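(* Let $\mathbf{P}\subseteq\mathbb{N}$. The following conditions are equivalent, and they imply that Problem 4 for $\mathbf{P}$ is computable: (1) $\mathbf{P}$ is ultimately periodic, i.e. there are $0<p$ and $d\in\mathbb{N}$ such that $n\in\mathbf{P}\leftrightarrow n+p\in\mathbf{P}$ for all $n>d$. (2) For every MLO formula $\psi(X,Y,P)$, either there is a finite state C-operator $F$ such that $\langle\mathbb{N},<\rangle\models\forall X\,\psi(X,F(X,\mathbf{P}),\mathbf{P})$, or there is a finite state SC-operator $G$ such that $\langle\mathbb{N},<\rangle\models\forall Y\,\neg\psi(G(Y,\mathbf{P}),Y,\mathbf{P})$.
   Context: MLO is monadic second-order logic over $<$ and unary predicate symbols, interpreted in structures $\langle\mathbb{N},<,\mathbf{P}\rangle$; set variables range over subsets of $\mathbb{N}$, identified with $\omega$-strings over $\{0,1\}$. An operator is a map $F:\Sigma_1^\omega\to\Sigma_2^\omega$ ($\Sigma_i$ finite); an operator of two arguments $F(X,P)$ is regarded as an operator on $\omega$-strings over the product alphabet. $F$ is causal (C-operator) if whenever $X,X'$ coincide on $[0,t]$ then $F(X),F(X')$ coincide on $[0,t]$; strongly causal (SC-operator) if whenever $X,X'$ coincide on $[0,t)$ then $F(X),F(X')$ coincide on $[0,t]$. A C-operator is finite state if there are a finite set $Q$, $q_{init}\in Q$, $\delta:Q\times\Sigma_1\to Q$ (extended to strings) and $out:Q\times\Sigma_1\to\Sigma_2$ such that the $i$-th letter of $F(a_0a_1\dots)$ is $out(\delta(q_{init},a_0\dots a_{i-1}),a_i)$;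 an SC-operator is finite state if the same holds with $out:Q\to\Sigma_2$ and $i$-th letter $out(\delta(q_{init},a_0\dots a_{i-1}))$. Problem 4 for $\mathbf{P}$: given an MLO formula $\psi(X,Y,P)$, decide whether there is a finite state C-operator $Y=F(X,P)$ with $\langle\mathbb{N},<\rangle\models\forall X\,\psi(X,F(X,\mathbf{P}),\mathbf{P})$, and if so construct it. It is computable if some algorithm solves it for all inputs. *)

theory Defs
  imports Main "HOL-Library.Nat_Bijection"
begin

subsection \<open>Monadic second-order logic of order\<close>

text \<open>Individual variables and set variables live in separate name spaces; both are indexed by
  natural numbers. The remaining connectives and quantifiers are definable as usual.\<close>

datatype mlo =
    Less nat nat
  | Equal nat nat
  | Mem nat nat  \<comment> \<open>individual variable, set variable\<close>
  | Neg mlo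
  | Conj mlo mlo
  | ExI nat mlo
  | ExS nat mlo

fun sat :: "(nat \<Rightarrow> nat) \<Rightarrow> (nat \<Rightarrow> nat set) \<Rightarrow> mlo \<Rightarrow> bool" where
  "sat u V (Less x y) \<longleftrightarrow> u x < u y"
| "sat u V (Equal x y) \<longleftrightarrow> u x = u y"
| "sat u V (Mem x X) \<longleftrightarrow> u x \<in> V X"
| "sat u V (Neg \<phi>) \<longleftrightarrow> \<not> sat u V \<phi>"
| "sat u V (Conj \<phi> \<chi>) \<longleftrightarrow> sat u V \<phi> \<and> sat u V \<chi>"
| "sat u V (ExI x \<phi>) \<longleftrightarrow> (\<exists>t. sat (u(x := t)) V \<phi>)"
| "sat u V (ExS X \<phi>) \<longleftrightarrow> (\<exists>S. sat u (V(X := S)) \<phi>)"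

fun free_ind :: "mlo \<Rightarrow> nat set" where
  "free_ind (Less x y) = {x, y}"
| "free_ind (Equal x y) = {x, y}"
| "free_ind (Mem x X) = {x}"
| "free_ind (Neg \<phi>) = free_ind \<phi>"
| "free_ind (Conj \<phi> \<chi>) = free_ind \<phi> \<union> free_ind \<chi>"
| "free_ind (ExI x \<phi>) = free_ind \<phi> - {x}"
| "free_ind (ExS X \<phi>) = free_ind \<phi>"

fun free_set :: "mlo \<Rightarrow> nat set" where
  "free_set (Less x y) = {}"
| "free_set (Equal x y) = {}"
| "free_set (Mem x X) = {X}"
| "free_set (Neg \<phi>) = free_set \<phi>"
| "free_set (Conj \<phi> \<chi>) = free_set \<phi> \<union> free_set \<chi>"
| "free_set (ExI x \<phi>) = free_set \<phi>"
| "free_set (ExS X \<phi>) = free_set \<phi> - {X}"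

text \<open>A formula \<open>\<psi>(X,Y,P)\<close> is one whose only free variables are the set variables
  \<open>X\<close>, \<open>Y\<close>, \<open>P\<close>, which are taken to be the set variables number 0, 1, 2. The default values
  in \<open>holds\<close> for the other variables are therefore irrelevant.\<close>

definition formula_XYP :: "mlo \<Rightarrow> bool" where
  "formula_XYP \<psi> \<longleftrightarrow> free_ind \<psi> = {} \<and> free_set \<psi> \<subseteq> {0, 1, 2}"

definition holds :: "mlo \<Rightarrow> nat set \<Rightarrow> nat set \<Rightarrow> nat set \<Rightarrow> bool" where
  "holds \<psi> X Y P \<longleftrightarrow> sat (\<lambda>_. 0) ((\<lambda>_. {})(0 := X, 1 := Y, 2 := P)) \<psi>"


subsection \<open>Causal and finite state operators\<close>

type_synonym 'a omega_string = "nat \<Rightarrow> 'a"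

type_synonym ('a, 'b) operator = "'a omega_string \<Rightarrow> 'b omega_string"

definition causal :: "('a, 'b) operator \<Rightarrow> bool" where
  "causal F \<longleftrightarrow> (\<forall>a a' t. (\<forall>i\<le>t. a i = a' i) \<longrightarrow> (\<forall>i\<le>t. F a i = F a' i))"

definition strongly_causal :: "('a, 'b) operator \<Rightarrow> bool" where
  "strongly_causal F \<longleftrightarrow> (\<forall>a a' t. (\<forall>i<t. a i = a' i) \<longrightarrow> (\<forall>i\<le>t. F a i = F a' i))"

definition state_after :: "('q \<Rightarrow> 'a \<Rightarrow> 'q) \<Rightarrow> 'q \<Rightarrow> 'a omega_string \<Rightarrow> nat \<Rightarrow> 'q" where
  "state_after \<delta> q a i = foldl \<delta> q (map a [0..<i])"

definition transition_system :: "'q set \<Rightarrow> 'q \<Rightarrow> ('q \<Rightarrow> 'a \<Rightarrow> 'q) \<Rightarrow> bool" where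
  "transition_system Q q0 \<delta> \<longleftrightarrow> finite Q \<and> q0 \<in> Q \<and> (\<forall>q\<in>Q. \<forall>a. \<delta> q a \<in> Q)"

definition mealy ::
  "'q set \<Rightarrow> 'q \<Rightarrow> ('q \<Rightarrow> 'a \<Rightarrow> 'q) \<Rightarrow> ('q \<Rightarrow> 'a \<Rightarrow> 'b) \<Rightarrow> ('a, 'b) operator \<Rightarrow> bool" where
  "mealy Q q0 \<delta> out F \<longleftrightarrow>
     transition_system Q q0 \<delta> \<and> (\<forall>a i. F a i = out (state_after \<delta> q0 a i) (a i))"

definition moore ::
  "'q set \<Rightarrow> 'q \<Rightarrow> ('q \<Rightarrow> 'a \<Rightarrow> 'q) \<Rightarrow> ('q \<Rightarrow> 'b) \<Rightarrow> ('a, 'b) operator \<Rightarrow> bool" where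
  "moore Q q0 \<delta> out F \<longleftrightarrow>
     transition_system Q q0 \<delta> \<and> (\<forall>a i. F a i = out (state_after \<delta> q0 a i))"

text \<open>States are natural numbers, which is no restriction since the set of states is finite.\<close>

definition finite_state_C :: "('a::finite, 'b::finite) operator \<Rightarrow> bool" where
  "finite_state_C F \<longleftrightarrow> causal F \<and> (\<exists>(Q :: nat set) q0 \<delta> out. mealy Q q0 \<delta> out F)"

definition finite_state_SC :: "('a::finite, 'b::finite) operator \<Rightarrow> bool" where
  "finite_state_SC F \<longleftrightarrow> strongly_causal F \<and> (\<exists>(Q :: nat set) q0 \<delta> out. moore Q q0 \<delta> out F)"

text \<open>An operator of two arguments is an operator over the product alphabet; sets of natural
  numbers are identified with their characteristic strings.\<close>

type_synonym operator2 = "(bool \<times> bool, bool) operator"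

definition apply2 :: "operator2 \<Rightarrow> nat set \<Rightarrow> nat set \<Rightarrow> nat set" where
  "apply2 F X P = {t. F (\<lambda>s. (s \<in> X, s \<in> P)) t}"

definition C_solution :: "mlo \<Rightarrow> nat set \<Rightarrow> operator2 \<Rightarrow> bool" where
  "C_solution \<psi> P F \<longleftrightarrow> finite_state_C F \<and> (\<forall>X. holds \<psi> X (apply2 F X P) P)"

definition ultimately_periodic :: "nat set \<Rightarrow> bool" where
  "ultimately_periodic P \<longleftrightarrow> (\<exists>p>0. \<exists>d. \<forall>n>d. n \<in> P \<longleftrightarrow> n + p \<in> P)"


subsection \<open>Computable functions\<close>

text \<open>Partial recursive functions of one argument; several arguments are passed through the
  pairing function \<open>prod_encode\<close>.\<close>

definition minimize :: "(nat \<Rightarrow> nat option) \<Rightarrow> nat option" where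
  "minimize h =
     (if \<exists>n. h n = Some 0 \<and> (\<forall>m<n. \<exists>k. h m = Some (Suc k))
      then Some (LEAST n. h n = Some 0) else None)"

inductive partial_recursive :: "(nat \<Rightarrow> nat option) \<Rightarrow> bool" where
  zero: "partial_recursive (\<lambda>_. Some 0)"
| succ: "partial_recursive (\<lambda>n. Some (Suc n))"
| left: "partial_recursive (\<lambda>n. Some (fst (prod_decode n)))"
| right: "partial_recursive (\<lambda>n. Some (snd (prod_decode n)))"
| pair: "partial_recursive f \<Longrightarrow> partial_recursive g \<Longrightarrow>
    partial_recursive (\<lambda>n. Option.bind (f n) (\<lambda>a. Option.bind (g n) (\<lambda>b. Some (prod_encode (a, b)))))"
| comp: "partial_recursive f \<Longrightarrow> partial_recursive g \<Longrightarrow>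
    partial_recursive (\<lambda>n. Option.bind (g n) f)"
| prim_rec: "partial_recursive f \<Longrightarrow> partial_recursive g \<Longrightarrow>
    partial_recursive (\<lambda>n. case prod_decode n of (a, m) \<Rightarrow>
      rec_nat (f a) (\<lambda>k r. Option.bind r (\<lambda>b. g (prod_encode (a, prod_encode (k, b))))) m)"
| minimization: "partial_recursive f \<Longrightarrow>
    partial_recursive (\<lambda>a. minimize (\<lambda>n. f (prod_encode (a, n))))"

definition computable :: "(nat \<Rightarrow> nat) \<Rightarrow> bool" where
  "computable h \<longleftrightarrow> partial_recursive (\<lambda>n. Some (h n))"


subsection \<open>Codes of formulas and of finite state operators\<close>

fun mlo_code :: "mlo \<Rightarrow> nat" where
  "mlo_code (Less x y) = prod_encode (0, prod_encode (x, y))"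
| "mlo_code (Equal x y) = prod_encode (1, prod_encode (x, y))"
| "mlo_code (Mem x X) = prod_encode (2, prod_encode (x, X))"
| "mlo_code (Neg \<phi>) = prod_encode (3, mlo_code \<phi>)"
| "mlo_code (Conj \<phi> \<chi>) = prod_encode (4, prod_encode (mlo_code \<phi>, mlo_code \<chi>))"
| "mlo_code (ExI x \<phi>) = prod_encode (5, prod_encode (x, mlo_code \<phi>))"
| "mlo_code (ExS X \<phi>) = prod_encode (6, prod_encode (X, mlo_code \<phi>))"

lemma mlo_code_inject: "mlo_code \<phi> = mlo_code \<chi> \<longleftrightarrow> \<phi> = \<chi>"
  by (induction \<phi> arbitrary: \<chi>; case_tac \<chi>) auto

text \<open>A finite state C-operator on strings over \<open>bool \<times> bool\<close> is presented by its initial state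
  and its table. The states are the numbers below \<open>n\<close>, the table has \<open>4 * n\<close> entries, and the
  entry for state \<open>q\<close> and letter \<open>(x, p)\<close> at position \<open>4 * q + 2 * of_bool x + of_bool p\<close>
  consists of the next state and the output letter.\<close>

type_synonym machine_table = "nat \<times> (nat \<times> bool) list"

definition entry :: "(nat \<times> bool) list \<Rightarrow> nat \<Rightarrow> bool \<times> bool \<Rightarrow> nat \<times> bool" where
  "entry es q a = es ! (4 * q + 2 * of_bool (fst a) + of_bool (snd a))"

definition presents :: "machine_table \<Rightarrow> operator2 \<Rightarrow> bool" where
  "presents T F \<longleftrightarrow> (case T of (q0, es) \<Rightarrow>
     \<exists>n. length es = 4 * n \<and>
       mealy {..<n} q0 (\<lambda>q a. fst (entry es q a)) (\<lambda>q a. snd (entry es q a)) F)"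

definition machine_code :: "machine_table \<Rightarrow> nat" where
  "machine_code T = (case T of (q0, es) \<Rightarrow>
     prod_encode (q0, list_encode (map (\<lambda>(q, b). prod_encode (q, of_bool b)) es)))"

lemma machine_code_inject: "machine_code T = machine_code T' \<longleftrightarrow> T = T'"
proof -
  have "inj (\<lambda>(q, b). prod_encode (q, of_bool b))"
    by (auto simp: inj_def)
  then show ?thesis
    by (auto simp: machine_code_def list_encode_eq inj_map_eq_map split: prod.splits)
qed

text \<open>The algorithm answers \<open>0\<close> if there is no solution; otherwise it returns the code, increased
  by one, of a table presenting a solution.\<close>

definition Problem4_computable :: "nat set \<Rightarrow> bool" where
  "Problem4_computable P \<longleftrightarrow>
     (\<exists>h. computable h \<and>
       (\<forall>\<psi>. formula_XYP \<psi> \<longrightarrow>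
         (if \<exists>F. C_solution \<psi> P F
          then \<exists>T F. h (mlo_code \<psi>) = Suc (machine_code T) \<and> presents T F \<and> C_solution \<psi> P F
          else h (mlo_code \<psi>) = 0)))"

end

theory Submission
  imports Defs "HOL-Library.Ramsey"
begin

text \<open>Suppose that \<open>P\<close> is ultimately periodic. By induction on formulas, every formula is recognised
  by a finite set of types of finite words (a Boolean combination is treated componentwise, a
  quantifier by taking sets of types): two infinite words that can be cut into blocks of the same
  types satisfy the same formulas. From such a finite monoid one obtains a deterministic parity
  automaton by following, in the order of their age, the classes of positions that have merged, i.e.
  whose distances to the present have the same type. The resulting finite parity game, whose arena
  also records the residual of \<open>P\<close>, is positionally determined; a winning strategy of the player
  choosing \<open>Y\<close> is a Mealy machine, one of the player choosing \<open>X\<close> is a Moore machine.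

  Since exactly one of the players has such a machine, Problem 4 is solved by searching for it. A
  candidate is verified on ultimately periodic inputs only: by Ramsey's theorem it suffices
  to test stems of length \<open>2 N\<close> and loops of length \<open>N\<close>, where \<open>N\<close> is such that every run of length
  \<open>2 N\<close> has the type of a run of length \<open>N\<close>. In this test a quantifier ranges over finitely many words,
  so that the test is recursive.

  Conversely, for the formula saying that \<open>Y\<close> predicts the next value of \<open>P\<close>, the second alternative
  is refuted by the shift of \<open>P\<close>; and a finite state operator satisfying the formula generates \<open>P\<close> from its
  own output, which makes \<open>P\<close> ultimately periodic.\<close>

section \<open>Parity games\<close>

text \<open>The algorithm builds neither monoid nor automaton nor game; these only show that one of
  the players has a machine, which makes the search terminate. Only the test of a given machine has
  to be computable, and this shapes the second half: types are numbers, variants form lists, and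
  truth is evaluated on pairs \<open>u\<close>, \<open>v\<close> such that \<open>u @ v\<close> has
  the type of \<open>u\<close> and \<open>v @ v\<close> that of \<open>v\<close>. A machine of one
  player excludes one of the other by a fixed point: a Moore machine fed into a Mealy machine is
  strongly causal, so both follow one common play. The length \<open>N\<close> is a multiple of the
  period of the residuals of \<open>P\<close>, so that runs starting at \<open>N\<close>,
  \<open>2 N\<close>, ... face the same parameter; it exists by Ramsey's theorem again, for the sets
  of triples (state, type, state) realised by runs of a given length. In the automaton, age matters
  because a merge keeps the older representative: below the oldest position that absorbs others for
  ever nothing changes in the end, so its rank freezes and its colour becomes the least recurring
  one.\<close>

definition parity :: "bool \<Rightarrow> (nat \<Rightarrow> nat) \<Rightarrow> bool" where
  "parity i c \<longleftrightarrow> (\<exists>k. even k = i \<and> (\<forall>m. \<exists>n\<ge>m. c n = k) \<and> (\<exists>m. \<forall>n\<ge>m. k \<le> c n))"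

lemma parity_suffix: "parity i (\<lambda>n. c (n + l)) \<Longrightarrow> parity i c"
proof -
  assume "parity i (\<lambda>n. c (n + l))"
  then obtain k m where k: "even k = i" "\<forall>m. \<exists>n\<ge>m. c (n + l) = k" "\<forall>n\<ge>m. k \<le> c (n + l)"
    unfolding parity_def by blast
  have "\<exists>n\<ge>m'. c n = k" for m'
    using k(2) by (meson le_add1 le_trans)
  moreover have "\<forall>n\<ge>m + l. k \<le> c n"
    using k(3) by (metis add_le_imp_le_right le_add2 le_add_diff_inverse2 le_trans)
  ultimately show ?thesis
    using k(1) unfolding parity_def by blast
qed

text \<open>Each witness recurs, so it respects the eventual lower bound given by the other: both
  are the limit inferior of the colours.\<close>

lemma parity_exclusive:
  assumes "parity True c" "parity False c"
  shows False
proof -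
  obtain k m k' m' where k: "even k" "\<forall>m. \<exists>n\<ge>m. c n = k" "\<forall>n\<ge>m. k \<le> c n"
    and k': "odd k'" "\<forall>m. \<exists>n\<ge>m. c n = k'" "\<forall>n\<ge>m'. k' \<le> c n"
    using assms unfolding parity_def by auto
  have "k \<le> k'" "k' \<le> k"
    using k(2,3) k'(2,3) by blast+
  then show False
    using k(1) k'(1) by simp
qed

section \<open>Positional strategies, attractors and traps\<close>

locale arena =
  fixes own :: "'v \<Rightarrow> bool" and E :: "'v \<Rightarrow> 'v \<Rightarrow> bool" and col :: "'v \<Rightarrow> nat"
begin

definition play :: "bool \<Rightarrow> ('v \<Rightarrow> 'v) \<Rightarrow> 'v set \<Rightarrow> (nat \<Rightarrow> 'v) \<Rightarrow> bool" where
  "play i \<sigma> W \<pi> \<longleftrightarrow>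
     (\<forall>n. \<pi> n \<in> W \<and> E (\<pi> n) (\<pi> (Suc n)) \<and> (own (\<pi> n) = i \<longrightarrow> \<pi> (Suc n) = \<sigma> (\<pi> n)))"

text \<open>A subarena is given by its vertex set \<open>A\<close>. Closure of \<open>W\<close>
  under \<open>\<sigma>\<close> and under all opposing moves inside \<open>A\<close> is what allows
  regions of different subarenas to be glued.\<close>

definition wins :: "'v set \<Rightarrow> bool \<Rightarrow> 'v set \<Rightarrow> ('v \<Rightarrow> 'v) \<Rightarrow> bool" where
  "wins A i W \<sigma> \<longleftrightarrow> W \<subseteq> A \<and>
     (\<forall>v\<in>W. if own v = i then E v (\<sigma> v) \<and> \<sigma> v \<in> W else \<forall>v'\<in>A. E v v' \<longrightarrow> v' \<in> W) \<and>
     (\<forall>\<pi>. play i \<sigma> W \<pi> \<longrightarrow> parity i (col \<circ> \<pi>))"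

text \<open>The rank \<open>r\<close> is a certificate that \<open>N\<close> is reached; it replaces
  the usual iteration of predecessor sets.\<close>

definition attracts :: "'v set \<Rightarrow> bool \<Rightarrow> 'v set \<Rightarrow> 'v set \<Rightarrow> ('v \<Rightarrow> nat) \<Rightarrow> ('v \<Rightarrow> 'v) \<Rightarrow> bool" where
  "attracts A i N X r \<sigma> \<longleftrightarrow> N \<subseteq> X \<and> X \<subseteq> A \<and>
     (\<forall>v\<in>X - N. if own v = i then E v (\<sigma> v) \<and> \<sigma> v \<in> X \<and> r (\<sigma> v) < r v
        else \<forall>v'\<in>A. E v v' \<longrightarrow> v' \<in> X \<and> r v' < r v)"

text \<open>It is the complement \<open>A - X\<close> that is the trap: player \<open>i\<close>
  cannot leave it, and the other player can stay in it.\<close>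

definition trap :: "'v set \<Rightarrow> bool \<Rightarrow> 'v set \<Rightarrow> bool" where
  "trap A i X \<longleftrightarrow> (\<forall>v\<in>A - X. if own v = i then \<forall>v'\<in>A. E v v' \<longrightarrow> v' \<notin> X
     else \<exists>v'\<in>A - X. E v v')"

lemma wins_own: "wins A i W \<sigma> \<Longrightarrow> v \<in> W \<Longrightarrow> own v = i \<Longrightarrow> E v (\<sigma> v) \<and> \<sigma> v \<in> W"
  and wins_other: "wins A i W \<sigma> \<Longrightarrow> v \<in> W \<Longrightarrow> own v \<noteq> i \<Longrightarrow> v' \<in> A \<Longrightarrow> E v v' \<Longrightarrow> v' \<in> W"
  and wins_subset: "wins A i W \<sigma> \<Longrightarrow> W \<subseteq> A"
  unfolding wins_def by (auto split: if_splits)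

lemma attracts_own: "attracts A i N X r \<sigma> \<Longrightarrow> v \<in> X - N \<Longrightarrow> own v = i \<Longrightarrow>
    E v (\<sigma> v) \<and> \<sigma> v \<in> X \<and> r (\<sigma> v) < r v"
  and attracts_other: "attracts A i N X r \<sigma> \<Longrightarrow> v \<in> X - N \<Longrightarrow> own v \<noteq> i \<Longrightarrow> v' \<in> A \<Longrightarrow> E v v' \<Longrightarrow>
    v' \<in> X \<and> r v' < r v"
  and attracts_subset: "attracts A i N X r \<sigma> \<Longrightarrow> N \<subseteq> X \<and> X \<subseteq> A"
  unfolding attracts_def by (auto split: if_splits)

lemma trap_own: "trap A i X \<Longrightarrow> v \<in> A - X \<Longrightarrow> own v = i \<Longrightarrow> v' \<in> A \<Longrightarrow> E v v' \<Longrightarrow> v' \<notin> X"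
  unfolding trap_def by (auto split: if_splits)

lemma trap_total:
  assumes "trap A i X" "\<forall>v\<in>A. \<exists>v'\<in>A. E v v'" "v \<in> A - X"
  shows "\<exists>v'\<in>A - X. E v v'"
proof (cases "own v = i")
  case True
  then show ?thesis
    using trap_own[OF assms(1,3)] assms(2,3) by blast
next
  case False
  then show ?thesis
    using assms(1,3) unfolding trap_def by auto
qed

text \<open>Since \<open>A\<close> is finite, there is a maximal set with a rank certificate. A
  vertex violating the trap condition could be added to it with a rank above all others.\<close>

lemma attractor:
  assumes "finite A" "N \<subseteq> A"
  obtains X r \<sigma> where "attracts A i N X r \<sigma>" "trap A i X"
proof -
  let ?good = "{X. X \<subseteq> A \<and> (\<exists>r \<sigma>. attracts A i N X r \<sigma>)}"
  have "finite ?good"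
    by (rule finite_subset[of _ "Pow A"]) (blast, simp add: assms(1))
  moreover have "attracts A i N N r \<sigma>" for r \<sigma>
    using assms(2) unfolding attracts_def by simp
  then have "N \<in> ?good"
    using assms(2) by blast
  ultimately have "\<exists>X\<in>?good. N \<subseteq> X \<and> (\<forall>Y\<in>?good. X \<subseteq> Y \<longrightarrow> X = Y)"
    by (rule finite_has_maximal2)
  then obtain X where X: "X \<in> ?good" "\<forall>Y\<in>?good. X \<subseteq> Y \<longrightarrow> X = Y"
    by (elim bexE conjE)
  then obtain r \<sigma> where att: "attracts A i N X r \<sigma>"
    by blast
  have XA: "X \<subseteq> A" "finite X"
    using X(1) assms(1) finite_subset by auto
  have ext: False
    if v: "v \<in> A - X"
      and step: "if own v = i then \<exists>v'\<in>X. E v v' else \<forall>v'\<in>A. E v v' \<longrightarrow> v' \<in> X" for v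
  proof -
    obtain v' where v': "own v = i \<Longrightarrow> v' \<in> X \<and> E v v'"
      using step by metis
    define m where "m = Suc (Max (r ` X \<union> {0}))"
    have m: "r x < m" if "x \<in> X" for x
      unfolding m_def using XA that by (simp add: less_Suc_eq_le)
    have "attracts A i N (insert v X) (r(v := m)) (\<sigma>(v := v'))"
      unfolding attracts_def
    proof (intro conjI ballI)
      show "N \<subseteq> insert v X" "insert v X \<subseteq> A"
        using att v by (auto simp: attracts_def)
      fix x assume x: "x \<in> insert v X - N"
      show "if own x = i then E x ((\<sigma>(v := v')) x) \<and> (\<sigma>(v := v')) x \<in> insert v X
            \<and> (r(v := m)) ((\<sigma>(v := v')) x) < (r(v := m)) x
          else \<forall>x'\<in>A. E x x' \<longrightarrow> x' \<in> insert v X \<and> (r(v := m)) x' < (r(v := m)) x"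
      proof (cases "x = v")
        case True
        then show ?thesis
          using v' m step v by (auto split: if_splits)
      next
        case False
        then have "x \<in> X - N" using x by auto
        then have *: "if own x = i then E x (\<sigma> x) \<and> \<sigma> x \<in> X \<and> r (\<sigma> x) < r x
            else \<forall>v'\<in>A. E x v' \<longrightarrow> v' \<in> X \<and> r v' < r x"
          using att unfolding attracts_def by blast
        show ?thesis
          using * False v by (auto split: if_splits)
      qed
    qed
    moreover have "insert v X \<subseteq> A"
      using v XA by auto
    ultimately have "insert v X \<in> ?good"
      by blast
    then have "X = insert v X"
      using X(2) by blast
    then show False
      using v by blast
  qed
  have "trap A i X"
    unfolding trap_def
  proof
    fix v assume v: "v \<in> A - X"
    have "\<not> (if own v = i then \<exists>v'\<in>X. E v v' else \<forall>v'\<in>A. E v v' \<longrightarrow> v' \<in> X)"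
      using ext[OF v] by blast
    then show "if own v = i then \<forall>v'\<in>A. E v v' \<longrightarrow> v' \<notin> X else \<exists>v'\<in>A - X. E v v'"
      by (auto split: if_splits)
  qed
  then show thesis
    using att that by blast
qed

lemma attracted_reaches:
  assumes att: "attracts A i N X r \<sigma>"
    and play: "\<And>n. \<pi> n \<in> A" "\<And>n. E (\<pi> n) (\<pi> (Suc n))"
      "\<And>n. \<pi> n \<in> X - N \<Longrightarrow> own (\<pi> n) = i \<Longrightarrow> \<pi> (Suc n) = \<sigma> (\<pi> n)"
    and "\<pi> m \<in> X"
  shows "\<exists>n\<ge>m. \<pi> n \<in> N"
  using assms(5)
proof (induction "r (\<pi> m)" arbitrary: m rule: less_induct)
  case less
  show ?case
  proof (cases "\<pi> m \<in> N")
    case False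
    then have "\<pi> m \<in> X - N"
      using less.prems by blast
    then have *: "if own (\<pi> m) = i then E (\<pi> m) (\<sigma> (\<pi> m)) \<and> \<sigma> (\<pi> m) \<in> X \<and> r (\<sigma> (\<pi> m)) < r (\<pi> m)
        else \<forall>v'\<in>A. E (\<pi> m) v' \<longrightarrow> v' \<in> X \<and> r v' < r (\<pi> m)"
      using att unfolding attracts_def by blast
    have "\<pi> (Suc m) \<in> X \<and> r (\<pi> (Suc m)) < r (\<pi> m)"
    proof (cases "own (\<pi> m) = i")
      case True
      then show ?thesis
        using * play(3)[OF \<open>\<pi> m \<in> X - N\<close> True] by simp
    next
      case False
      then show ?thesis
        using * play(1,2) by simp
    qed
    then obtain n where "n \<ge> Suc m" "\<pi> n \<in> N"
      using less.hyps by blast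
    then show ?thesis
      using Suc_leD by blast
  qed blast
qed

lemma parity_play_suffix:
  assumes "wins A i W \<sigma>" "\<And>n. n \<ge> l \<Longrightarrow> \<pi> n \<in> W" "\<And>n. E (\<pi> n) (\<pi> (Suc n))"
    "\<And>n. n \<ge> l \<Longrightarrow> own (\<pi> n) = i \<Longrightarrow> \<pi> (Suc n) = \<sigma> (\<pi> n)"
  shows "parity i (col \<circ> \<pi>)"
proof -
  have "play i \<sigma> W (\<lambda>n. \<pi> (n + l))"
    unfolding play_def using assms(2-4) by simp
  then have "parity i (col \<circ> (\<lambda>n. \<pi> (n + l)))"
    using assms(1) unfolding wins_def by blast
  then have "parity i (\<lambda>n. (col \<circ> \<pi>) (n + l))"
    by (simp add: comp_def)
  then show ?thesis
    by (rule parity_suffix)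
qed

text \<open>Either the play returns to \<open>X\<close> for ever and so meets the least colour
  \<open>d\<close> infinitely often, or it ends up in \<open>A - X\<close>, where
  \<open>\<sigma>\<close> wins.\<close>

lemma wins_all_of_attractor:
  assumes tot: "\<forall>v\<in>A. \<exists>v'\<in>A. E v v'" and d: "even d = i" "\<forall>v\<in>A. d \<le> col v"
    and att: "attracts A i {v \<in> A. col v = d} X r \<rho>" and wins: "wins (A - X) i (A - X) \<sigma>"
  shows "\<exists>\<sigma>. wins A i A \<sigma>"
proof -
  obtain nx where nx: "\<And>v. v \<in> A \<Longrightarrow> nx v \<in> A \<and> E v (nx v)"
    using tot by metis
  have XA: "X \<subseteq> A"
    using att by (auto simp: attracts_def)
  \<comment> \<open>On vertices of colour \<open>d\<close> the attractor gives no advice; there any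
    move inside \<open>A\<close> will do.\<close>
  define \<tau> where "\<tau> v = (if v \<notin> X then \<sigma> v else if col v = d then nx v else \<rho> v)" for v
  have "E v (\<tau> v) \<and> \<tau> v \<in> A" if "v \<in> A" "own v = i" for v
  proof -
    have "E v (\<sigma> v) \<and> \<sigma> v \<in> A - X" if "v \<notin> X"
      using wins_own[OF wins] that \<open>v \<in> A\<close> \<open>own v = i\<close> by blast
    moreover have "E v (\<rho> v) \<and> \<rho> v \<in> X" if "v \<in> X" "col v \<noteq> d"
      using attracts_own[OF att] that \<open>own v = i\<close> by blast
    ultimately show ?thesis
      using nx that(1) XA unfolding \<tau>_def by auto
  qed
  moreover have "parity i (col \<circ> \<pi>)" if "play i \<tau> A \<pi>" for \<pi>
  proof (cases "\<forall>m. \<exists>n\<ge>m. \<pi> n \<in> X")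
    case True
    have "\<exists>n\<ge>m. \<pi> n \<in> {v \<in> A. col v = d}" for m
    proof -
      obtain m' where "m' \<ge> m" "\<pi> m' \<in> X"
        using True by blast
      moreover have "\<exists>n\<ge>m'. \<pi> n \<in> {v \<in> A. col v = d}"
        by (rule attracted_reaches[OF att])
           (use that \<open>\<pi> m' \<in> X\<close> in \<open>auto simp: play_def \<tau>_def\<close>)
      ultimately show ?thesis
        using le_trans by blast
    qed
    then show ?thesis
      unfolding parity_def using d that by (intro exI[of _ d]) (auto simp: play_def)
  next
    case False
    then obtain l where "\<And>n. n \<ge> l \<Longrightarrow> \<pi> n \<notin> X"
      by blast
    then show ?thesis
      by (intro parity_play_suffix[OF wins, of l]) (use that in \<open>auto simp: play_def \<tau>_def\<close>)
  qed
  ultimately have "wins A i A \<tau>"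
    unfolding wins_def by auto
  then show ?thesis by blast
qed

text \<open>The opponent has no edge from \<open>A - Y\<close> into \<open>Y\<close>, so closure
  inside \<open>A - Y\<close> is already closure inside \<open>A\<close>.\<close>

lemma wins_region_in_trap:
  assumes "trap A (\<not> i) Y" "wins (A - Y) i W \<sigma>"
  shows "wins A i W \<sigma>"
  unfolding wins_def
proof (intro conjI ballI)
  show "W \<subseteq> A" "\<forall>\<pi>. play i \<sigma> W \<pi> \<longrightarrow> parity i (col \<circ> \<pi>)"
    using assms(2) unfolding wins_def by auto
  fix v assume v: "v \<in> W"
  then have "v \<in> A - Y"
    using wins_subset[OF assms(2)] by blast
  then show "if own v = i then E v (\<sigma> v) \<and> \<sigma> v \<in> W else \<forall>v'\<in>A. E v v' \<longrightarrow> v' \<in> W"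
    using wins_own[OF assms(2) v] wins_other[OF assms(2) v] trap_own[OF assms(1), of v] by auto
qed

text \<open>From \<open>U\<close> the opponent cannot flee into \<open>X\<close>. Hence a play that
  ever enters \<open>Y\<close> is drawn into \<open>U\<close> and stays there; any other play
  remains in \<open>W\<close>.\<close>

lemma wins_union_of_attractor:
  assumes trapX: "trap A (\<not> i) X" and U: "wins (A - X) i U \<sigma>"
    and att: "attracts A i U Y r \<rho>" and W: "wins (A - Y) i W \<tau>"
  shows "\<exists>\<sigma>. wins A i (Y \<union> W) \<sigma>"
proof -
  define \<omega> where "\<omega> v = (if v \<in> U then \<sigma> v else if v \<in> Y then \<rho> v else \<tau> v)" for v
  have sub: "U \<subseteq> Y" "Y \<subseteq> A" "W \<subseteq> A - Y" "U \<subseteq> A - X"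
    using att U W by (auto simp: attracts_def wins_def)
  have U_closed: "v' \<in> U" if "v \<in> U" "v' \<in> A" "E v v'" "own v = i \<longrightarrow> v' = \<omega> v" for v v'
  proof (cases "own v = i")
    case True
    then have "\<sigma> v \<in> U"
      using wins_own[OF U] that(1) by blast
    then show ?thesis
      using that True by (simp add: \<omega>_def)
  next
    case False
    have "v' \<notin> X"
      using trap_own[OF trapX] that sub False by blast
    then show ?thesis
      using wins_other[OF U] that False by blast
  qed
  have Y_closed: "v' \<in> Y" if "v \<in> Y" "v' \<in> A" "E v v'" "own v = i \<longrightarrow> v' = \<omega> v" for v v'
  proof (cases "v \<in> U")
    case True
    then show ?thesis
      using U_closed that sub by blast
  next
    case False
    then show ?thesis
      using that attracts_own[OF att, of v] attracts_other[OF att, of v] unfolding \<omega>_def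
      by (cases "own v = i") auto
  qed
  have W_closed: "v' \<in> W" if "v \<in> W" "v' \<in> A" "E v v'" "v' \<notin> Y" "own v = i \<longrightarrow> v' = \<omega> v" for v v'
    using wins_own[OF W, of v] wins_other[OF W, of v] that sub unfolding \<omega>_def
    by (cases "own v = i") auto
  have move: "E v (\<omega> v) \<and> \<omega> v \<in> Y \<union> W" if "v \<in> Y \<union> W" "own v = i" for v
  proof -
    have "E v (\<sigma> v) \<and> \<sigma> v \<in> U" if "v \<in> U"
      using wins_own[OF U] that \<open>own v = i\<close> by blast
    moreover have "E v (\<rho> v) \<and> \<rho> v \<in> Y" if "v \<in> Y - U"
      using attracts_own[OF att] that \<open>own v = i\<close> by blast
    moreover have "E v (\<tau> v) \<and> \<tau> v \<in> W" if "v \<in> W"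
      using wins_own[OF W] that \<open>own v = i\<close> by blast
    ultimately show ?thesis
      using that sub unfolding \<omega>_def by auto
  qed
  have "parity i (col \<circ> \<pi>)" if play: "play i \<omega> (Y \<union> W) \<pi>" for \<pi>
  proof -
    have \<pi>: "\<pi> n \<in> Y \<union> W" "\<pi> n \<in> A" "E (\<pi> n) (\<pi> (Suc n))" "own (\<pi> n) = i \<longrightarrow> \<pi> (Suc n) = \<omega> (\<pi> n)" for n
      using play sub unfolding play_def by auto
    show ?thesis
    proof (cases "\<exists>m. \<pi> m \<in> Y")
      case True
      then obtain m where m: "\<pi> m \<in> Y" by blast
      have "\<exists>l\<ge>m. \<pi> l \<in> U"
        by (rule attracted_reaches[OF att])
           (use \<pi> sub m in \<open>auto simp: \<omega>_def\<close>)
      then obtain l where l: "\<pi> l \<in> U" by blast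
      have inU: "\<pi> n \<in> U" if "n \<ge> l" for n
        using that
      proof (induction n rule: dec_induct)
        case base
        then show ?case using l by simp
      next
        case (step n)
        then show ?case using U_closed \<pi> by blast
      qed
      show ?thesis
        by (rule parity_play_suffix[OF U, of l]) (use inU \<pi> in \<open>auto simp: \<omega>_def\<close>)
    next
      case False
      show ?thesis
        by (rule parity_play_suffix[OF W, of 0]) (use False \<pi> sub in \<open>auto simp: \<omega>_def\<close>)
    qed
  qed
  moreover have "Y \<union> W \<subseteq> A"
    using sub by blast
  moreover have "v' \<in> Y \<union> W" if "v \<in> Y \<union> W" "own v \<noteq> i" "v' \<in> A" "E v v'" for v v'
    using that Y_closed W_closed by blast
  ultimately have "wins A i (Y \<union> W) \<omega>"
    unfolding wins_def using move by auto
  then show ?thesis by blast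
qed

text \<open>The recursion of McNaughton and Zielonka: solve the game without the attractor of the
  least colour; if the opponent of that colour wins somewhere, remove the attractor of the region
  won and solve the rest.\<close>

theorem positional_determinacy:
  assumes "finite A" "\<forall>v\<in>A. \<exists>v'\<in>A. E v v'"
  shows "\<exists>W \<sigma>. (\<Union>i. W i) = A \<and> (\<forall>i. wins A i (W i) (\<sigma> i))"
  using assms
proof (induction A rule: finite_psubset_induct)
  case (psubset A)
  show ?case
  proof (cases "A = {}")
    case True
    then have "wins A i {} \<sigma>" for i \<sigma>
      by (auto simp: wins_def play_def)
    then show ?thesis
      using True by (intro exI[of _ "\<lambda>_. {}"]) auto
  next
    case False
    define d where "d = Min (col ` A)"
    define i where "i = even d"
    let ?N = "{v \<in> A. col v = d}"
    have "d \<in> col ` A"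
      using False psubset.hyps unfolding d_def by (intro Min_in) auto
    then have d: "\<forall>v\<in>A. d \<le> col v" "?N \<noteq> {}"
      using psubset.hyps unfolding d_def by auto
    obtain X r \<rho> where X: "attracts A i ?N X r \<rho>" "trap A i X"
      using attractor[OF psubset.hyps, of ?N i] by blast
    then have "A - X \<subset> A"
      using d(2) unfolding attracts_def by blast
    moreover have "\<forall>v\<in>A - X. \<exists>v'\<in>A - X. E v v'"
      using trap_total[OF X(2)] psubset.prems by blast
    ultimately obtain W \<sigma> where W: "(\<Union>j. W j) = A - X" "\<forall>j. wins (A - X) j (W j) (\<sigma> j)"
      using psubset.IH[of "A - X"] by blast
    have un: "(\<Union>j. V j) = V i \<union> V (\<not> i)" for V :: "bool \<Rightarrow> 'v set"
    proof -
      have "(\<Union>j. V j) = V True \<union> V False"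
        by (simp add: UNIV_bool Un_commute)
      then show ?thesis
        by (cases i) auto
    qed
    show ?thesis
    proof (cases "W (\<not> i) = {}")
      case True
      then have "W i = A - X"
        using W(1) un[of W] by simp
      then obtain \<sigma>' where "wins A i A \<sigma>'"
        using wins_all_of_attractor[OF psubset.prems i_def[symmetric] d(1) X(1)] W(2) by metis
      moreover have "wins A (\<not> i) {} \<sigma>'"
        by (auto simp: wins_def play_def)
      ultimately have "wins A j (if j = i then A else {}) \<sigma>'" for j
        by (cases "j = i") auto
      then show ?thesis
        by (intro exI[of _ "\<lambda>j. if j = i then A else {}"] exI[of _ "\<lambda>_. \<sigma>'"]) auto
    next
      case False
      let ?U = "W (\<not> i)"
      have U: "wins (A - X) (\<not> i) ?U (\<sigma> (\<not> i))"
        using W by blast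
      then have "?U \<subseteq> A"
        unfolding wins_def by blast
      then obtain Y r' \<rho>' where Y: "attracts A (\<not> i) ?U Y r' \<rho>'" "trap A (\<not> i) Y"
        using attractor[OF psubset.hyps, of ?U "\<not> i"] by blast
      then have "A - Y \<subset> A"
        using False \<open>?U \<subseteq> A\<close> unfolding attracts_def by blast
      moreover have "\<forall>v\<in>A - Y. \<exists>v'\<in>A - Y. E v v'"
        using trap_total[OF Y(2)] psubset.prems by blast
      ultimately obtain V \<tau> where V: "(\<Union>j. V j) = A - Y" "\<forall>j. wins (A - Y) j (V j) (\<tau> j)"
        using psubset.IH[of "A - Y"] by blast
      have "\<exists>\<omega>. wins A (\<not> i) (Y \<union> V (\<not> i)) \<omega>"
        by (rule wins_union_of_attractor[OF _ U Y(1)]) (use X(2) V(2) in auto)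
      then obtain \<omega> where \<omega>: "wins A (\<not> i) (Y \<union> V (\<not> i)) \<omega>" ..
      have "wins A i (V i) (\<tau> i)"
        by (rule wins_region_in_trap[OF Y(2)]) (use V(2) in auto)
      with \<omega> have "wins A j (if j = i then V i else Y \<union> V (\<not> i)) (if j = i then \<tau> i else \<omega>)" for j
        by (cases "j = i") auto
      moreover have "(\<Union>j. if j = i then V i else Y \<union> V (\<not> i)) = A"
        using V(1) un[of V] un[of "\<lambda>j. if j = i then V i else Y \<union> V (\<not> i)"] Y(1)
        unfolding attracts_def by auto
      ultimately show ?thesis
        by (intro exI[of _ "\<lambda>j. if j = i then V i else Y \<union> V (\<not> i)"]
              exI[of _ "\<lambda>j. if j = i then \<tau> i else \<omega>"]) auto
    qed
  qed
qed

end

section \<open>From finite monoids to parity automata\<close>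

definition seg :: "(nat \<Rightarrow> 'a) \<Rightarrow> nat \<Rightarrow> nat \<Rightarrow> 'a list" where
  "seg w i j = map w [i..<j]"

lemma length_seg [simp]: "length (seg w i j) = j - i"
  by (simp add: seg_def)

lemma nth_seg [simp]: "k < j - i \<Longrightarrow> seg w i j ! k = w (i + k)"
  by (simp add: seg_def)

lemma seg_append: "i \<le> j \<Longrightarrow> j \<le> k \<Longrightarrow> seg w i j @ seg w j k = seg w i k"
  unfolding seg_def by (metis le_add_diff_inverse map_append upt_add_eq_append)

lemma seg_Suc: "i \<le> j \<Longrightarrow> seg w i (Suc j) = seg w i j @ [w j]"
  by (simp add: seg_def)

lemma seg_empty [simp]: "seg w i i = []"
  by (simp add: seg_def)

lemma take_drop_seg: "i \<le> j \<Longrightarrow> j \<le> t \<Longrightarrow> take (j - i) (drop i (seg w 0 t)) = seg w i j"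
  by (simp add: seg_def take_map drop_map take_upt)

lemma ramsey_pairs:
  fixes c :: "nat \<Rightarrow> nat \<Rightarrow> 'c"
  assumes "finite S" "\<And>i j. c i j \<in> S"
  obtains g :: "nat \<Rightarrow> nat" and e where "strict_mono g" "\<And>i j. i < j \<Longrightarrow> c (g i) (g j) = e"
proof -
  obtain f :: "'c \<Rightarrow> nat" and n where f: "f ` S = {i. i < n}" "inj_on f S"
    using finite_imp_inj_to_nat_seg[OF assms(1)] by blast
  \<comment> \<open>\<open>Ramsey2\<close> colours two-element sets by numbers; \<open>Min\<close>
    and \<open>Max\<close> recover the ordered pair.\<close>
  have "\<forall>x\<in>(UNIV :: nat set). \<forall>y\<in>UNIV. x \<noteq> y \<longrightarrow> f (c (Min {x, y}) (Max {x, y})) < n"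
    using f(1) assms(2) by blast
  then obtain Y t where Y: "infinite Y"
    "\<forall>x\<in>Y. \<forall>y\<in>Y. x \<noteq> y \<longrightarrow> f (c (Min {x, y}) (Max {x, y})) = t"
    using Ramsey2[of UNIV "\<lambda>X. f (c (Min X) (Max X))" n] infinite_UNIV_nat by blast
  define g where "g = enumerate Y"
  have g: "strict_mono g" "g i \<in> Y" for i
    unfolding g_def using Y(1) by (auto intro: strict_mono_enumerate enumerate_in_set)
  have col: "f (c (g i) (g j)) = t" if "i < j" for i j
    using Y(2) g(2)[of i] g(2)[of j] strict_monoD[OF g(1) that] by fastforce
  have "c (g i) (g j) = c (g 0) (g 1)" if "i < j" for i j
  proof (rule inj_onD[OF f(2)])
    show "f (c (g i) (g j)) = f (c (g 0) (g 1))"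
      using col[OF that] col[of 0 1] by simp
  qed (use assms(2) in auto)
  then show thesis
    using that[OF g(1)] by blast
qed

section \<open>Merging classes of positions and the colour of a finite prefix\<close>

locale recognised =
  fixes h :: "'a list \<Rightarrow> nat" and L :: "(nat \<Rightarrow> 'a) \<Rightarrow> bool"
  assumes finite_range: "finite (range h)"
    and append_cong: "h u = h u' \<Longrightarrow> h v = h v' \<Longrightarrow> h (u @ v) = h (u' @ v')"
    and saturated: "strict_mono f \<Longrightarrow> f 0 = 0 \<Longrightarrow> strict_mono g \<Longrightarrow> g 0 = 0 \<Longrightarrow>
      (\<And>i. h (seg w (f i) (f (Suc i))) = h (seg w' (g i) (g (Suc i)))) \<Longrightarrow> L w \<Longrightarrow> L w'"
begin

definition D :: "'a list \<Rightarrow> nat \<Rightarrow> nat \<Rightarrow> nat" where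
  "D u i j = h (take (j - i) (drop i u))"

text \<open>The positions are identified once the words between them and the current position have the
  same value; every class is represented by its least element, so that a class changes its
  representative only by being merged into an older class.\<close>

definition reps :: "'a list \<Rightarrow> nat set" where
  "reps u = {i. i \<le> length u \<and> (\<forall>i'<i. D u i' (length u) \<noteq> D u i (length u))}"

text \<open>A class that is alive now was alive one letter earlier or consists of the newest
  position alone, so only these positions have to be compared.\<close>

definition cand :: "'a list \<Rightarrow> nat set" where
  "cand u = (if u = [] then {0} else insert (length u) (reps (butlast u)))"

definition merges :: "'a list \<Rightarrow> (nat \<times> nat) set" where
  "merges u = {(r, q). r \<in> reps u \<and> q \<in> cand u \<and> r < q \<and> D u r (length u) = D u q (length u)}"

text \<open>The answer is taken from some word with this stem and loop type; by saturation all such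
  words agree.\<close>

definition accept :: "nat \<Rightarrow> nat \<Rightarrow> bool" where
  "accept s e \<longleftrightarrow> (\<exists>w g. strict_mono g \<and> h (seg w 0 (g 0)) = s \<and>
     (\<forall>i. h (seg w (g i) (g (Suc i))) = e) \<and> L w)"

text \<open>A merge of \<open>q\<close> into \<open>r\<close> proposes the factorisation of the word
  with stem up to \<open>r\<close> and loops of the type from \<open>r\<close> to \<open>q\<close>;
  even means that it is accepted. Older targets get smaller colours.\<close>

definition colours :: "'a list \<Rightarrow> nat set" where
  "colours u = (\<lambda>(r, q). 2 * card {i \<in> reps u. i < r} + of_bool (\<not> accept (D u 0 r) (D u r q))) ` merges u"

text \<open>The default \<open>2 * card (range h)\<close> exceeds the colour of every merge, because
  a representative has fewer than \<open>card (range h)\<close> older ones.\<close>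

definition colour :: "'a list \<Rightarrow> nat" where
  "colour u = Min (insert (2 * card (range h)) (colours u))"

definition points :: "'a list \<Rightarrow> nat list" where
  "points u = sorted_list_of_set (cand u)"

text \<open>The state of the automaton. Absolute positions are unbounded and therefore forgotten;
  what remains are the types between candidates, listed by age.\<close>

definition matrix :: "'a list \<Rightarrow> nat list list" where
  "matrix u = map (\<lambda>i. map (D u i) (points u)) (points u)"

lemma D_append: "i \<le> j \<Longrightarrow> j \<le> length u \<Longrightarrow> D (u @ v) i j = D u i j"
  by (simp add: D_def)

lemma D_back: "j \<le> i \<Longrightarrow> D u i j = h []"
  by (simp add: D_def)

lemma D_snoc_cong:
  assumes "i \<le> length u" "i' \<le> length u'" "D u i (length u) = D u' i' (length u')"
  shows "D (u @ [a]) i (Suc (length u)) = D (u' @ [a]) i' (Suc (length u'))"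
  using assms append_cong[of "drop i u" "drop i' u'" "[a]" "[a]"] by (simp add: D_def)

lemma reps_subset: "reps u \<subseteq> {..length u}"
  by (auto simp: reps_def)

lemma card_reps: "card (reps u) \<le> card (range h)"
proof -
  have "inj_on (\<lambda>i. D u i (length u)) (reps u)"
    by (rule linorder_inj_onI) (auto simp: reps_def)
  moreover have "(\<lambda>i. D u i (length u)) ` reps u \<subseteq> range h"
    by (auto simp: D_def)
  ultimately show ?thesis
    using finite_range card_inj_on_le by blast
qed

lemma finite_reps [simp]: "finite (reps u)"
  using reps_subset finite_subset by blast

lemma finite_cand [simp]: "finite (cand u)"
  by (simp add: cand_def)

lemma cand_subset: "cand u \<subseteq> {..length u}"
  using reps_subset[of "butlast u"] by (auto simp: cand_def)

lemma length_in_cand: "length u \<in> cand u"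
  by (simp add: cand_def)

lemma zero_in_reps: "0 \<in> reps u"
  by (simp add: reps_def)

lemma zero_in_cand: "0 \<in> cand u"
  by (simp add: cand_def zero_in_reps)

text \<open>Merged positions stay merged. So an earlier position equivalent to \<open>i\<close> may
  be replaced by its representative one letter before, which is a candidate.\<close>

lemma reps_iff_cand:
  "reps u = {i \<in> cand u. \<forall>i'\<in>cand u. i' < i \<longrightarrow> D u i' (length u) \<noteq> D u i (length u)}"
proof (cases u rule: rev_cases)
  case Nil
  then show ?thesis
    by (auto simp: reps_def cand_def)
next
  case (snoc v a)
  have ex: "\<exists>i''\<in>reps v. i'' \<le> i' \<and> D u i'' (length u) = D u i' (length u)" if "i' \<le> length v" for i'
  proof -
    define l where "l = (LEAST x. D v x (length v) = D v i' (length v))"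
    have l: "D v l (length v) = D v i' (length v)" "l \<le> i'"
      unfolding l_def by (auto intro: LeastI Least_le)
    moreover have "l \<in> reps v"
      using l that not_less_Least unfolding reps_def l_def by fastforce
    ultimately show ?thesis
      using D_snoc_cong[of l v i' v a] that snoc by auto
  qed
  have "i \<in> cand u" if "i \<in> reps u" for i
  proof (cases "i \<le> length v")
    case True
    have "D v i' (length v) \<noteq> D v i (length v)" if "i' < i" for i'
      using \<open>i \<in> reps u\<close> D_snoc_cong[of i' v i v a] that True snoc by (auto simp: reps_def)
    then show ?thesis
      using True snoc by (simp add: cand_def reps_def)
  qed (use that snoc in \<open>simp add: cand_def reps_def\<close>)
  moreover have "i \<in> reps u"
    if "i \<in> cand u" "\<forall>i'\<in>cand u. i' < i \<longrightarrow> D u i' (length u) \<noteq> D u i (length u)" for i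
  proof -
    have "i \<le> length u"
      using that cand_subset by blast
    moreover have "D u i' (length u) \<noteq> D u i (length u)" if "i' < i" for i'
    proof -
      have "i' \<le> length v"
        using that \<open>i \<le> length u\<close> snoc by simp
      then obtain i'' where "i'' \<in> reps v" "i'' \<le> i'" "D u i'' (length u) = D u i' (length u)"
        using ex by blast
      moreover have "i'' \<in> cand u"
        using \<open>i'' \<in> reps v\<close> snoc by (simp add: cand_def)
      ultimately show ?thesis
        using that \<open>\<forall>i'\<in>cand u. i' < i \<longrightarrow> D u i' (length u) \<noteq> D u i (length u)\<close> by auto
    qed
    ultimately show ?thesis
      by (simp add: reps_def)
  qed
  moreover have "D u i' (length u) \<noteq> D u i (length u)" if "i \<in> reps u" "i' < i" for i i'
    using that by (simp add: reps_def)
  ultimately show ?thesis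
    by blast
qed

section \<open>The matrix of types as a finite state\<close>

lemma set_points [simp]: "set (points u) = cand u"
  by (simp add: points_def)

lemma sorted_points: "sorted_wrt (<) (points u)"
  by (simp add: points_def)

lemma points_less_iff: "i < length (points u) \<Longrightarrow> j < length (points u) \<Longrightarrow>
    points u ! i < points u ! j \<longleftrightarrow> i < j"
  using sorted_points by (metis linorder_neqE_nat not_less_iff_gr_or_eq sorted_wrt_nth_less)

lemma finite_range_matrix: "finite (range matrix)"
proof -
  define N where "N = Suc (card (range h))"
  have len: "length (points u) \<le> N" for u
  proof -
    have "card (cand u) \<le> N"
      using card_reps[of "butlast u"] unfolding N_def cand_def
      by (auto intro: le_trans[OF card_insert_le_m1] simp: card_insert_if)
    then show ?thesis
      by (simp add: points_def)
  qed
  let ?M = "{xs. set xs \<subseteq> range h \<and> length xs \<le> N}"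
  have "finite ?M"
    using finite_range by (rule finite_lists_length_le)
  then have "finite {xss. set xss \<subseteq> ?M \<and> length xss \<le> N}"
    by (rule finite_lists_length_le)
  moreover have "range matrix \<subseteq> {xss. set xss \<subseteq> ?M \<and> length xss \<le> N}"
    using len by (auto simp: matrix_def D_def)
  ultimately show ?thesis
    by (rule rev_finite_subset)
qed

lemma matrix_eqD:
  assumes "matrix u = matrix u'"
  shows "length (points u) = length (points u')"
    and "i < length (points u) \<Longrightarrow> j < length (points u) \<Longrightarrow>
      D u (points u ! i) (points u ! j) = D u' (points u' ! i) (points u' ! j)"
proof -
  show len: "length (points u) = length (points u')"
    using arg_cong[OF assms, of length] by (simp add: matrix_def)
  assume ij: "i < length (points u)" "j < length (points u)"
  have "matrix u ! i ! j = matrix u' ! i ! j"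
    using assms by simp
  then show "D u (points u ! i) (points u ! j) = D u' (points u' ! i) (points u' ! j)"
    using ij len by (simp add: matrix_def)
qed

lemma points_last: "points u ! (length (points u) - 1) = length u" "points u \<noteq> []"
proof -
  show ne: "points u \<noteq> []"
    using length_in_cand[of u] set_points[of u] by (metis empty_iff empty_set)
  obtain k where k: "k < length (points u)" "points u ! k = length u"
    using length_in_cand[of u] set_points[of u] by (metis in_set_conv_nth)
  moreover have "points u ! (length (points u) - 1) \<le> length u"
    using ne cand_subset[of u] nth_mem[of "length (points u) - 1" "points u"] by auto
  moreover have "k \<le> length (points u) - 1"
    using k by simp
  ultimately show "points u ! (length (points u) - 1) = length u"
    using points_less_iff[of k u "length (points u) - 1"] ne by (cases "k = length (points u) - 1") auto
qed

lemma points_0: "points u ! 0 = 0"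
proof -
  obtain k where k: "k < length (points u)" "points u ! k = 0"
    using zero_in_cand[of u] set_points[of u] by (metis in_set_conv_nth)
  then show ?thesis
    using points_less_iff[of 0 u k] points_last(2)[of u] by (cases "k = 0") auto
qed

text \<open>\<open>reps\<close> in terms of indices into \<open>points\<close>. It can be read off
  the matrix because the last point is the end of the word.\<close>

definition kept :: "'a list \<Rightarrow> nat set" where
  "kept u = {j. j < length (points u) \<and>
     (\<forall>j'<j. D u (points u ! j') (length u) \<noteq> D u (points u ! j) (length u))}"

lemma kept_cong: "matrix u = matrix u' \<Longrightarrow> kept u = kept u'"
proof -
  assume eq: "matrix u = matrix u'"
  have "D u (points u ! j) (length u) = D u' (points u' ! j) (length u')" if "j < length (points u)" for j
    using matrix_eqD(2)[OF eq that, of "length (points u) - 1"] matrix_eqD(1)[OF eq]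
      points_last[of u] points_last[of u'] by simp
  then show "kept u = kept u'"
    using matrix_eqD(1)[OF eq] unfolding kept_def by auto
qed

lemma reps_kept: "reps u = (!) (points u) ` kept u"
proof -
  have "i \<in> reps u \<longleftrightarrow> i \<in> (!) (points u) ` kept u" for i
  proof
    assume "i \<in> reps u"
    then have i: "i \<in> cand u" "\<forall>i'\<in>cand u. i' < i \<longrightarrow> D u i' (length u) \<noteq> D u i (length u)"
      using reps_iff_cand[of u] by auto
    then obtain k where k: "k < length (points u)" "points u ! k = i"
      by (metis in_set_conv_nth set_points)
    have "points u ! j' \<in> cand u \<and> points u ! j' < i" if "j' < k" for j'
      using that k points_less_iff[of j' u k] by (metis nth_mem order.strict_trans set_points)
    then have "k \<in> kept u"
      using i k unfolding kept_def by auto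
    then show "i \<in> (!) (points u) ` kept u"
      using k by blast
  next
    assume "i \<in> (!) (points u) ` kept u"
    then obtain k where k: "k < length (points u)" "points u ! k = i"
      "\<forall>j'<k. D u (points u ! j') (length u) \<noteq> D u (points u ! k) (length u)"
      unfolding kept_def by blast
    have "D u i' (length u) \<noteq> D u i (length u)" if i': "i' \<in> cand u" "i' < i" for i'
    proof -
      obtain j where "j < length (points u)" "points u ! j = i'"
        using i' by (metis in_set_conv_nth set_points)
      then show ?thesis
        using k i' points_less_iff[of j u k] by auto
    qed
    then show "i \<in> reps u"
      using k nth_mem[of k "points u"] unfolding reps_iff_cand[of u] by auto
  qed
  then show ?thesis
    by blast
qed

lemma points_snoc:
  "points (u @ [a]) = map ((!) (points u)) (sorted_list_of_set (kept u)) @ [Suc (length u)]"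
proof -
  have fin: "finite (kept u)"
    by (simp add: kept_def)
  have sub: "kept u \<subseteq> {..<length (points u)}"
    by (auto simp: kept_def)
  have "sorted_wrt (<) (map ((!) (points u)) (sorted_list_of_set (kept u)))"
    unfolding sorted_wrt_map
    by (rule sorted_wrt_mono_rel[OF _ sorted_list_of_set.strict_sorted_key_list_of_set])
       (use sub fin in \<open>auto simp: points_less_iff\<close>)
  moreover have "\<forall>x\<in>set (map ((!) (points u)) (sorted_list_of_set (kept u))). x < Suc (length u)"
    using reps_kept[of u] fin reps_subset[of u] by auto
  ultimately have "sorted_wrt (<) (map ((!) (points u)) (sorted_list_of_set (kept u)) @ [Suc (length u)])"
    by (simp add: sorted_wrt_append)
  moreover have "set (map ((!) (points u)) (sorted_list_of_set (kept u)) @ [Suc (length u)]) = cand (u @ [a])"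
    using fin by (auto simp: cand_def reps_kept)
  ultimately show ?thesis
    unfolding points_def by (metis finite_cand sorted_list_of_set.idem_if_sorted_distinct
        strict_sorted_iff)
qed

text \<open>The new points are the kept ones and the new end. Types between old points persist,
  types to the new end are determined by those to the old end and the letter, and backward entries
  are all \<open>h []\<close>.\<close>

lemma matrix_snoc_cong:
  assumes eq: "matrix u = matrix u'"
  shows "matrix (u @ [a]) = matrix (u' @ [a])"
proof -
  let ?n = "length u" and ?n' = "length u'" and ?K = "sorted_list_of_set (kept u)"
  have len: "length (points u) = length (points u')"
    using matrix_eqD(1)[OF eq] .
  have K: "k \<in> set ?K \<Longrightarrow> k < length (points u)" for k
    by (simp add: kept_def)
  have le: "points u ! k \<le> ?n" "points u' ! k \<le> ?n'" if "k < length (points u)" for k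
    using that len cand_subset[of u] cand_subset[of u'] nth_mem[of k "points u"] nth_mem[of k "points u'"] by auto
  have last: "D u (points u ! k) ?n = D u' (points u' ! k) ?n'" if "k < length (points u)" for k
    using matrix_eqD(2)[OF eq that, of "length (points u) - 1"] points_last[of u] points_last[of u'] len
    by simp
  have old: "D (u @ [a]) (points u ! k) (points u ! l) = D (u' @ [a]) (points u' ! k) (points u' ! l)"
    if "k < length (points u)" "l < length (points u)" for k l
  proof (cases "k \<le> l")
    case True
    then have "points u ! k \<le> points u ! l" "points u' ! k \<le> points u' ! l"
      using that len points_less_iff[of l u k] points_less_iff[of l u' k] by (simp_all add: not_less[symmetric])
    then show ?thesis
      using that le matrix_eqD(2)[OF eq that] by (simp add: D_append)
  next
    case False
    then have "points u ! l \<le> points u ! k" "points u' ! l \<le> points u' ! k"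
      using that len points_less_iff[of k u l] points_less_iff[of k u' l] by (simp_all add: not_less[symmetric])
    then show ?thesis
      by (simp add: D_back)
  qed
  have new: "D (u @ [a]) (points u ! k) (Suc ?n) = D (u' @ [a]) (points u' ! k) (Suc ?n')"
    if "k < length (points u)" for k
    by (rule D_snoc_cong) (use that le last in auto)
  have bwd: "D (u @ [a]) (Suc ?n) (points u ! k) = D (u' @ [a]) (Suc ?n') (points u' ! k)"
    if "k < length (points u)" for k
    using le[OF that] by (simp add: D_back)
  show ?thesis
    unfolding matrix_def points_snoc kept_cong[OF eq, symmetric]
    using old new bwd K by (simp add: D_back)
qed

text \<open>The rank of a representative is the rank of its index among the kept ones, and position
  0 is the first point; so every ingredient of a colour can be read off the matrix.\<close>

lemma colour_cong:
  assumes eq: "matrix u = matrix u'"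
  shows "colour u = colour u'"
proof -
  define C where "C u = (\<lambda>(r, q). 2 * card {i \<in> kept u. i < r} +
      of_bool (\<not> accept (D u (points u ! 0) (points u ! r)) (D u (points u ! r) (points u ! q)))) `
      {(r, q). r \<in> kept u \<and> q < length (points u) \<and> r < q \<and>
        D u (points u ! r) (points u ! (length (points u) - 1)) =
        D u (points u ! q) (points u ! (length (points u) - 1))}" for u
  have K: "k \<in> kept u \<Longrightarrow> k < length (points u)" for k u
    by (simp add: kept_def)
  have colours: "colours u = C u" for u
  proof -
    let ?p = "(!) (points u)"
    have "merges u = map_prod ?p ?p ` {(r, q). r \<in> kept u \<and> q < length (points u) \<and> r < q \<and>
        D u (?p r) (length u) = D u (?p q) (length u)}"
    proof -
      have "(x, y) \<in> merges u" if "r \<in> kept u" "q < length (points u)" "r < q"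
        "D u (?p r) (length u) = D u (?p q) (length u)" "x = ?p r" "y = ?p q" for x y r q
        using that K[of r u] points_less_iff[of r u q] nth_mem[of q "points u"]
        unfolding merges_def reps_kept by auto
      moreover have "\<exists>r q. x = ?p r \<and> y = ?p q \<and> r \<in> kept u \<and> q < length (points u) \<and> r < q \<and>
          D u (?p r) (length u) = D u (?p q) (length u)" if xy: "(x, y) \<in> merges u" for x y
      proof -
        have "x \<in> ?p ` kept u" "y \<in> set (points u)" "x < y" "D u x (length u) = D u y (length u)"
          using xy unfolding merges_def reps_kept by auto
        then obtain r q where "r \<in> kept u" "x = ?p r" "q < length (points u)" "y = ?p q"
          by (metis imageE in_set_conv_nth)
        then show ?thesis
          using \<open>x < y\<close> \<open>D u x (length u) = D u y (length u)\<close> K points_less_iff[of r u q] by blast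
      qed
      ultimately show ?thesis
        by (auto simp: image_iff) blast
    qed
    moreover have card: "card {i \<in> reps u. i < ?p r} = card {i \<in> kept u. i < r}" if "r \<in> kept u" for r
    proof -
      have "{i \<in> reps u. i < ?p r} = ?p ` {i \<in> kept u. i < r}"
        unfolding reps_kept using points_less_iff K that by blast
      moreover have "inj_on ?p {i \<in> kept u. i < r}"
      proof (rule inj_onI)
        fix x y assume "x \<in> {i \<in> kept u. i < r}" "y \<in> {i \<in> kept u. i < r}" "?p x = ?p y"
        then show "x = y"
          using points_less_iff[of x u y] points_less_iff[of y u x] K[of x u] K[of y u] by auto
      qed
      ultimately show ?thesis
        by (simp add: card_image)
    qed
    ultimately have "colours u = (\<lambda>(r, q). 2 * card {i \<in> reps u. i < ?p r} +
        of_bool (\<not> accept (D u 0 (?p r)) (D u (?p r) (?p q)))) `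
        {(r, q). r \<in> kept u \<and> q < length (points u) \<and> r < q \<and> D u (?p r) (length u) = D u (?p q) (length u)}"
      unfolding colours_def by (simp add: image_image case_prod_unfold)
    also have "\<dots> = C u"
      unfolding C_def points_0 points_last by (rule image_cong) (use card in auto)
    finally show ?thesis .
  qed
  have "C u = C u'"
    unfolding C_def
  proof (rule image_cong)
    show "{(r, q). r \<in> kept u \<and> q < length (points u) \<and> r < q \<and>
        D u (points u ! r) (points u ! (length (points u) - 1)) =
        D u (points u ! q) (points u ! (length (points u) - 1))} =
      {(r, q). r \<in> kept u' \<and> q < length (points u') \<and> r < q \<and>
        D u' (points u' ! r) (points u' ! (length (points u') - 1)) =
        D u' (points u' ! q) (points u' ! (length (points u') - 1))}"
      using matrix_eqD[OF eq] kept_cong[OF eq] points_last(2)[of u] by (auto simp: K)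
  next
    fix x
    assume "x \<in> {(r, q). r \<in> kept u' \<and> q < length (points u') \<and> r < q \<and>
        D u' (points u' ! r) (points u' ! (length (points u') - 1)) =
        D u' (points u' ! q) (points u' ! (length (points u') - 1))}"
    then show "(case x of (r, q) \<Rightarrow> 2 * card {i \<in> kept u. i < r} +
        of_bool (\<not> accept (D u (points u ! 0) (points u ! r)) (D u (points u ! r) (points u ! q)))) =
      (case x of (r, q) \<Rightarrow> 2 * card {i \<in> kept u'. i < r} +
        of_bool (\<not> accept (D u' (points u' ! 0) (points u' ! r)) (D u' (points u' ! r) (points u' ! q))))"
      using matrix_eqD[OF eq] kept_cong[OF eq] points_last(2)[of u'] by (auto dest: K)
  qed
  then show ?thesis
    unfolding colour_def colours by simp
qed

end

section \<open>Merging along an infinite word\<close>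

context recognised
begin

lemma reps_seg: "reps (seg w 0 t) = {i. i \<le> t \<and> (\<forall>i'<i. h (seg w i' t) \<noteq> h (seg w i t))}"
  by (auto simp: reps_def D_def take_drop_seg[of _ t t, simplified])

lemma cand_seg_Suc: "cand (seg w 0 (Suc t)) = insert (Suc t) (reps (seg w 0 t))"
  by (simp add: cand_def seg_Suc)

lemma D_seg: "i \<le> j \<Longrightarrow> j \<le> t \<Longrightarrow> D (seg w 0 t) i j = h (seg w i j)"
  by (simp add: D_def take_drop_seg)

lemma merges_seg: "(r, q) \<in> merges (seg w 0 t) \<longleftrightarrow>
    r \<in> reps (seg w 0 t) \<and> q \<in> cand (seg w 0 t) \<and> r < q \<and> h (seg w r t) = h (seg w q t)"
proof -
  have "q \<in> cand (seg w 0 t) \<Longrightarrow> q \<le> t"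
    using cand_subset[of "seg w 0 t"] by auto
  then show ?thesis
    by (auto simp: merges_def D_seg)
qed

lemma seg_cong_extend:
  assumes "h (seg w i t) = h (seg w j t)" "i \<le> t" "j \<le> t" "t \<le> t'"
  shows "h (seg w i t') = h (seg w j t')"
proof -
  have "h (seg w i t @ seg w t t') = h (seg w j t @ seg w t t')"
    using assms(1) by (rule append_cong) simp
  then show ?thesis
    by (simp only: seg_append[OF assms(2,4)] seg_append[OF assms(3,4)])
qed

lemma reps_seg_antimono:
  assumes "i \<in> reps (seg w 0 t')" "i \<le> t" "t \<le> t'"
  shows "i \<in> reps (seg w 0 t)"
proof -
  have "h (seg w i' t) \<noteq> h (seg w i t)" if "i' < i" for i'
    using assms that seg_cong_extend[of w i' t i t'] by (auto simp: reps_seg)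
  then show ?thesis
    using assms(2) by (simp add: reps_seg)
qed

definition stable :: "(nat \<Rightarrow> 'a) \<Rightarrow> nat set" where
  "stable w = {i. \<forall>t\<ge>i. i \<in> reps (seg w 0 t)}"

text \<open>Finitely many stable positions are representatives at one common time, when their types
  differ.\<close>

lemma finite_stable: "finite (stable w)" and card_stable: "card (stable w) \<le> card (range h)"
proof -
  have card: "card S \<le> card (range h)" if S: "S \<subseteq> stable w" "finite S" for S
  proof -
    have "S \<subseteq> reps (seg w 0 (Max (insert 0 S)))"
      using S by (auto simp: stable_def)
    then have "card S \<le> card (reps (seg w 0 (Max (insert 0 S))))"
      by (simp add: card_mono)
    then show ?thesis
      using card_reps le_trans by blast
  qed
  show fin: "finite (stable w)"
  proof (rule ccontr)
    assume "infinite (stable w)"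
    then obtain S where "S \<subseteq> stable w" "finite S" "card S = Suc (card (range h))"
      using infinite_arbitrarily_large by blast
    then show False
      using card[of S] by simp
  qed
  show "card (stable w) \<le> card (range h)"
    using card fin by blast
qed

lemma eventually_reps_stable:
  "eventually (\<lambda>t. \<forall>i\<le>b. i \<in> reps (seg w 0 t) \<longleftrightarrow> i \<in> stable w) sequentially"
proof -
  have "eventually (\<lambda>t. i \<in> reps (seg w 0 t) \<longleftrightarrow> i \<in> stable w) sequentially" for i
  proof (cases "i \<in> stable w")
    case True
    then show ?thesis
      unfolding eventually_sequentially stable_def by auto
  next
    case False
    then obtain t where "t \<ge> i" "i \<notin> reps (seg w 0 t)"
      unfolding stable_def by blast
    then have "i \<notin> reps (seg w 0 t')" if "t' \<ge> t" for t'
      using reps_seg_antimono that by blast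
    then show ?thesis
      using False unfolding eventually_sequentially by blast
  qed
  then have "eventually (\<lambda>t. \<forall>i\<in>{..b}. i \<in> reps (seg w 0 t) \<longleftrightarrow> i \<in> stable w) sequentially"
    by (intro eventually_ball_finite) auto
  then show ?thesis
    by (rule eventually_mono) auto
qed

text \<open>Follow the representative of a position \<open>q0\<close> beyond \<open>m\<close> and
  beyond all stable positions. It can only decrease, and its final value is stable, hence below
  \<open>q0\<close>; so it is reached by a merge.\<close>

lemma merge_into_stable: "\<exists>t\<ge>m. \<exists>r\<in>stable w. \<exists>q. (r, q) \<in> merges (seg w 0 t)"
proof -
  define q0 where "q0 = Suc (Max (insert m (stable w)))"
  have q0: "m < q0" "\<And>i. i \<in> stable w \<Longrightarrow> i < q0"
    using finite_stable unfolding q0_def by (auto simp: less_Suc_eq_le)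
  define f where "f k = (LEAST i. h (seg w i (q0 + k)) = h (seg w q0 (q0 + k)))" for k
  have f: "h (seg w (f k) (q0 + k)) = h (seg w q0 (q0 + k))" "f k \<le> q0" for k
    unfolding f_def by (auto intro: LeastI Least_le)
  have f_le: "f k \<le> i" if "h (seg w i (q0 + k)) = h (seg w q0 (q0 + k))" for i k
    unfolding f_def using that by (rule Least_le)
  have f_rep: "f k \<in> reps (seg w 0 (q0 + k))" for k
  proof -
    have "h (seg w i (q0 + k)) \<noteq> h (seg w (f k) (q0 + k))" if "i < f k" for i
      using f(1)[of k] f_le[of i k] that by auto
    then show ?thesis
      using f(2)[of k] by (simp add: reps_seg)
  qed
  have f_antimono: "f (k + l) \<le> f k" for k l
    by (rule f_le) (use seg_cong_extend[OF f(1), of k "q0 + (k + l)"] f(2)[of k] in simp)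
  obtain k0 where k0: "\<And>k. f k0 \<le> f k"
    using ex_has_least_nat[of "\<lambda>_. True" 0 f] by blast
  have const: "f (k0 + l) = f k0" for l
    using k0 f_antimono by (rule order.antisym[rotated])
  have stable: "f k0 \<in> stable w"
    unfolding stable_def
  proof (intro CollectI allI impI)
    fix t assume "f k0 \<le> t"
    have "f k0 \<in> reps (seg w 0 (q0 + (k0 + t)))"
      using f_rep[of "k0 + t"] const by simp
    then show "f k0 \<in> reps (seg w 0 t)"
      by (rule reps_seg_antimono) (use \<open>f k0 \<le> t\<close> in auto)
  qed
  define k1 where "k1 = (LEAST k. f k = f k0)"
  have k1: "f k1 = f k0"
    unfolding k1_def by (rule LeastI) simp
  have rep: "f k0 \<in> reps (seg w 0 (q0 + k1))"
    using f_rep[of k1] k1 by simp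
  obtain t where t: "q0 + k1 = Suc t"
    using q0(1) by (cases "q0 + k1") auto
  have "\<exists>q. (f k0, q) \<in> merges (seg w 0 (q0 + k1))"
  \<comment> \<open>For \<open>k1 = 0\<close> the newest position \<open>q0\<close> itself is
    absorbed; otherwise it is the representative that \<open>q0\<close> had one step
    earlier.\<close>
  proof (cases k1)
    case 0
    then show ?thesis
      using f(1)[of k1] k1 rep q0(2)[OF stable] t by (auto simp: merges_seg cand_seg_Suc intro!: exI[of _ q0])
  next
    case (Suc k)
    then have "f k \<noteq> f k0"
      using not_less_Least[of k "\<lambda>k. f k = f k0"] unfolding k1_def by simp
    then have "f k0 < f k"
      using k0[of k] by simp
    moreover have "t = q0 + k"
      using t Suc by simp
    moreover have "h (seg w (f k) (q0 + k1)) = h (seg w q0 (q0 + k1))"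
      by (rule seg_cong_extend[OF f(1)[of k]]) (use f(2)[of k] Suc in auto)
    ultimately show ?thesis
      using f(1)[of k1] k1 rep f_rep[of k] t
      by (auto simp: merges_seg cand_seg_Suc intro!: exI[of _ "f k"])
  qed
  then show ?thesis
    using stable q0(1) by (intro exI[of _ "q0 + k1"]) auto
qed

text \<open>Each of the finitely many positions up to \<open>m\<close> is in the end either stable,
  and never absorbed, or no representative any more.\<close>

lemma eventually_merges_late:
  "eventually (\<lambda>t. \<forall>q. (r, q) \<in> merges (seg w 0 t) \<longrightarrow> m < q) sequentially"
proof -
  obtain T where T: "\<And>t i. t \<ge> T \<Longrightarrow> i \<le> m \<Longrightarrow> i \<in> reps (seg w 0 t) \<longleftrightarrow> i \<in> stable w"
    using eventually_reps_stable[of m w] unfolding eventually_sequentially by blast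
  have "m < q" if t: "t \<ge> T + m + 2" and q: "(r, q) \<in> merges (seg w 0 t)" for t q
  proof (rule ccontr)
    assume "\<not> m < q"
    then have qm: "q \<le> m" by simp
    obtain s where s: "t = Suc s"
      using t by (cases t) auto
    have "q \<in> cand (seg w 0 t)" "q \<noteq> t"
      using q qm t by (auto simp: merges_seg)
    then have "q \<in> reps (seg w 0 s)"
      using s by (simp add: cand_seg_Suc)
    then have "q \<in> reps (seg w 0 t)"
      using T qm t s by simp
    moreover have "q \<notin> reps (seg w 0 t)"
      using q by (auto simp: merges_seg reps_seg)
    ultimately show False by simp
  qed
  then show ?thesis
    unfolding eventually_sequentially by blast
qed

text \<open>Once \<open>q\<close> has merged into \<open>r\<close>, segments from \<open>q\<close>
  have the type of segments from \<open>r\<close>. Hence successive merges of type \<open>e\<close>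
  cut \<open>w\<close> into a stem and blocks of type \<open>e\<close>.\<close>

lemma accept_iff:
  assumes "\<forall>m. \<exists>t\<ge>m. \<exists>q. (r, q) \<in> merges (seg w 0 t) \<and> h (seg w r q) = e"
  shows "accept (h (seg w 0 r)) e \<longleftrightarrow> L w"
proof -
  have "\<exists>t q. (r, q) \<in> merges (seg w 0 t) \<and> h (seg w r q) = e \<and> m < q" for m
    using eventually_merges_late[of r w m] assms unfolding eventually_sequentially by blast
  then obtain T Q where TQ: "\<And>m. (r, Q m) \<in> merges (seg w 0 (T m))" "\<And>m. h (seg w r (Q m)) = e"
    "\<And>m. m < Q m"
    by metis
  \<comment> \<open>Each merge is taken with its \<open>q\<close> beyond the time at which the
    previous merge happened, so that the previous \<open>q\<close> is already equivalent to
    \<open>r\<close>.\<close>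
  define k where "k = rec_nat r (\<lambda>_. T)"
  define g where "g i = (case i of 0 \<Rightarrow> r | Suc j \<Rightarrow> Q (k j))" for i
  have QT: "Q m \<le> T m" "r < Q m" "h (seg w r (T m)) = h (seg w (Q m) (T m))" for m
    using TQ(1)[of m] cand_subset[of "seg w 0 (T m)"] by (auto simp: merges_seg)
  have kS: "k (Suc i) = T (k i)" for i
    by (simp add: k_def)
  have mono: "strict_mono g"
    unfolding strict_mono_Suc_iff
  proof
    fix i show "g i < g (Suc i)"
    proof (cases i)
      case 0
      then show ?thesis using QT by (simp add: g_def)
    next
      case (Suc j)
      have "Q (k j) \<le> T (k j)" using QT by simp
      also have "\<dots> < Q (k i)" using TQ(3)[of "k i"] Suc kS by simp
      finally show ?thesis using Suc by (simp add: g_def)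
    qed
  qed
  have e: "h (seg w (g i) (g (Suc i))) = e" for i
  proof (cases i)
    case 0
    then show ?thesis using TQ by (simp add: g_def)
  next
    case (Suc j)
    have "h (seg w r (Q (k i))) = h (seg w (Q (k j)) (Q (k i)))"
      by (rule seg_cong_extend[OF QT(3)[of "k j"]])
         (use QT[of "k j"] TQ(3)[of "k i"] kS[of j] Suc in auto)
    then show ?thesis
      using Suc TQ(2) by (simp add: g_def)
  qed
  have "L w" if "accept (h (seg w 0 r)) e"
  proof -
    obtain w' g' where w': "strict_mono g'" "h (seg w' 0 (g' 0)) = h (seg w 0 r)"
      "\<And>i. h (seg w' (g' i) (g' (Suc i))) = e" "L w'"
      using \<open>accept (h (seg w 0 r)) e\<close> unfolding accept_def by blast
    \<comment> \<open>The stem is empty if \<open>r = 0\<close>, whereas saturation wants strictly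
      increasing cuts from 0; so the stem is joined to the first block.\<close>
    define cut where "cut f = (\<lambda>i. case i of 0 \<Rightarrow> 0 | Suc j \<Rightarrow> f (Suc j))" for f :: "nat \<Rightarrow> nat"
    have cut: "strict_mono (cut f)" "cut f 0 = 0" if "strict_mono f" for f
    proof -
      have "cut f i < cut f (Suc i)" for i
      proof (cases i)
        case 0
        then show ?thesis
          using strict_monoD[OF that, of 0 1] by (simp add: cut_def)
      next
        case (Suc j)
        then show ?thesis
          using strict_monoD[OF that, of "Suc j" "Suc (Suc j)"] by (simp add: cut_def)
      qed
      then show "strict_mono (cut f)" "cut f 0 = 0"
        by (auto simp: strict_mono_Suc_iff cut_def)
    qed
    have "h (seg w' (cut g' i) (cut g' (Suc i))) = h (seg w (cut g i) (cut g (Suc i)))" for i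
    proof (cases i)
      case 0
      have "h (seg w' 0 (g' 0) @ seg w' (g' 0) (g' 1)) = h (seg w 0 (g 0) @ seg w (g 0) (g 1))"
        by (rule append_cong) (use w'(2) w'(3)[of 0] e[of 0] in \<open>auto simp: g_def\<close>)
      then show ?thesis
        using 0 strict_monoD[OF w'(1), of 0 1] strict_monoD[OF mono, of 0 1]
        by (simp add: cut_def seg_append)
    next
      case (Suc j)
      then show ?thesis
        using w'(3)[of i] e[of i] by (simp add: cut_def)
    qed
    then show ?thesis
      using saturated[OF cut[OF w'(1)] cut[OF mono], where w = w' and w' = w] w'(4) by blast
  qed
  moreover have "accept (h (seg w 0 r)) e" if "L w"
    unfolding accept_def using that mono e by (intro exI[of _ w] exI[of _ g]) (simp add: g_def)
  ultimately show ?thesis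
    by blast
qed

text \<open>Each of the finitely many types \<open>e\<close> either recurs in merges into
  \<open>r\<close>, and \<open>accept_iff\<close> applies, or stops occurring.\<close>

lemma eventually_accept_iff:
  "eventually (\<lambda>t. \<forall>q. (r, q) \<in> merges (seg w 0 t) \<longrightarrow>
     (accept (h (seg w 0 r)) (h (seg w r q)) \<longleftrightarrow> L w)) sequentially"
proof -
  have "eventually (\<lambda>t. \<forall>q. (r, q) \<in> merges (seg w 0 t) \<and> h (seg w r q) = e \<longrightarrow>
     (accept (h (seg w 0 r)) e \<longleftrightarrow> L w)) sequentially" for e
  proof (cases "\<forall>m. \<exists>t\<ge>m. \<exists>q. (r, q) \<in> merges (seg w 0 t) \<and> h (seg w r q) = e")
    case True
    then show ?thesis
      using accept_iff by simp
  next
    case False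
    then show ?thesis
      unfolding eventually_sequentially by blast
  qed
  then have "eventually (\<lambda>t. \<forall>e\<in>range h. \<forall>q. (r, q) \<in> merges (seg w 0 t) \<and> h (seg w r q) = e \<longrightarrow>
     (accept (h (seg w 0 r)) e \<longleftrightarrow> L w)) sequentially"
    using finite_range by (intro eventually_ball_finite) auto
  then show ?thesis
    by (rule eventually_mono) auto
qed

text \<open>With \<open>r\<close> the oldest position that absorbs others for ever, \<open>k\<close>
  is the colour of its late merges. Merges into older positions have ceased, and younger targets
  have rank above \<open>\<rho>\<close>, hence colours at least
  \<open>2 * \<rho> + 2\<close>.\<close>

lemma parity_colour: "parity (L w) (\<lambda>t. colour (seg w 0 t))"
proof -
  have "\<exists>r\<in>stable w. \<forall>m. \<exists>t\<ge>m. \<exists>q. (r, q) \<in> merges (seg w 0 t)"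
  proof (rule ccontr)
    assume "\<not> ?thesis"
    then have "\<forall>r\<in>stable w. eventually (\<lambda>t. \<forall>q. (r, q) \<notin> merges (seg w 0 t)) sequentially"
      unfolding eventually_sequentially by blast
    then have "eventually (\<lambda>t. \<forall>r\<in>stable w. \<forall>q. (r, q) \<notin> merges (seg w 0 t)) sequentially"
      using finite_stable by (intro eventually_ball_finite) auto
    then show False
      using merge_into_stable unfolding eventually_sequentially by blast
  qed
  then have ex: "\<exists>r. r \<in> stable w \<and> (\<forall>m. \<exists>t\<ge>m. \<exists>q. (r, q) \<in> merges (seg w 0 t))" (is "\<exists>r. ?A r")
    by blast
  define r where "r = (LEAST r. ?A r)"
  have r: "?A r"
    unfolding r_def by (rule LeastI_ex[OF ex])
  have min: "\<not> ?A r'" if "r' < r" for r'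
    using that not_less_Least unfolding r_def by blast
  have "eventually (\<lambda>t. \<forall>r'\<in>{r'. r' \<in> stable w \<and> r' < r}. \<forall>q. (r', q) \<notin> merges (seg w 0 t)) sequentially"
  proof (rule eventually_ball_finite)
    show "\<forall>r'\<in>{r'. r' \<in> stable w \<and> r' < r}.
        eventually (\<lambda>t. \<forall>q. (r', q) \<notin> merges (seg w 0 t)) sequentially"
      using min unfolding eventually_sequentially by blast
  qed simp
  then have "eventually (\<lambda>t. (\<forall>r'\<in>{r'. r' \<in> stable w \<and> r' < r}. \<forall>q. (r', q) \<notin> merges (seg w 0 t)) \<and>
      (\<forall>i\<le>r. i \<in> reps (seg w 0 t) \<longleftrightarrow> i \<in> stable w) \<and>
      (\<forall>q. (r, q) \<in> merges (seg w 0 t) \<longrightarrow> (accept (h (seg w 0 r)) (h (seg w r q)) \<longleftrightarrow> L w))) sequentially"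
    using eventually_reps_stable eventually_accept_iff by (intro eventually_conj)
  then obtain T where T: "\<And>t r' q. t \<ge> T \<Longrightarrow> r' \<in> stable w \<Longrightarrow> r' < r \<Longrightarrow> (r', q) \<notin> merges (seg w 0 t)"
    "\<And>t i. t \<ge> T \<Longrightarrow> i \<le> r \<Longrightarrow> i \<in> reps (seg w 0 t) \<longleftrightarrow> i \<in> stable w"
    "\<And>t q. t \<ge> T \<Longrightarrow> (r, q) \<in> merges (seg w 0 t) \<Longrightarrow> accept (h (seg w 0 r)) (h (seg w r q)) \<longleftrightarrow> L w"
    unfolding eventually_sequentially by blast
  define \<rho> where "\<rho> = card {i \<in> stable w. i < r}"
  define k where "k = 2 * \<rho> + of_bool (\<not> L w)"
  have rank: "card {i \<in> reps (seg w 0 t). i < r} = \<rho>" if "t \<ge> T" for t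
    unfolding \<rho>_def using T(2)[OF that] by (intro arg_cong[of _ _ card]) auto
  have fin: "finite (colours (seg w 0 t))" for t
    unfolding colours_def merges_def
    by (rule finite_imageI, rule finite_subset[of _ "reps (seg w 0 t) \<times> cand (seg w 0 t)"]) auto
  have "\<rho> < card (stable w)"
    unfolding \<rho>_def by (rule psubset_card_mono[OF finite_stable]) (use r in auto)
  then have k_top: "k < 2 * card (range h)"
    using card_stable[of w] unfolding k_def by simp
  have merge: "c = 2 * card {i \<in> reps (seg w 0 t). i < r'} +
      of_bool (\<not> accept (h (seg w 0 r')) (h (seg w r' q)))"
    if "(r', q) \<in> merges (seg w 0 t)" "c = 2 * card {i \<in> reps (seg w 0 t). i < r'} +
      of_bool (\<not> accept (D (seg w 0 t) 0 r') (D (seg w 0 t) r' q))" for c r' q t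
    using that cand_subset[of "seg w 0 t"] by (auto simp: merges_seg D_seg)
  have "\<forall>t\<ge>T. k \<le> colour (seg w 0 t)"
  proof (intro allI impI)
    fix t assume t: "t \<ge> T"
    have "k \<le> c" if "c \<in> colours (seg w 0 t)" for c
    proof -
      obtain r' q where r': "(r', q) \<in> merges (seg w 0 t)"
        "c = 2 * card {i \<in> reps (seg w 0 t). i < r'} +
          of_bool (\<not> accept (h (seg w 0 r')) (h (seg w r' q)))"
        using \<open>c \<in> colours (seg w 0 t)\<close> merge unfolding colours_def by fastforce
      have "r' \<in> reps (seg w 0 t)"
        using r'(1) by (simp add: merges_seg)
      then have "\<not> r' < r"
        using T(1)[OF t] T(2)[OF t, of r'] r'(1) by fastforce
      then consider "r' = r" | "r < r'"
        by linarith
      then show ?thesis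
      proof cases
        case 1
        then show ?thesis
          using r' rank[OF t] T(3)[OF t, of q] by (simp add: k_def)
      next
        case 2
        have "r \<in> reps (seg w 0 t)"
          using T(2)[OF t, of r] r by simp
        then have less: "{i \<in> reps (seg w 0 t). i < r} \<subset> {i \<in> reps (seg w 0 t). i < r'}"
          using 2 by auto
        then have "\<rho> < card {i \<in> reps (seg w 0 t). i < r'}"
          using rank[OF t] psubset_card_mono[OF _ less] by simp
        then show ?thesis
          using r'(2) by (simp add: k_def)
      qed
    qed
    then show "k \<le> colour (seg w 0 t)"
      unfolding colour_def using fin k_top by simp
  qed
  moreover have "\<exists>t\<ge>m. colour (seg w 0 t) = k" for m
  proof -
    obtain t q where t: "t \<ge> m + T" "(r, q) \<in> merges (seg w 0 t)"
      using r by blast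
    then have "2 * card {i \<in> reps (seg w 0 t). i < r} +
      of_bool (\<not> accept (D (seg w 0 t) 0 r) (D (seg w 0 t) r q)) \<in> colours (seg w 0 t)"
      unfolding colours_def by force
    moreover have "q \<le> t"
      using t(2) cand_subset[of "seg w 0 t"] by (auto simp: merges_seg)
    ultimately have "k \<in> colours (seg w 0 t)"
      using t rank[of t] T(3)[of t q] by (auto simp: D_seg merges_seg k_def)
    then have "colour (seg w 0 t) \<le> k"
      unfolding colour_def using fin by simp
    then show ?thesis
      using \<open>\<forall>t\<ge>T. k \<le> colour (seg w 0 t)\<close> t(1) by (intro exI[of _ t]) (auto intro: antisym)
  qed
  moreover have "even k = L w"
    by (simp add: k_def)
  ultimately show ?thesis
    unfolding parity_def by blast
qed

theorem parity_automaton: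
  obtains st :: "'a list \<Rightarrow> nat list list" and c where "finite (range st)"
    "\<And>u u' a. st u = st u' \<Longrightarrow> st (u @ [a]) = st (u' @ [a])"
    "\<And>w. parity (L w) (\<lambda>t. c (st (seg w 0 t)))"
proof -
  define c where "c m = colour (SOME u. matrix u = m)" for m
  have "c (matrix u) = colour u" for u
    unfolding c_def by (rule colour_cong) (rule someI[of _ u], simp)
  then show thesis
    using that[OF finite_range_matrix matrix_snoc_cong, of c] parity_colour by simp
qed

end

section \<open>Types of words\<close>

text \<open>Set variables only and four constructors, which keeps the many inductions short;
  positions are accessed only through \<open>Meet\<close> and \<open>Before\<close>.\<close>

datatype core = Meet nat nat | Before nat nat | Nand core core | Ex nat core

text \<open>A letter lists the variables whose values contain the current position.\<close>

type_synonym letter = "nat list"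

definition letter_variants :: "nat \<Rightarrow> letter \<Rightarrow> letter list" where
  "letter_variants X a = [removeAll X a, X # removeAll X a]"

fun csat :: "core \<Rightarrow> (nat \<Rightarrow> letter) \<Rightarrow> bool" where
  "csat (Meet X Y) w \<longleftrightarrow> (\<exists>t. X \<in> set (w t) \<and> Y \<in> set (w t))"
| "csat (Before X Y) w \<longleftrightarrow> (\<exists>s t. s < t \<and> X \<in> set (w s) \<and> Y \<in> set (w t))"
| "csat (Nand \<phi> \<chi>) w \<longleftrightarrow> \<not> (csat \<phi> w \<and> csat \<chi> w)"
| "csat (Ex X \<phi>) w \<longleftrightarrow> (\<exists>w'. (\<forall>t. w' t \<in> set (letter_variants X (w t))) \<and> csat \<phi> w')"

fun variants :: "nat \<Rightarrow> letter list \<Rightarrow> letter list list" where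
  "variants X [] = [[]]"
| "variants X (a # u) =
     map ((#) (removeAll X a)) (variants X u) @ map ((#) (X # removeAll X a)) (variants X u)"

definition occurs :: "nat \<Rightarrow> letter list \<Rightarrow> bool" where
  "occurs X u \<longleftrightarrow> (\<exists>a\<in>set u. X \<in> set a)"

text \<open>Quantifiers bounded by lists, because this test is later shown to be decidable.\<close>

definition before :: "nat \<Rightarrow> nat \<Rightarrow> letter list \<Rightarrow> bool" where
  "before X Y u \<longleftrightarrow> (\<exists>j\<in>set [0..<length u]. Y \<in> set (u ! j) \<and> (\<exists>i\<in>set [0..<j]. X \<in> set (u ! i)))"

definition meets :: "nat \<Rightarrow> nat \<Rightarrow> letter list \<Rightarrow> bool" where
  "meets X Y u \<longleftrightarrow> (\<exists>a\<in>set u. X \<in> set a \<and> Y \<in> set a)"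

text \<open>For \<open>Before\<close> the single occurrences are recorded too, since a pair may be
  split between two factors. For \<open>Ex\<close> the type is a finite set of types, coded by its
  sorted list.\<close>

fun tp :: "core \<Rightarrow> letter list \<Rightarrow> nat" where
  "tp (Meet X Y) u = of_bool (meets X Y u)"
| "tp (Before X Y) u =
     prod_encode (of_bool (occurs X u), prod_encode (of_bool (occurs Y u), of_bool (before X Y u)))"
| "tp (Nand \<phi> \<chi>) u = prod_encode (tp \<phi> u, tp \<chi> u)"
| "tp (Ex X \<phi>) u = list_encode (sorted_list_of_set (tp \<phi> ` set (variants X u)))"

lemma set_variants: "set (variants X u) = {v. list_all2 (\<lambda>a b. b \<in> set (letter_variants X a)) u v}"
  by (induction u) (auto simp: list_all2_Cons1 letter_variants_def)

lemma variants_append: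
  "set (variants X (u @ v)) = {u' @ v' | u' v'. u' \<in> set (variants X u) \<and> v' \<in> set (variants X v)}"
proof
  show "set (variants X (u @ v)) \<subseteq> {u' @ v' | u' v'. u' \<in> set (variants X u) \<and> v' \<in> set (variants X v)}"
    by (auto simp: set_variants list_all2_append1)
  show "{u' @ v' | u' v'. u' \<in> set (variants X u) \<and> v' \<in> set (variants X v)} \<subseteq> set (variants X (u @ v))"
    by (auto simp: set_variants intro: list_all2_appendI)
qed

lemma tp_Ex_eq_iff:
  "tp (Ex X \<phi>) u = tp (Ex X \<phi>) v \<longleftrightarrow> tp \<phi> ` set (variants X u) = tp \<phi> ` set (variants X v)"
  by (simp add: list_encode_eq) (metis List.finite_set finite_imageI sorted_list_of_set.set_sorted_key_list_of_set)

lemma tp_Ex_transfer: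
  assumes "tp (Ex X \<phi>) u = tp (Ex X \<phi>) u'" "a \<in> set (variants X u)"
  shows "\<exists>a'. a' \<in> set (variants X u') \<and> tp \<phi> a = tp \<phi> a'"
proof -
  have "tp \<phi> a \<in> tp \<phi> ` set (variants X u')"
    using assms unfolding tp_Ex_eq_iff by blast
  then show ?thesis
    by (rule imageE) blast
qed

lemma finite_range_tp: "finite (range (tp \<phi>))"
proof (induction \<phi>)
  case (Meet X Y)
  have "range (tp (Meet X Y)) \<subseteq> {0, 1}"
    by auto
  then show ?case
    by (rule finite_subset) simp
next
  case (Before X Y)
  have "range (tp (Before X Y)) \<subseteq>
      (\<lambda>(a, b, c). prod_encode (a, prod_encode (b, c))) ` ({0, 1} \<times> {0, 1} \<times> {0, 1})"
    by (auto simp: image_iff)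
  then show ?case
    by (rule finite_subset) simp
next
  case (Nand \<phi> \<chi>)
  have "range (tp (Nand \<phi> \<chi>)) \<subseteq> prod_encode ` (range (tp \<phi>) \<times> range (tp \<chi>))"
    by auto
  then show ?case
    by (rule finite_subset) (use Nand in simp)
next
  case (Ex X \<phi>)
  have "range (tp (Ex X \<phi>)) \<subseteq> (\<lambda>S. list_encode (sorted_list_of_set S)) ` Pow (range (tp \<phi>))"
    by auto
  then show ?case
    by (rule finite_subset) (use Ex in simp)
qed

lemma before_iff: "before X Y u \<longleftrightarrow> (\<exists>i j. i < j \<and> j < length u \<and> X \<in> set (u ! i) \<and> Y \<in> set (u ! j))"
  unfolding before_def set_upt Bex_def atLeastLessThan_iff by blast

lemma before_append:
  "before X Y (u @ v) \<longleftrightarrow> before X Y u \<or> before X Y v \<or> occurs X u \<and> occurs Y v"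
proof
  assume "before X Y (u @ v)"
  then obtain i j where ij: "i < j" "j < length u + length v" "X \<in> set ((u @ v) ! i)" "Y \<in> set ((u @ v) ! j)"
    by (auto simp: before_iff)
  consider "j < length u" | "i < length u" "length u \<le> j" | "length u \<le> i"
    by linarith
  then show "before X Y u \<or> before X Y v \<or> occurs X u \<and> occurs Y v"
  proof cases
    case 1
    then have "before X Y u"
      using ij by (auto simp: before_iff nth_append)
    then show ?thesis by simp
  next
    case 2
    then have "occurs X u \<and> occurs Y v"
      using ij by (auto simp: occurs_def nth_append intro!: bexI[OF _ nth_mem])
    then show ?thesis by simp
  next
    case 3
    then have "i - length u < j - length u \<and> j - length u < length v \<and>
        X \<in> set (v ! (i - length u)) \<and> Y \<in> set (v ! (j - length u))"
      using ij by (auto simp: nth_append)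
    then have "before X Y v"
      unfolding before_iff by blast
    then show ?thesis by simp
  qed
next
  assume "before X Y u \<or> before X Y v \<or> occurs X u \<and> occurs Y v"
  then show "before X Y (u @ v)"
  proof (elim disjE conjE)
    assume "before X Y u"
    then obtain i j where "i < j" "j < length u" "X \<in> set (u ! i)" "Y \<in> set (u ! j)"
      by (auto simp: before_iff)
    then show ?thesis
      unfolding before_iff by (intro exI[of _ i] exI[of _ j]) (auto simp: nth_append)
  next
    assume "before X Y v"
    then obtain i j where "i < j" "j < length v" "X \<in> set (v ! i)" "Y \<in> set (v ! j)"
      by (auto simp: before_iff)
    then show ?thesis
      unfolding before_iff
      by (intro exI[of _ "length u + i"] exI[of _ "length u + j"]) (auto simp: nth_append)
  next
    assume "occurs X u" "occurs Y v"
    then obtain i j where "i < length u" "X \<in> set (u ! i)" "j < length v" "Y \<in> set (v ! j)"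
      unfolding occurs_def by (metis in_set_conv_nth)
    then show ?thesis
      unfolding before_iff by (intro exI[of _ i] exI[of _ "length u + j"]) (auto simp: nth_append)
  qed
qed

text \<open>The variants of a concatenation are the concatenations of variants, so in the case of
  \<open>Ex\<close> the induction hypothesis can be applied to each pair of variants.\<close>

lemma tp_append_cong:
  "tp \<phi> u = tp \<phi> u' \<Longrightarrow> tp \<phi> v = tp \<phi> v' \<Longrightarrow> tp \<phi> (u @ v) = tp \<phi> (u' @ v')"
proof (induction \<phi> arbitrary: u u' v v')
  case (Meet X Y)
  have "meets X Y (a @ b) \<longleftrightarrow> meets X Y a \<or> meets X Y b" for a b
    by (auto simp: meets_def)
  then show ?case
    using Meet by simp
next
  case (Before X Y)
  have "occurs Z (a @ b) \<longleftrightarrow> occurs Z a \<or> occurs Z b" for a b Z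
    by (auto simp: occurs_def)
  moreover have "occurs X u = occurs X u'" "occurs Y u = occurs Y u'" "before X Y u = before X Y u'"
    "occurs X v = occurs X v'" "occurs Y v = occurs Y v'" "before X Y v = before X Y v'"
    using Before by (simp_all add: of_bool_eq_iff)
  ultimately show ?case
    by (simp add: before_append)
next
  case (Nand \<phi> \<chi>)
  have "tp \<phi> (u @ v) = tp \<phi> (u' @ v')"
    by (rule Nand.IH(1)) (use Nand.prems in auto)
  moreover have "tp \<chi> (u @ v) = tp \<chi> (u' @ v')"
    by (rule Nand.IH(2)) (use Nand.prems in auto)
  ultimately show ?case
    by simp
next
  case (Ex X \<phi>)
  have sub: "tp \<phi> ` set (variants X (u @ v)) \<subseteq> tp \<phi> ` set (variants X (u' @ v'))"
    if eq: "tp (Ex X \<phi>) u = tp (Ex X \<phi>) u'" "tp (Ex X \<phi>) v = tp (Ex X \<phi>) v'" for u v u' v'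
  proof
    fix s assume "s \<in> tp \<phi> ` set (variants X (u @ v))"
    then obtain a b where ab: "s = tp \<phi> (a @ b)" "a \<in> set (variants X u)" "b \<in> set (variants X v)"
      by (auto simp: variants_append)
    obtain a' where a': "a' \<in> set (variants X u')" "tp \<phi> a = tp \<phi> a'"
      using tp_Ex_transfer[OF eq(1), of a] ab(2) by blast
    obtain b' where b': "b' \<in> set (variants X v')" "tp \<phi> b = tp \<phi> b'"
      using tp_Ex_transfer[OF eq(2), of b] ab(3) by blast
    have "s = tp \<phi> (a' @ b')"
      using ab(1) Ex.IH[OF a'(2) b'(2)] by simp
    then show "s \<in> tp \<phi> ` set (variants X (u' @ v'))"
      using a'(1) b'(1) by (auto simp: variants_append)
  qed
  show ?case
    unfolding tp_Ex_eq_iff[of _ _ "_ @ _"]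
    using sub[OF Ex.prems] sub[OF Ex.prems[symmetric]] by (rule subset_antisym)
qed

lemma block_exists:
  fixes g :: "nat \<Rightarrow> nat"
  assumes "strict_mono g" "g 0 = 0"
  obtains i where "g i \<le> t" "t < g (Suc i)"
proof -
  have "\<exists>i. g i \<le> t \<and> t < g (Suc i)"
  proof (induction t)
    case 0
    then show ?case
      using assms strict_monoD[OF assms(1), of 0 1] by (intro exI[of _ 0]) auto
  next
    case (Suc t)
    then obtain i where i: "g i \<le> t" "t < g (Suc i)" by blast
    show ?case
    proof (cases "Suc t < g (Suc i)")
      case True
      then show ?thesis
        using i by (intro exI[of _ i]) auto
    next
      case False
      then show ?thesis
        using i strict_monoD[OF assms(1), of "Suc i" "Suc (Suc i)"] by (intro exI[of _ "Suc i"]) auto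
    qed
  qed
  then show thesis
    using that by blast
qed

lemma assemble:
  fixes g :: "nat \<Rightarrow> nat"
  assumes "strict_mono g" "\<And>i. length (B i) = g (Suc i) - g i"
  obtains v where "\<And>i. seg v (g i) (g (Suc i)) = B i"
proof -
  define ix where "ix t = (LEAST i. t < g (Suc i))" for t
  have ix: "ix t = i" if "g i \<le> t" "t < g (Suc i)" for i t
    unfolding ix_def
  proof (rule Least_equality)
    fix j assume "t < g (Suc j)"
    then have "g i < g (Suc j)" using that by simp
    then show "i \<le> j"
      using assms(1) by (simp add: strict_mono_less)
  qed (use that in simp)
  have "seg (\<lambda>t. B (ix t) ! (t - g (ix t))) (g i) (g (Suc i)) = B i" for i
  proof (rule nth_equalityI)
    fix k assume "k < length (seg (\<lambda>t. B (ix t) ! (t - g (ix t))) (g i) (g (Suc i)))"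
    then show "seg (\<lambda>t. B (ix t) ! (t - g (ix t))) (g i) (g (Suc i)) ! k = B i ! k"
      using ix[of i "g i + k"] by simp
  qed (use assms(2) in simp)
  then show thesis
    using that by blast
qed

lemma occurs_seg: "occurs X (seg w i j) \<longleftrightarrow> (\<exists>t. i \<le> t \<and> t < j \<and> X \<in> set (w t))"
  by (auto simp: occurs_def seg_def)

lemma meets_seg: "meets X Y (seg w i j) \<longleftrightarrow> (\<exists>t. i \<le> t \<and> t < j \<and> X \<in> set (w t) \<and> Y \<in> set (w t))"
  by (auto simp: meets_def seg_def)

lemma before_seg:
  "before X Y (seg w i j) \<longleftrightarrow> (\<exists>s t. i \<le> s \<and> s < t \<and> t < j \<and> X \<in> set (w s) \<and> Y \<in> set (w t))"
proof
  assume "before X Y (seg w i j)"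
  then obtain k l where "k < l" "l < j - i" "X \<in> set (w (i + k))" "Y \<in> set (w (i + l))"
    by (auto simp: before_iff)
  then show "\<exists>s t. i \<le> s \<and> s < t \<and> t < j \<and> X \<in> set (w s) \<and> Y \<in> set (w t)"
    by (intro exI[of _ "i + k"] exI[of _ "i + l"]) auto
next
  assume "\<exists>s t. i \<le> s \<and> s < t \<and> t < j \<and> X \<in> set (w s) \<and> Y \<in> set (w t)"
  then obtain s t where "i \<le> s" "s < t" "t < j" "X \<in> set (w s)" "Y \<in> set (w t)" by blast
  then show "before X Y (seg w i j)"
    unfolding before_iff by (intro exI[of _ "s - i"] exI[of _ "t - i"]) auto
qed

text \<open>In the case of \<open>Ex\<close>, the witness for \<open>w\<close> is transferred block
  by block: equal types provide a variant of each block of \<open>w'\<close> with the right type,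
  and \<open>assemble\<close> glues these variants into one infinite word.\<close>

lemma csat_saturated:
  assumes f: "strict_mono f" "f 0 = 0" and g: "strict_mono g" "g 0 = 0"
    and "\<And>i. tp \<phi> (seg w (f i) (f (Suc i))) = tp \<phi> (seg w' (g i) (g (Suc i)))"
  shows "csat \<phi> w \<longleftrightarrow> csat \<phi> w'"
proof -
  have "csat \<phi> w \<longleftrightarrow> csat \<phi> w'"
    if "strict_mono f" "f 0 = 0" "strict_mono g" "g 0 = 0"
      "\<And>i. tp \<phi> (seg w (f i) (f (Suc i))) = tp \<phi> (seg w' (g i) (g (Suc i)))" for w w' f g
    using that
  proof (induction \<phi> arbitrary: w w' f g)
    case (Meet X Y)
    have eq: "csat (Meet X Y) w \<longleftrightarrow> (\<exists>i. meets X Y (seg w (f i) (f (Suc i))))"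
      if fm: "strict_mono f" "f 0 = 0" for w and f :: "nat \<Rightarrow> nat"
    proof
      assume "csat (Meet X Y) w"
      then obtain t where t: "X \<in> set (w t)" "Y \<in> set (w t)"
        by auto
      obtain i where "f i \<le> t" "t < f (Suc i)"
        using block_exists[OF fm] by blast
      then show "\<exists>i. meets X Y (seg w (f i) (f (Suc i)))"
        using t unfolding meets_seg by blast
    next
      assume "\<exists>i. meets X Y (seg w (f i) (f (Suc i)))"
      then show "csat (Meet X Y) w"
        by (auto simp: meets_seg)
    qed
    have "meets X Y (seg w (f i) (f (Suc i))) = meets X Y (seg w' (g i) (g (Suc i)))" for i
      using Meet.prems(5)[of i] by (simp add: of_bool_eq_iff)
    then show ?case
      unfolding eq[OF Meet.prems(1,2), of w] eq[OF Meet.prems(3,4), of w'] by simp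
  next
    case (Before X Y)
    have eq: "csat (Before X Y) w \<longleftrightarrow> (\<exists>i. before X Y (seg w (f i) (f (Suc i)))) \<or>
        (\<exists>i j. i < j \<and> occurs X (seg w (f i) (f (Suc i))) \<and> occurs Y (seg w (f j) (f (Suc j))))"
      if fm: "strict_mono f" "f 0 = 0" for w and f :: "nat \<Rightarrow> nat"
    proof
      assume "csat (Before X Y) w"
      then obtain s t where st: "s < t" "X \<in> set (w s)" "Y \<in> set (w t)"
        by auto
      obtain i where i: "f i \<le> s" "s < f (Suc i)"
        using block_exists[OF fm] by blast
      obtain j where j: "f j \<le> t" "t < f (Suc j)"
        using block_exists[OF fm] by blast
      have "f i < f (Suc j)"
        using i j st by simp
      then have "i \<le> j"
        using fm(1) by (simp add: strict_mono_less)
      then show "(\<exists>i. before X Y (seg w (f i) (f (Suc i)))) \<or>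
        (\<exists>i j. i < j \<and> occurs X (seg w (f i) (f (Suc i))) \<and> occurs Y (seg w (f j) (f (Suc j))))"
      proof (cases "i = j")
        case True
        then show ?thesis
          using i j st unfolding before_seg by blast
      next
        case False
        then show ?thesis
          using i j st \<open>i \<le> j\<close> unfolding occurs_seg by (metis le_neq_implies_less)
      qed
    next
      assume "(\<exists>i. before X Y (seg w (f i) (f (Suc i)))) \<or>
        (\<exists>i j. i < j \<and> occurs X (seg w (f i) (f (Suc i))) \<and> occurs Y (seg w (f j) (f (Suc j))))"
      then show "csat (Before X Y) w"
      proof (elim disjE exE conjE)
        fix i assume "before X Y (seg w (f i) (f (Suc i)))"
        then show ?thesis
          by (auto simp: before_seg)
      next
        fix i j assume ij: "i < j" "occurs X (seg w (f i) (f (Suc i)))" "occurs Y (seg w (f j) (f (Suc j)))"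
        then obtain s t where st: "s < f (Suc i)" "X \<in> set (w s)" "f j \<le> t" "Y \<in> set (w t)"
          by (auto simp: occurs_seg)
        have "f (Suc i) \<le> f j"
          using fm(1) ij(1) by (simp add: strict_mono_less_eq)
        then have "s < t"
          using st by simp
        then show ?thesis
          using st by auto
      qed
    qed
    have "occurs X (seg w (f i) (f (Suc i))) = occurs X (seg w' (g i) (g (Suc i))) \<and>
      occurs Y (seg w (f i) (f (Suc i))) = occurs Y (seg w' (g i) (g (Suc i))) \<and>
      before X Y (seg w (f i) (f (Suc i))) = before X Y (seg w' (g i) (g (Suc i)))" for i
      using Before.prems(5)[of i] by (simp add: of_bool_eq_iff)
    then show ?case
      unfolding eq[OF Before.prems(1,2), of w] eq[OF Before.prems(3,4), of w'] by simp
  next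
    case (Nand \<phi> \<chi>)
    have "csat \<phi> w \<longleftrightarrow> csat \<phi> w'"
      by (rule Nand.IH(1)[OF Nand.prems(1-4)]) (use Nand.prems(5) in simp)
    moreover have "csat \<chi> w \<longleftrightarrow> csat \<chi> w'"
      by (rule Nand.IH(2)[OF Nand.prems(1-4)]) (use Nand.prems(5) in simp)
    ultimately show ?case
      by simp
  next
    case (Ex X \<phi>)
    have imp: "csat (Ex X \<phi>) w'" if fg: "strict_mono f" "f 0 = 0" "strict_mono g" "g 0 = 0"
      "\<And>i. tp (Ex X \<phi>) (seg w (f i) (f (Suc i))) = tp (Ex X \<phi>) (seg w' (g i) (g (Suc i)))"
      and "csat (Ex X \<phi>) w" for w w' and f g :: "nat \<Rightarrow> nat"
    proof -
      obtain v where v: "\<And>t. v t \<in> set (letter_variants X (w t))" "csat \<phi> v"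
        using \<open>csat (Ex X \<phi>) w\<close> by auto
      have "\<exists>b. b \<in> set (variants X (seg w' (g i) (g (Suc i)))) \<and> tp \<phi> (seg v (f i) (f (Suc i))) = tp \<phi> b" for i
      proof -
        have "seg v (f i) (f (Suc i)) \<in> set (variants X (seg w (f i) (f (Suc i))))"
          using v(1) by (auto simp: set_variants list_all2_conv_all_nth)
        then show ?thesis
          using tp_Ex_transfer[OF fg(5)] by blast
      qed
      then obtain B where B: "\<And>i. B i \<in> set (variants X (seg w' (g i) (g (Suc i))))"
        "\<And>i. tp \<phi> (seg v (f i) (f (Suc i))) = tp \<phi> (B i)"
        by metis
      have len: "length (B i) = g (Suc i) - g i" for i
        using B(1)[of i] by (auto simp: set_variants dest: list_all2_lengthD)
      obtain v' where v': "\<And>i. seg v' (g i) (g (Suc i)) = B i"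
        using assemble[OF fg(3) len] by blast
      have "v' t \<in> set (letter_variants X (w' t))" for t
      proof -
        obtain i where i: "g i \<le> t" "t < g (Suc i)"
          using block_exists[OF fg(3,4)] by blast
        have "list_all2 (\<lambda>a b. b \<in> set (letter_variants X a))
            (seg w' (g i) (g (Suc i))) (seg v' (g i) (g (Suc i)))"
          using B(1)[of i] v' by (simp add: set_variants)
        from list_all2_nthD[OF this, of "t - g i"] show ?thesis
          using i by simp
      qed
      moreover have "csat \<phi> v'"
        using Ex.IH[OF fg(1-4), of v v'] B(2) v' v(2) by simp
      ultimately show ?thesis
        by auto
    qed
    show ?case
    proof
      assume "csat (Ex X \<phi>) w"
      then show "csat (Ex X \<phi>) w'"
        using imp[OF Ex.prems(1-5)] by blast
    next
      assume "csat (Ex X \<phi>) w'"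
      then show "csat (Ex X \<phi>) w"
        using imp[OF Ex.prems(3,4,1,2) Ex.prems(5)[symmetric]] by blast
    qed
  qed
  then show ?thesis
    using assms by blast
qed

lemma recognised_csat: "recognised (tp \<phi>) (csat \<phi>)"
  by (unfold_locales, rule finite_range_tp, erule (1) tp_append_cong) (use csat_saturated in blast)

section \<open>Translation of MLO into the core language\<close>

abbreviation cNot :: "core \<Rightarrow> core" where
  "cNot \<phi> \<equiv> Nand \<phi> \<phi>"

abbreviation cAnd :: "core \<Rightarrow> core \<Rightarrow> core" where
  "cAnd \<phi> \<chi> \<equiv> cNot (Nand \<phi> \<chi>)"

text \<open>An individual variable becomes a set variable ranging over singletons.\<close>

fun to_core :: "mlo \<Rightarrow> core" where
  "to_core (Less x y) = Before (2 * x) (2 * y)"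
| "to_core (Equal x y) = Meet (2 * x) (2 * y)"
| "to_core (Mem x X) = Meet (2 * x) (Suc (2 * X))"
| "to_core (Neg \<phi>) = cNot (to_core \<phi>)"
| "to_core (Conj \<phi> \<chi>) = cAnd (to_core \<phi>) (to_core \<chi>)"
| "to_core (ExI x \<phi>) = Ex (2 * x)
     (cAnd (cAnd (Meet (2 * x) (2 * x)) (cNot (Before (2 * x) (2 * x)))) (to_core \<phi>))"
| "to_core (ExS X \<phi>) = Ex (Suc (2 * X)) (to_core \<phi>)"

definition assign :: "nat \<Rightarrow> nat set \<Rightarrow> (nat \<Rightarrow> letter) \<Rightarrow> nat \<Rightarrow> letter" where
  "assign X S w t = (if t \<in> S then X # removeAll X (w t) else removeAll X (w t))"

lemma mem_assign: "Z \<in> set (assign X S w t) \<longleftrightarrow> (if Z = X then t \<in> S else Z \<in> set (w t))"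
  by (auto simp: assign_def)

lemma csat_Ex_iff: "csat (Ex X \<phi>) w \<longleftrightarrow> (\<exists>S. csat \<phi> (assign X S w))"
proof
  assume "csat (Ex X \<phi>) w"
  then obtain w' where w': "\<And>t. w' t \<in> set (letter_variants X (w t))" "csat \<phi> w'"
    by auto
  have "assign X {t. X \<in> set (w' t)} w t = w' t" for t
    using w'(1)[of t] by (auto simp: assign_def letter_variants_def)
  then have "assign X {t. X \<in> set (w' t)} w = w'"
    by blast
  then show "\<exists>S. csat \<phi> (assign X S w)"
    using w'(2) by metis
next
  assume "\<exists>S. csat \<phi> (assign X S w)"
  then obtain S where "csat \<phi> (assign X S w)" ..
  moreover have "assign X S w t \<in> set (letter_variants X (w t))" for t
    by (simp add: assign_def letter_variants_def)
  ultimately show "csat (Ex X \<phi>) w"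
    by auto
qed

declare csat.simps(4) [simp del]

lemma csat_to_core:
  assumes "\<forall>x\<in>free_ind \<phi>. {t. 2 * x \<in> set (w t)} = {u x}"
    and "\<forall>X\<in>free_set \<phi>. {t. Suc (2 * X) \<in> set (w t)} = V X"
  shows "csat (to_core \<phi>) w \<longleftrightarrow> sat u V \<phi>"
  using assms
proof (induction \<phi> arbitrary: u V w)
  case (Less x y)
  then have "2 * x \<in> set (w t) \<longleftrightarrow> t = u x" "2 * y \<in> set (w t) \<longleftrightarrow> t = u y" for t
    by auto
  then show ?case by simp
next
  case (Equal x y)
  then have "2 * x \<in> set (w t) \<longleftrightarrow> t = u x" "2 * y \<in> set (w t) \<longleftrightarrow> t = u y" for t
    by auto
  then show ?case by simp
next
  case (Mem x X)
  then have "2 * x \<in> set (w t) \<longleftrightarrow> t = u x" "Suc (2 * X) \<in> set (w t) \<longleftrightarrow> t \<in> V X" for t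
    by auto
  then show ?case by simp
next
  case (Neg \<phi>)
  then show ?case by simp
next
  case (Conj \<phi> \<chi>)
  have "csat (to_core \<phi>) w \<longleftrightarrow> sat u V \<phi>"
    by (rule Conj.IH(1)) (use Conj.prems in auto)
  moreover have "csat (to_core \<chi>) w \<longleftrightarrow> sat u V \<chi>"
    by (rule Conj.IH(2)) (use Conj.prems in auto)
  ultimately show ?case
    by simp
next
  case (ExI x \<phi>)
  \<comment> \<open>\<open>Meet X X\<close> says that the track \<open>X\<close> is nonempty, the
    negation of \<open>Before X X\<close> that it has at most one position.\<close>
  have sing: "csat (Meet X X) w \<and> \<not> csat (Before X X) w \<longleftrightarrow> (\<exists>t. {t. X \<in> set (w t)} = {t})" for X w
  proof
    assume l: "csat (Meet X X) w \<and> \<not> csat (Before X X) w"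
    then obtain t where t: "X \<in> set (w t)" by auto
    have "s = t" if "X \<in> set (w s)" for s
      using l t that by (metis csat.simps(2) linorder_neqE_nat)
    then show "\<exists>t. {t. X \<in> set (w t)} = {t}"
      using t by blast
  next
    assume "\<exists>t. {t. X \<in> set (w t)} = {t}"
    then obtain t where "X \<in> set (w s) \<longleftrightarrow> s = t" for s by blast
    then show "csat (Meet X X) w \<and> \<not> csat (Before X X) w" by simp
  qed
  have IH: "csat (to_core \<phi>) (assign (2 * x) {t} w) \<longleftrightarrow> sat (u(x := t)) V \<phi>" for t
    by (rule ExI.IH) (use ExI.prems in \<open>auto simp: mem_assign\<close>, presburger+)
  have "csat (to_core (ExI x \<phi>)) w \<longleftrightarrow>
      (\<exists>S. (csat (Meet (2 * x) (2 * x)) (assign (2 * x) S w) \<and>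
        \<not> csat (Before (2 * x) (2 * x)) (assign (2 * x) S w)) \<and>
        csat (to_core \<phi>) (assign (2 * x) S w))"
    by (simp add: csat_Ex_iff del: csat.simps(1,2))
  also have "\<dots> \<longleftrightarrow> (\<exists>S. (\<exists>t. S = {t}) \<and> csat (to_core \<phi>) (assign (2 * x) S w))"
    unfolding sing by (simp add: mem_assign)
  also have "\<dots> \<longleftrightarrow> (\<exists>t. csat (to_core \<phi>) (assign (2 * x) {t} w))"
    by blast
  finally show ?case
    using IH by simp
next
  case (ExS X \<phi>)
  have "csat (to_core \<phi>) (assign (Suc (2 * X)) S w) \<longleftrightarrow> sat u (V(X := S)) \<phi>" for S
    by (rule ExS.IH) (use ExS.prems in \<open>auto simp: mem_assign\<close>, presburger+)
  then show ?case
    by (simp add: csat_Ex_iff)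
qed

text \<open>1, 3 and 5 are the tracks \<open>Suc (2 * Z)\<close> that \<open>to_core\<close> gives
  to the set variables 0, 1 and 2.\<close>

definition letter3 :: "bool \<Rightarrow> bool \<Rightarrow> bool \<Rightarrow> letter" where
  "letter3 x y p = (if x then [1] else []) @ (if y then [3] else []) @ (if p then [5] else [])"

definition word3 :: "nat set \<Rightarrow> nat set \<Rightarrow> nat set \<Rightarrow> nat \<Rightarrow> letter" where
  "word3 X Y P t = letter3 (t \<in> X) (t \<in> Y) (t \<in> P)"

lemma holds_iff_csat:
  assumes "formula_XYP \<psi>"
  shows "holds \<psi> X Y P \<longleftrightarrow> csat (to_core \<psi>) (word3 X Y P)"
proof -
  have "{t. Suc (2 * Z) \<in> set (word3 X Y P t)} = ((\<lambda>_. {})(0 := X, 1 := Y, 2 := P)) Z"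
    if "Z = 0 \<or> Z = 1 \<or> Z = 2" for Z
    using that by (elim disjE) (simp_all add: word3_def letter3_def)
  then have "\<forall>Z\<in>free_set \<psi>. {t. Suc (2 * Z) \<in> set (word3 X Y P t)} =
      ((\<lambda>_. {})(0 := X, 1 := Y, 2 := P)) Z"
    using assms unfolding formula_XYP_def by blast
  then show ?thesis
    unfolding holds_def using assms by (intro csat_to_core[symmetric]) (simp_all add: formula_XYP_def)
qed

section \<open>Synthesis for ultimately periodic parameters\<close>

lemma state_after_0 [simp]: "state_after \<delta> q a 0 = q"
  by (simp add: state_after_def)

lemma state_after_Suc [simp]: "state_after \<delta> q a (Suc i) = \<delta> (state_after \<delta> q a i) (a i)"
  by (simp add: state_after_def)

lemma state_after_in:
  assumes "transition_system Q q0 \<delta>"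
  shows "state_after \<delta> q0 a i \<in> Q"
  using assms by (induction i) (auto simp: transition_system_def)

lemma state_after_cong: "(\<forall>i<t. a i = a' i) \<Longrightarrow> state_after \<delta> q a t = state_after \<delta> q a' t"
  by (induction t) auto

lemma mealy_causal:
  fixes F :: "('a, 'b) operator"
  assumes F: "mealy Q q0 \<delta> out F"
  shows "causal F"
  unfolding causal_def
proof (intro allI impI)
  fix a a' :: "'a omega_string" and t i assume a: "\<forall>i\<le>t. a i = a' i" "i \<le> t"
  have "state_after \<delta> q0 a i = state_after \<delta> q0 a' i"
    by (rule state_after_cong) (use a in auto)
  then show "F a i = F a' i"
    using F a by (simp add: mealy_def)
qed

lemma moore_strongly_causal:
  fixes F :: "('a, 'b) operator"
  assumes F: "moore Q q0 \<delta> out F"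
  shows "strongly_causal F"
  unfolding strongly_causal_def
proof (intro allI impI)
  fix a a' :: "'a omega_string" and t i assume a: "\<forall>i<t. a i = a' i" "i \<le> t"
  have "state_after \<delta> q0 a i = state_after \<delta> q0 a' i"
    by (rule state_after_cong) (use a in auto)
  then show "F a i = F a' i"
    using F by (simp add: moore_def)
qed

text \<open>The states obtained from the game are pairs of a residual and an automaton state,
  whereas operators and tables want numbers below some \<open>n\<close>.\<close>

lemma transition_system_rename:
  assumes "transition_system Q q0 \<delta>"
  obtains n :: nat and f g where "\<And>q. q \<in> Q \<Longrightarrow> g (f q) = q"
    "transition_system {..<n} (f q0) (\<lambda>i a. f (\<delta> (g i) a))"
    "\<And>a t. state_after (\<lambda>i a. f (\<delta> (g i) a)) (f q0) a t = f (state_after \<delta> q0 a t)"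
proof -
  have fin: "finite Q"
    using assms by (simp add: transition_system_def)
  obtain f where f: "bij_betw f Q {0..<card Q}"
    using ex_bij_betw_finite_nat[OF fin] by blast
  define g where "g = inv_into Q f"
  have gf: "g (f q) = q" if "q \<in> Q" for q
    unfolding g_def using bij_betw_inv_into_left[OF f that] .
  have f_lt: "f q < card Q" if "q \<in> Q" for q
    using bij_betwE[OF f] that by simp
  have g_in: "g i \<in> Q" if "i < card Q" for i
    using that bij_betwE[OF bij_betw_inv_into[OF f]] unfolding g_def by simp
  have "transition_system {..<card Q} (f q0) (\<lambda>i a. f (\<delta> (g i) a))"
    using assms f_lt g_in by (simp add: transition_system_def)
  moreover have "state_after (\<lambda>i a. f (\<delta> (g i) a)) (f q0) a t = f (state_after \<delta> q0 a t)" for a t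
    by (induction t) (simp_all add: gf state_after_in[OF assms])
  ultimately show thesis
    using that[of g f "card Q"] gf by blast
qed

lemma mealy_rename:
  assumes "mealy Q q0 \<delta> out F"
  shows "\<exists>n q0' \<delta>' out'. mealy {..<n :: nat} q0' \<delta>' out' F"
proof -
  have ts: "transition_system Q q0 \<delta>"
    using assms by (simp add: mealy_def)
  show ?thesis
  proof (rule transition_system_rename[OF ts])
    fix n :: nat and f g
    assume "\<And>q. q \<in> Q \<Longrightarrow> g (f q) = q"
      and "transition_system {..<n} (f q0) (\<lambda>i a. f (\<delta> (g i) a))"
      and "\<And>a t. state_after (\<lambda>i a. f (\<delta> (g i) a)) (f q0) a t = f (state_after \<delta> q0 a t)"
    then have "mealy {..<n} (f q0) (\<lambda>i a. f (\<delta> (g i) a)) (\<lambda>i. out (g i)) F"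
      using assms state_after_in[OF ts] by (simp add: mealy_def)
    then show ?thesis
      by blast
  qed
qed

lemma moore_rename:
  assumes "moore Q q0 \<delta> out F"
  shows "\<exists>n q0' \<delta>' out'. moore {..<n :: nat} q0' \<delta>' out' F"
proof -
  have ts: "transition_system Q q0 \<delta>"
    using assms by (simp add: moore_def)
  show ?thesis
  proof (rule transition_system_rename[OF ts])
    fix n :: nat and f g
    assume "\<And>q. q \<in> Q \<Longrightarrow> g (f q) = q"
      and "transition_system {..<n} (f q0) (\<lambda>i a. f (\<delta> (g i) a))"
      and "\<And>a t. state_after (\<lambda>i a. f (\<delta> (g i) a)) (f q0) a t = f (state_after \<delta> q0 a t)"
    then have "moore {..<n} (f q0) (\<lambda>i a. f (\<delta> (g i) a)) (\<lambda>i. out (g i)) F"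
      using assms state_after_in[OF ts] by (simp add: moore_def)
    then show ?thesis
      by blast
  qed
qed

section \<open>Residuals of the parameter and the synthesis game\<close>

definition residual :: "nat set \<Rightarrow> nat \<Rightarrow> nat set" where
  "residual P t = {s. s + t \<in> P}"

lemma shift_residual: "{s. Suc s \<in> residual P t} = residual P (Suc t)"
  by (simp add: residual_def)

lemma residual_0_iff [simp]: "0 \<in> residual P t \<longleftrightarrow> t \<in> P"
  by (simp add: residual_def)

lemma finite_residuals:
  assumes "ultimately_periodic P"
  shows "finite (range (residual P))"
proof -
  obtain p d where p: "p > 0" "\<And>n. n > d \<Longrightarrow> n \<in> P \<longleftrightarrow> n + p \<in> P"
    using assms unfolding ultimately_periodic_def by blast
  have "residual P t \<in> residual P ` {..d + p}" for t
  proof (induction t rule: less_induct)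
    case (less t)
    show ?case
    proof (cases "t \<le> d + p")
      case False
      then have "residual P t = residual P (t - p)"
        using p(2)[of "_ + (t - p)"] by (auto simp: residual_def algebra_simps)
      then show ?thesis
        using less.IH[of "t - p"] False p(1) by simp
    qed simp
  qed
  then have "range (residual P) \<subseteq> residual P ` {..d + p}"
    by blast
  then show ?thesis
    by (rule finite_subset) simp
qed

text \<open>A round of the game consists of two nodes with the same automaton state, so the play
  shows every colour of the run twice.\<close>

lemma parity_halve:
  assumes "parity i (\<lambda>n. f (n div 2))"
  shows "parity i f"
proof -
  obtain k m where k: "even k = i" "\<forall>m. \<exists>n\<ge>m. f (n div 2) = k" "\<forall>n\<ge>m. k \<le> f (n div 2)"
    using assms unfolding parity_def by blast
  have "\<exists>n\<ge>m'. f n = k" for m'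
  proof -
    obtain n where "n \<ge> 2 * m'" "f (n div 2) = k"
      using k(2) by blast
    then show ?thesis
      by (intro exI[of _ "n div 2"]) auto
  qed
  moreover have "k \<le> f n" if "n \<ge> m" for n
    using k(3)[rule_format, of "2 * n"] that by simp
  ultimately show ?thesis
    unfolding parity_def using k(1) by blast
qed

text \<open>Residual of \<open>P\<close>, automaton state, and the letter of \<open>X\<close> that
  waits for an answer; at \<open>None\<close> the player choosing \<open>X\<close> is to
  move.\<close>

type_synonym node = "nat set \<times> nat list list \<times> bool option"

locale synthesis_game =
  fixes P :: "nat set" and \<phi> :: core and st :: "letter list \<Rightarrow> nat list list" and c :: "nat list list \<Rightarrow> nat"
  assumes finite_residuals: "finite (range (residual P))"
    and finite_states: "finite (range st)"
    and st_cong: "st u = st u' \<Longrightarrow> st (u @ [a]) = st (u' @ [a])"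
    and parity_st: "parity (csat \<phi> w) (\<lambda>t. c (st (seg w 0 t)))"
begin

definition dl :: "nat list list \<Rightarrow> letter \<Rightarrow> nat list list" where
  "dl q a = st ((SOME u. st u = q) @ [a])"

lemma dl_st: "dl (st u) a = st (u @ [a])"
  unfolding dl_def by (rule st_cong) (rule someI[of _ u], simp)

abbreviation shift :: "nat set \<Rightarrow> nat set" where
  "shift S \<equiv> {s. Suc s \<in> S}"

definition V :: "node set" where
  "V = range (residual P) \<times> range st \<times> UNIV"

definition own :: "node \<Rightarrow> bool" where
  "own v \<longleftrightarrow> snd (snd v) \<noteq> None"

fun move :: "node \<Rightarrow> node \<Rightarrow> bool" where
  "move (S, q, None) v \<longleftrightarrow> (\<exists>x. v = (S, q, Some x))"
| "move (S, q, Some x) v \<longleftrightarrow> (\<exists>y. v = (shift S, dl q (letter3 x y (0 \<in> S)), None))"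

definition col :: "node \<Rightarrow> nat" where
  "col v = c (fst (snd v))"

sublocale arena own move col .

lemma finite_V: "finite V"
  unfolding V_def using finite_residuals finite_states by simp

lemma V_total: "\<forall>v\<in>V. \<exists>v'\<in>V. move v v'"
proof
  fix v assume "v \<in> V"
  then obtain t u o' where v: "v = (residual P t, st u, o')"
    by (auto simp: V_def)
  show "\<exists>v'\<in>V. move v v'"
  proof (cases o')
    case None
    then show ?thesis
      using v by (intro bexI[of _ "(residual P t, st u, Some True)"]) (auto simp: V_def)
  next
    case (Some x)
    then show ?thesis
      using v by (intro bexI[of _ "(residual P (Suc t), st (u @ [letter3 x True (t \<in> P)]), None)"])
         (auto simp: V_def shift_residual dl_st)
  qed
qed

text \<open>One statement for both players: \<open>\<sigma>\<close> has to explain the moves of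
  player \<open>i\<close> only, and the letters of the other player are arbitrary.\<close>

lemma play_outcome:
  fixes x y :: "nat \<Rightarrow> bool"
  assumes win: "wins V i W \<sigma>" and init: "(residual P 0, st [], None) \<in> W"
    and w: "\<And>t. w t = letter3 (x t) (y t) (t \<in> P)"
    and out: "\<And>t. i \<Longrightarrow> \<sigma> (residual P t, st (seg w 0 t), Some (x t)) =
        (residual P (Suc t), st (seg w 0 (Suc t)), None)"
    and inp: "\<And>t. \<not> i \<Longrightarrow> \<sigma> (residual P t, st (seg w 0 t), None) = (residual P t, st (seg w 0 t), Some (x t))"
  shows "csat \<phi> w = i"
proof -
  define \<alpha> where "\<alpha> t = (residual P t, st (seg w 0 t), None :: bool option)" for t
  define \<beta> where "\<beta> t = (residual P t, st (seg w 0 t), Some (x t))" for t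
  have in_V: "\<alpha> t \<in> V" "\<beta> t \<in> V" for t
    by (auto simp: \<alpha>_def \<beta>_def V_def)
  have moves: "move (\<alpha> t) (\<beta> t)" "move (\<beta> t) (\<alpha> (Suc t))" for t
    by (auto simp: \<alpha>_def \<beta>_def shift_residual seg_Suc dl_st w)
  have own: "\<not> own (\<alpha> t)" "own (\<beta> t)" for t
    by (auto simp: \<alpha>_def \<beta>_def own_def)
  have \<beta>: "\<beta> t \<in> W" if "\<alpha> t \<in> W" for t
    using wins_own[OF win that] wins_other[OF win that _ in_V(2) moves(1)] own inp[of t]
    by (cases i) (auto simp: \<alpha>_def \<beta>_def)
  have \<alpha>: "\<alpha> (Suc t) \<in> W" if "\<beta> t \<in> W" for t
    using wins_own[OF win that] wins_other[OF win that _ in_V(1) moves(2)] own out[of t]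
    by (cases i) (auto simp: \<alpha>_def \<beta>_def)
  have in_W: "\<alpha> t \<in> W \<and> \<beta> t \<in> W" for t
  proof (induction t)
    case 0
    have "\<alpha> 0 \<in> W"
      using init by (simp add: \<alpha>_def)
    then show ?case
      using \<beta> by blast
  next
    case (Suc t)
    then show ?case
      using \<alpha> \<beta> by blast
  qed
  define \<pi> where "\<pi> n = (if even n then \<alpha> (n div 2) else \<beta> (n div 2))" for n
  have "play i \<sigma> W \<pi>"
    unfolding play_def
  proof (intro allI conjI impI)
    fix n
    show "\<pi> n \<in> W"
      using in_W by (simp add: \<pi>_def)
    show "move (\<pi> n) (\<pi> (Suc n))"
      using moves by (simp add: \<pi>_def)
    assume "own (\<pi> n) = i"
    then show "\<pi> (Suc n) = \<sigma> (\<pi> n)"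
      using own out[of "n div 2"] inp[of "n div 2"] by (auto simp: \<pi>_def \<alpha>_def \<beta>_def split: if_splits)
  qed
  then have "parity i (col \<circ> \<pi>)"
    using win unfolding wins_def by blast
  moreover have "col \<circ> \<pi> = (\<lambda>n. c (st (seg w 0 (n div 2))))"
    by (auto simp: \<pi>_def \<alpha>_def \<beta>_def col_def)
  ultimately have "parity i (\<lambda>n. c (st (seg w 0 n)))"
    using parity_halve[of i "\<lambda>n. c (st (seg w 0 n))"] by simp
  then show ?thesis
    using parity_st[of w] parity_exclusive by (cases i; cases "csat \<phi> w") auto
qed

definition start :: "nat set \<times> nat list list" where
  "start = (residual P 0, st [])"

lemma transition_system_start:
  assumes "\<And>S q a. \<exists>b. \<delta> (S, q) a = (shift S, dl q (letter3 (fst b) (snd b) (0 \<in> S)))"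
  shows "transition_system (range (residual P) \<times> range st) start \<delta>"
  unfolding transition_system_def
proof (intro conjI ballI allI)
  fix v a assume "v \<in> range (residual P) \<times> range st"
  then obtain t u where "v = (residual P t, st u)"
    by auto
  then obtain b where "\<delta> v a = (residual P (Suc t), st (u @ [letter3 (fst b) (snd b) (t \<in> P)]))"
    using assms[of "residual P t" "st u" a] by (auto simp: shift_residual dl_st)
  then show "\<delta> v a \<in> range (residual P) \<times> range st"
    by auto
qed (auto simp: start_def finite_residuals finite_states)

text \<open>The machine keeps track of the node at which \<open>X\<close> is to move and answers the
  current letter of \<open>X\<close> as \<open>\<sigma>\<close> does; the bit of \<open>P\<close> is
  read off the residual.\<close>

lemma mealy_solution:
  assumes win: "wins V True W \<sigma>" and init: "(residual P 0, st [], None) \<in> W"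
  shows "\<exists>n q0 \<delta> out F. mealy {..<n :: nat} q0 \<delta> out F \<and> (\<forall>X. csat \<phi> (word3 X (apply2 F X P) P))"
proof -
  define ch where "ch S q x = (SOME y. \<sigma> (S, q, Some x) = (shift S, dl q (letter3 x y (0 \<in> S)), None))" for S q x
  have ch: "\<sigma> (S, q, Some x) = (shift S, dl q (letter3 x (ch S q x) (0 \<in> S)), None)"
    if "(S, q, Some x) \<in> W" for S q x
  proof -
    have "move (S, q, Some x) (\<sigma> (S, q, Some x))"
      using wins_own[OF win that] by (simp add: own_def)
    then show ?thesis
      unfolding ch_def move.simps by (rule someI_ex)
  qed
  define \<delta> where "\<delta> = (\<lambda>(S, q) (x, p :: bool). (shift S, dl q (letter3 x (ch S q x) (0 \<in> S))))"
  define out where "out = (\<lambda>(S, q) (x, p :: bool). ch S q x)"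
  have \<delta>: "\<delta> (S, q) (x, p) = (shift S, dl q (letter3 x (ch S q x) (0 \<in> S)))" for S q x p
    by (simp add: \<delta>_def)
  have out: "out (S, q) (x, p) = ch S q x" for S q x p
    by (simp add: out_def)
  define F where "F a i = out (state_after \<delta> start a i) (a i)" for a i
  have "transition_system (range (residual P) \<times> range st) start \<delta>"
    by (rule transition_system_start) (force simp: \<delta>_def)
  then have "mealy (range (residual P) \<times> range st) start \<delta> out F"
    by (simp add: mealy_def F_def)
  moreover have "csat \<phi> (word3 X (apply2 F X P) P)" for X
  proof -
    let ?a = "\<lambda>s. (s \<in> X, s \<in> P)" and ?w = "word3 X (apply2 F X P) P"
    have w: "?w t = letter3 (t \<in> X) (F ?a t) (t \<in> P)" for t
      by (simp add: word3_def apply2_def)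
    have state: "state_after \<delta> start ?a t = (residual P t, st (seg ?w 0 t))" for t
    proof (induction t)
      case 0
      then show ?case
        by (simp add: start_def)
    next
      case (Suc t)
      have "F ?a t = ch (residual P t) (st (seg ?w 0 t)) (t \<in> X)"
        by (subst F_def) (simp add: Suc out)
      then show ?case
        by (simp add: Suc \<delta> shift_residual seg_Suc dl_st w[of t])
    qed
    have F: "F ?a t = ch (residual P t) (st (seg ?w 0 t)) (t \<in> X)" for t
      by (subst F_def) (simp add: state out)
    \<comment> \<open>\<open>ch\<close> is known to agree with \<open>\<sigma>\<close> only inside
      \<open>W\<close>, so it must first be seen that the run stays there.\<close>
    have mem: "(residual P t, st (seg ?w 0 t), None) \<in> W" for t
    proof (induction t)
      case 0
      then show ?case using init by simp
    next
      case (Suc t)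
      have "(residual P t, st (seg ?w 0 t), Some (t \<in> X)) \<in> W"
        using wins_other[OF win Suc, of "(residual P t, st (seg ?w 0 t), Some (t \<in> X))"]
        by (simp add: own_def V_def)
      from ch[OF this] wins_own[OF win this] show ?case
        by (simp add: own_def shift_residual seg_Suc w[of t] F dl_st)
    qed
    have mem': "(residual P t, st (seg ?w 0 t), Some (t \<in> X)) \<in> W" for t
      using wins_other[OF win mem, of t "(residual P t, st (seg ?w 0 t), Some (t \<in> X))"]
      by (simp add: own_def V_def)
    have "\<sigma> (residual P t, st (seg ?w 0 t), Some (t \<in> X)) =
        (residual P (Suc t), st (seg ?w 0 (Suc t)), None)" for t
      using ch[OF mem'[of t]] by (simp add: shift_residual seg_Suc w[of t] F dl_st)
    then have "csat \<phi> ?w = True"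
      by (intro play_outcome[OF win init w]) simp_all
    then show ?thesis
      by simp
  qed
  ultimately show ?thesis
    using mealy_rename by metis
qed

text \<open>This player moves at the nodes with \<open>None\<close>, before the letter of
  \<open>Y\<close> is known; hence the output depends on the state alone.\<close>

lemma moore_solution:
  assumes win: "wins V False W \<sigma>" and init: "(residual P 0, st [], None) \<in> W"
  shows "\<exists>n q0 \<delta> out G. moore {..<n :: nat} q0 \<delta> out G \<and> (\<forall>Y. \<not> csat \<phi> (word3 (apply2 G Y P) Y P))"
proof -
  define ch where "ch S q = (SOME x. \<sigma> (S, q, None) = (S, q, Some x))" for S q
  have ch: "\<sigma> (S, q, None) = (S, q, Some (ch S q))" if "(S, q, None) \<in> W" for S q
  proof -
    have "move (S, q, None) (\<sigma> (S, q, None))"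
      using wins_own[OF win that] by (simp add: own_def)
    then show ?thesis
      unfolding ch_def move.simps by (rule someI_ex)
  qed
  define \<delta> where "\<delta> = (\<lambda>(S, q) (y, p :: bool). (shift S, dl q (letter3 (ch S q) y (0 \<in> S))))"
  define out where "out = (\<lambda>(S, q). ch S q)"
  have \<delta>: "\<delta> (S, q) (y, p) = (shift S, dl q (letter3 (ch S q) y (0 \<in> S)))" for S q y p
    by (simp add: \<delta>_def)
  have out: "out (S, q) = ch S q" for S q
    by (simp add: out_def)
  define G where "G a i = out (state_after \<delta> start a i)" for a i
  have "transition_system (range (residual P) \<times> range st) start \<delta>"
    by (rule transition_system_start) (force simp: \<delta>_def)
  then have "moore (range (residual P) \<times> range st) start \<delta> out G"
    by (simp add: moore_def G_def)
  moreover have "\<not> csat \<phi> (word3 (apply2 G Y P) Y P)" for Y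
  proof -
    let ?a = "\<lambda>s. (s \<in> Y, s \<in> P)" and ?w = "word3 (apply2 G Y P) Y P"
    have w: "?w t = letter3 (G ?a t) (t \<in> Y) (t \<in> P)" for t
      by (simp add: word3_def apply2_def)
    have state: "state_after \<delta> start ?a t = (residual P t, st (seg ?w 0 t))" for t
    proof (induction t)
      case 0
      then show ?case
        by (simp add: start_def)
    next
      case (Suc t)
      have "G ?a t = ch (residual P t) (st (seg ?w 0 t))"
        by (subst G_def) (simp add: Suc out)
      then show ?case
        by (simp add: Suc \<delta> shift_residual seg_Suc dl_st w[of t])
    qed
    have G: "G ?a t = ch (residual P t) (st (seg ?w 0 t))" for t
      by (subst G_def) (simp add: state out)
    have mem: "(residual P t, st (seg ?w 0 t), None) \<in> W" for t
    proof (induction t)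
      case 0
      then show ?case using init by simp
    next
      case (Suc t)
      have "(residual P t, st (seg ?w 0 t), Some (G ?a t)) \<in> W"
        using ch[OF Suc] wins_own[OF win Suc] by (simp add: own_def G)
      from wins_other[OF win this, of "(residual P (Suc t), st (seg ?w 0 (Suc t)), None)"] show ?case
        by (auto simp: own_def V_def shift_residual seg_Suc w[of t] dl_st)
    qed
    have "csat \<phi> ?w = False"
      by (rule play_outcome[OF win init w]) (use ch[OF mem] in \<open>simp_all add: G\<close>)
    then show ?thesis
      by simp
  qed
  ultimately show ?thesis
    using moore_rename by metis
qed

end

theorem synthesis_dichotomy:
  assumes "ultimately_periodic P"
  shows "(\<exists>n q0 \<delta> out F. mealy {..<n :: nat} q0 \<delta> out F \<and> (\<forall>X. csat \<phi> (word3 X (apply2 F X P) P))) \<or>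
    (\<exists>n q0 \<delta> out G. moore {..<n :: nat} q0 \<delta> out G \<and> (\<forall>Y. \<not> csat \<phi> (word3 (apply2 G Y P) Y P)))"
proof -
  interpret recognised "tp \<phi>" "csat \<phi>"
    by (rule recognised_csat)
  obtain st :: "letter list \<Rightarrow> nat list list" and c where st: "finite (range st)"
    "\<And>u u' a. st u = st u' \<Longrightarrow> st (u @ [a]) = st (u' @ [a])"
    "\<And>w. parity (csat \<phi> w) (\<lambda>t. c (st (seg w 0 t)))"
    using parity_automaton by blast
  interpret synthesis_game P \<phi> st c
    by unfold_locales (use st finite_residuals[OF assms] in blast)+
  obtain W \<sigma> where W: "(\<Union>i. W i) = V" "\<forall>i. wins V i (W i) (\<sigma> i)"
    using positional_determinacy[OF finite_V V_total] by blast
  have "(residual P 0, st [], None) \<in> V"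
    by (simp add: V_def)
  then obtain i where "(residual P 0, st [], None) \<in> W i"
    using W(1) by blast
  then show ?thesis
    using W(2) mealy_solution[of "W True" "\<sigma> True"] moore_solution[of "W False" "\<sigma> False"]
    by (cases i) auto
qed

section \<open>Predicting the parameter\<close>

definition predict_next :: mlo where
  "predict_next = Neg (ExI 0 (ExI 1 (Conj
     (Conj (Less 0 1) (Neg (ExI 2 (Conj (Less 0 2) (Less 2 1)))))
     (Conj (Neg (Conj (Mem 0 1) (Mem 1 2))) (Neg (Conj (Neg (Mem 0 1)) (Neg (Mem 1 2))))))))"

lemma formula_predict_next: "formula_XYP predict_next"
  by (auto simp: formula_XYP_def predict_next_def)

lemma holds_predict_next: "holds predict_next X Y P \<longleftrightarrow> (\<forall>t. t \<in> Y \<longleftrightarrow> Suc t \<in> P)"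
proof -
  have succ: "s < t \<and> \<not> (\<exists>r. s < r \<and> r < t) \<longleftrightarrow> t = Suc s" for s t :: nat
  proof
    assume *: "s < t \<and> \<not> (\<exists>r. s < r \<and> r < t)"
    then have "\<not> Suc s < t"
      by blast
    then show "t = Suc s"
      using * by simp
  qed auto
  have "holds predict_next X Y P \<longleftrightarrow> \<not> (\<exists>s t. (s < t \<and> \<not> (\<exists>r. s < r \<and> r < t)) \<and>
      (\<not> (s \<in> Y \<and> t \<in> P) \<and> \<not> (s \<notin> Y \<and> t \<notin> P)))"
    unfolding holds_def predict_next_def by simp
  then show ?thesis
    unfolding succ by auto
qed

text \<open>On the input \<open>X = {}\<close> the pair of state and current bit of \<open>P\<close>
  determines the next such pair, as the output is the next bit. The period is the distance between
  two occurrences of one pair.\<close>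

lemma ultimately_periodic_if_predicted:
  assumes F: "finite_state_C F" and holds: "holds predict_next {} (apply2 F {} P) P"
  shows "ultimately_periodic P"
proof -
  obtain Q :: "nat set" and q0 \<delta> out where F: "mealy Q q0 \<delta> out F"
    using F unfolding finite_state_C_def by blast
  let ?a = "\<lambda>s. (s \<in> ({} :: nat set), s \<in> P)"
  define c where "c t = (state_after \<delta> q0 ?a t, t \<in> P)" for t
  have ts: "transition_system Q q0 \<delta>"
    using F by (simp add: mealy_def)
  have next_P: "Suc t \<in> P \<longleftrightarrow> out (fst (c t)) (False, snd (c t))" for t
    using holds F by (auto simp: holds_predict_next apply2_def mealy_def c_def)
  have step: "c (Suc s) = c (Suc t)" if "c s = c t" for s t
    using that next_P[of s] next_P[of t] by (simp add: c_def)
  have "range c \<subseteq> Q \<times> UNIV"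
    using state_after_in[OF ts] by (auto simp: c_def)
  then have "finite (range c)"
    by (rule finite_subset) (use ts in \<open>simp add: transition_system_def\<close>)
  then have "\<not> inj c"
    using finite_imageD infinite_UNIV_nat by blast
  then obtain i j where ij: "i < j" "c i = c j"
    unfolding inj_def by (metis linorder_neqE_nat)
  have shift: "c (i + k) = c (j + k)" for k
  proof (induction k)
    case 0
    then show ?case using ij(2) by simp
  next
    case (Suc k)
    then show ?case using step[of "i + k" "j + k"] by simp
  qed
  have "n \<in> P \<longleftrightarrow> n + (j - i) \<in> P" if "n > i" for n
  proof -
    have "i + (n - i) = n" "j + (n - i) = n + (j - i)"
      using that ij(1) by simp_all
    then have "c n = c (n + (j - i))"
      using shift[of "n - i"] by simp
    then show ?thesis
      by (simp add: c_def)
  qed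
  then have "\<forall>n>i. n \<in> P \<longleftrightarrow> n + (j - i) \<in> P"
    by blast
  moreover have "j - i > 0"
    using ij(1) by simp
  ultimately show ?thesis
    unfolding ultimately_periodic_def by blast
qed

section \<open>Computable functions on encoded data\<close>

lemma computable_comp: "computable f \<Longrightarrow> computable g \<Longrightarrow> computable (\<lambda>n. f (g n))"
  unfolding computable_def by (drule (1) partial_recursive.comp) simp

lemma computable_pair: "computable f \<Longrightarrow> computable g \<Longrightarrow> computable (\<lambda>n. prod_encode (f n, g n))"
  unfolding computable_def by (drule (1) partial_recursive.pair) simp

lemma computable_fst: "computable (\<lambda>n. fst (prod_decode n))"
  and computable_snd: "computable (\<lambda>n. snd (prod_decode n))"
  and computable_Suc: "computable Suc"
  unfolding computable_def by (rule partial_recursive.intros)+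

lemma computable_id: "computable (\<lambda>n. n)"
  using computable_pair[OF computable_fst computable_snd] by simp

lemma computable_const: "computable (\<lambda>_. k)"
proof (induction k)
  case 0
  then show ?case
    unfolding computable_def by (rule partial_recursive.zero)
next
  case (Suc k)
  then show ?case
    using computable_comp[OF computable_Suc] by simp
qed

lemma computable_rec:
  assumes f: "computable f" and g: "computable g"
  shows "computable (\<lambda>n. rec_nat (f (fst (prod_decode n)))
    (\<lambda>k r. g (prod_encode (fst (prod_decode n), prod_encode (k, r)))) (snd (prod_decode n)))"
proof -
  have "rec_nat (Some (f a)) (\<lambda>k r. Option.bind r (\<lambda>b. Some (g (prod_encode (a, prod_encode (k, b)))))) m =
      Some (rec_nat (f a) (\<lambda>k r. g (prod_encode (a, prod_encode (k, r)))) m)" for a m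
    by (induction m) auto
  then show ?thesis
    using partial_recursive.prim_rec[OF f[unfolded computable_def] g[unfolded computable_def]]
    by (simp add: computable_def case_prod_unfold)
qed

lemma computable_Least:
  assumes f: "computable f" and ex: "\<And>a. \<exists>n. f (prod_encode (a, n)) = 0"
  shows "computable (\<lambda>a. LEAST n. f (prod_encode (a, n)) = 0)"
proof -
  have "minimize (\<lambda>n. Some (f (prod_encode (a, n)))) = Some (LEAST n. f (prod_encode (a, n)) = 0)" for a
  proof -
    have "f (prod_encode (a, LEAST n. f (prod_encode (a, n)) = 0)) = 0"
      using ex[of a] by (rule LeastI_ex)
    moreover have "\<exists>k. f (prod_encode (a, m)) = Suc k" if "m < (LEAST n. f (prod_encode (a, n)) = 0)" for m
      using not_less_Least[OF that] by (rule not0_implies_Suc)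
    ultimately have "\<exists>n. f (prod_encode (a, n)) = 0 \<and> (\<forall>m<n. \<exists>k. f (prod_encode (a, m)) = Suc k)"
      by blast
    then show ?thesis
      by (simp add: minimize_def)
  qed
  then show ?thesis
    using partial_recursive.minimization[OF f[unfolded computable_def]] by (simp add: computable_def)
qed

text \<open>Codes are required to be onto the natural numbers, so that \<open>dec\<close> is a total
  inverse and invalid codes do not arise.\<close>

class encodable =
  fixes enc :: "'a \<Rightarrow> nat"
  assumes bij_enc: "bij enc"

definition dec :: "nat \<Rightarrow> 'a::encodable" where
  "dec = inv enc"

lemma dec_enc [simp]: "dec (enc x) = x"
  unfolding dec_def by (rule inv_f_f[OF bij_is_inj[OF bij_enc]])

lemma enc_dec [simp]: "enc (dec n) = n"
  unfolding dec_def by (rule surj_f_inv_f[OF bij_is_surj[OF bij_enc]])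

lemma enc_eq_iff: "enc x = enc y \<longleftrightarrow> x = y"
  by (metis dec_enc)

instantiation nat :: encodable
begin

definition enc_nat :: "nat \<Rightarrow> nat" where "enc_nat n = n"

instance
  by standard (simp add: enc_nat_def[abs_def] bij_id[unfolded id_def])

end

instantiation prod :: (encodable, encodable) encodable
begin

definition enc_prod :: "'a \<times> 'b \<Rightarrow> nat" where
  "enc_prod z = prod_encode (enc (fst z), enc (snd z))"

instance
proof
  show "bij (enc :: 'a \<times> 'b \<Rightarrow> nat)"
    by (rule bij_betw_byWitness[where f' = "\<lambda>n. (dec (fst (prod_decode n)), dec (snd (prod_decode n)))"])
       (auto simp: enc_prod_def)
qed

end

instantiation list :: (encodable) encodable
begin

definition enc_list :: "'a list \<Rightarrow> nat" where
  "enc_list xs = list_encode (map enc xs)"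

instance
proof
  show "bij (enc :: 'a list \<Rightarrow> nat)"
    by (rule bij_betw_byWitness[where f' = "\<lambda>n. map dec (list_decode n)"])
       (auto simp: enc_list_def comp_def)
qed

end

lemma dec_nat [simp]: "dec n = (n :: nat)"
  using enc_dec[of n, where ?'a = nat] by (simp add: enc_nat_def)

lemma dec_prod: "dec n = (dec (fst (prod_decode n)) :: 'a::encodable, dec (snd (prod_decode n)) :: 'b::encodable)"
proof -
  have "enc (dec (fst (prod_decode n)) :: 'a, dec (snd (prod_decode n)) :: 'b) = n"
    by (simp add: enc_prod_def)
  then show ?thesis
    by (metis dec_enc)
qed

lemma enc_Nil [simp]: "enc [] = 0"
  and enc_Cons [simp]: "enc (x # xs) = Suc (prod_encode (enc x, enc xs))"
  by (simp_all add: enc_list_def)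

lemma length_le_enc: "length xs \<le> enc (xs :: 'a::encodable list)"
proof (induction xs)
  case (Cons x xs)
  then show ?case
    using le_prod_encode_2[of "enc xs" "enc x"] by simp
qed simp

section \<open>Closure properties of effective functions and decidable predicates\<close>

definition effective :: "('a::encodable \<Rightarrow> 'b::encodable) \<Rightarrow> bool" where
  "effective f \<longleftrightarrow> computable (\<lambda>n. enc (f (dec n)))"

definition decidable :: "('a::encodable \<Rightarrow> bool) \<Rightarrow> bool" where
  "decidable p \<longleftrightarrow> effective (\<lambda>x. of_bool (p x) :: nat)"

lemma effective_comp: "effective f \<Longrightarrow> effective g \<Longrightarrow> effective (\<lambda>x. f (g x))"
  unfolding effective_def
  using computable_comp[of "\<lambda>n. enc (f (dec n))" "\<lambda>n. enc (g (dec n))"] by simp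

lemma effective_id: "effective (\<lambda>x. x)"
  unfolding effective_def by (simp add: computable_id)

lemma effective_const: "effective (\<lambda>_. c)"
  unfolding effective_def by (rule computable_const)

lemma effective_fst: "effective f \<Longrightarrow> effective (\<lambda>x. fst (f x))"
proof (rule effective_comp[of fst])
  show "effective (fst :: 'b \<times> 'c \<Rightarrow> 'b)"
    unfolding effective_def by (simp add: dec_prod computable_fst)
qed

lemma effective_snd: "effective f \<Longrightarrow> effective (\<lambda>x. snd (f x))"
proof (rule effective_comp[of snd])
  show "effective (snd :: 'b \<times> 'c \<Rightarrow> 'c)"
    unfolding effective_def by (simp add: dec_prod computable_snd)
qed

lemma effective_Pair: "effective f \<Longrightarrow> effective g \<Longrightarrow> effective (\<lambda>x. (f x, g x))"
  unfolding effective_def enc_prod_def using computable_pair by simp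

text \<open>Functions of several arguments are uncurried over nested pairs throughout. The first
  component often carries an outer variable, so that the closure rules also apply below a
  lambda.\<close>

lemma effective_comp2:
  assumes "effective (\<lambda>z. f (fst z) (snd z))" "effective a" "effective b"
  shows "effective (\<lambda>x. f (a x) (b x))"
  using effective_comp[OF assms(1) effective_Pair[OF assms(2,3)]] by simp

lemma effective_comp3:
  assumes "effective (\<lambda>z. f (fst z) (fst (snd z)) (snd (snd z)))" "effective a" "effective b" "effective c"
  shows "effective (\<lambda>x. f (a x) (b x) (c x))"
  using effective_comp[OF assms(1) effective_Pair[OF assms(2) effective_Pair[OF assms(3,4)]]] by simp

lemma effective_Suc: "effective f \<Longrightarrow> effective (\<lambda>x. Suc (f x))"
proof (rule effective_comp[of Suc])
  show "effective Suc"
    unfolding effective_def by (simp add: enc_nat_def computable_Suc)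
qed

lemma effective_enc: "effective f \<Longrightarrow> effective (\<lambda>x. enc (f x))"
  unfolding effective_def by (simp add: enc_nat_def)

lemma effective_dec: "effective f \<Longrightarrow> effective (\<lambda>x. dec (f x))"
  unfolding effective_def by (simp add: enc_nat_def)

lemma effective_prod_decode: "effective f \<Longrightarrow> effective (\<lambda>x. prod_decode (f x))"
proof (rule effective_comp[of prod_decode])
  show "effective prod_decode"
    unfolding effective_def by (simp add: enc_prod_def enc_nat_def computable_id)
qed

lemma effective_rec_nat:
  assumes a: "effective a" and g: "effective (\<lambda>z. g (fst z) (fst (snd z)) (snd (snd z)))"
    and m: "effective m"
  shows "effective (\<lambda>x. rec_nat (a x) (g x) (m x))"
proof -
  let ?G = "\<lambda>n. enc (g (dec (fst (prod_decode n))) (fst (prod_decode (snd (prod_decode n))))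
      (dec (snd (prod_decode (snd (prod_decode n))))))"
  have "computable ?G"
    using g unfolding effective_def by (simp add: dec_prod)
  then have "computable (\<lambda>n. rec_nat (enc (a (dec (fst (prod_decode n)))))
      (\<lambda>k r. ?G (prod_encode (fst (prod_decode n), prod_encode (k, r)))) (snd (prod_decode n)))"
    using a unfolding effective_def by (rule computable_rec[rotated])
  moreover have "rec_nat (enc (a (dec l))) (\<lambda>k r. ?G (prod_encode (l, prod_encode (k, r)))) i =
      enc (rec_nat (a (dec l)) (g (dec l)) i)" for l i
    by (induction i) simp_all
  ultimately have "computable (\<lambda>n. enc (rec_nat (a (dec (fst (prod_decode n))))
      (g (dec (fst (prod_decode n)))) (snd (prod_decode n))))"
    by (simp only:)
  then have "effective (\<lambda>z. rec_nat (a (fst z)) (g (fst z)) (snd z))"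
    unfolding effective_def by (simp add: dec_prod)
  from effective_comp2[OF this effective_id m] show ?thesis .
qed

lemma effective_if: 
  assumes "decidable p" "effective f" "effective g"
  shows "effective (\<lambda>x. if p x then f x else g x)"
proof -
  have "effective (\<lambda>x. rec_nat (g x) (\<lambda>_ _. f x) (of_bool (p x)))"
    using assms(1) unfolding decidable_def
    by (intro effective_rec_nat effective_comp[OF assms(2)] effective_comp[OF assms(3)]
        effective_fst effective_id)
  moreover have "(\<lambda>x. rec_nat (g x) (\<lambda>_ _. f x) (of_bool (p x))) = (\<lambda>x. if p x then f x else g x)"
    by auto
  ultimately show ?thesis
    by simp
qed

lemma decidable_True: "decidable (\<lambda>_. c)"
  unfolding decidable_def by (rule effective_const)

lemma decidable_if:
  assumes "decidable p" "decidable q" "decidable r"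
  shows "decidable (\<lambda>x. if p x then q x else r x)"
proof -
  have "(\<lambda>x. of_bool (if p x then q x else r x) :: nat) = (\<lambda>x. if p x then of_bool (q x) else of_bool (r x))"
    by auto
  then show ?thesis
    using effective_if[OF assms(1), of "\<lambda>x. of_bool (q x) :: nat"] assms(2,3) unfolding decidable_def
    by simp
qed

lemma decidable_not: "decidable p \<Longrightarrow> decidable (\<lambda>x. \<not> p x)"
proof -
  have eq: "(\<lambda>x. if p x then False else True) = (\<lambda>x. \<not> p x)"
    by auto
  show "decidable p \<Longrightarrow> decidable (\<lambda>x. \<not> p x)"
    unfolding eq[symmetric] by (intro decidable_if decidable_True)
qed

lemma decidable_conj: "decidable p \<Longrightarrow> decidable q \<Longrightarrow> decidable (\<lambda>x. p x \<and> q x)"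
proof -
  have eq: "(\<lambda>x. if p x then q x else False) = (\<lambda>x. p x \<and> q x)"
    by auto
  show "decidable p \<Longrightarrow> decidable q \<Longrightarrow> decidable (\<lambda>x. p x \<and> q x)"
    unfolding eq[symmetric] by (intro decidable_if decidable_True)
qed

lemma decidable_disj: "decidable p \<Longrightarrow> decidable q \<Longrightarrow> decidable (\<lambda>x. p x \<or> q x)"
proof -
  have eq: "(\<lambda>x. if p x then True else q x) = (\<lambda>x. p x \<or> q x)"
    by auto
  show "decidable p \<Longrightarrow> decidable q \<Longrightarrow> decidable (\<lambda>x. p x \<or> q x)"
    unfolding eq[symmetric] by (intro decidable_if decidable_True)
qed

lemma decidable_imp: "decidable p \<Longrightarrow> decidable q \<Longrightarrow> decidable (\<lambda>x. p x \<longrightarrow> q x)"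
  unfolding imp_conv_disj by (intro decidable_disj decidable_not)

lemma decidable_iff: "decidable p \<Longrightarrow> decidable q \<Longrightarrow> decidable (\<lambda>x. p x = q x)"
  unfolding iff_conv_conj_imp by (intro decidable_conj decidable_imp)

lemma effective_of_bool: "decidable p \<Longrightarrow> effective (\<lambda>x. of_bool (p x) :: nat)"
  by (simp add: decidable_def)

lemma decidable_0: "effective f \<Longrightarrow> decidable (\<lambda>x. f x = (0 :: nat))"
proof -
  assume "effective f"
  then have "effective (\<lambda>x. rec_nat (1 :: nat) (\<lambda>_ _. 0) (f x))"
    by (intro effective_rec_nat effective_const)
  moreover have "rec_nat (1 :: nat) (\<lambda>_ _. 0) n = of_bool (n = 0)" for n
    by (cases n) auto
  ultimately show ?thesis
    by (simp add: decidable_def)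
qed

lemma effective_add: "effective f \<Longrightarrow> effective g \<Longrightarrow> effective (\<lambda>x. f x + g x :: nat)"
proof -
  assume "effective f" "effective g"
  then have "effective (\<lambda>x. rec_nat (f x) (\<lambda>_ r. Suc r) (g x))"
    by (intro effective_rec_nat effective_Suc effective_snd effective_id)
  moreover have "rec_nat m (\<lambda>_ r. Suc r) n = m + n" for m n
    by (induction n) auto
  ultimately show ?thesis
    by simp
qed

lemma effective_mult: "effective f \<Longrightarrow> effective g \<Longrightarrow> effective (\<lambda>x. f x * g x :: nat)"
proof -
  assume f: "effective f" and "effective g"
  then have "effective (\<lambda>x. rec_nat 0 (\<lambda>_ r. r + f x) (g x))"
    by (intro effective_rec_nat effective_add effective_snd effective_fst effective_id effective_const
        effective_comp[OF f])
  moreover have "rec_nat 0 (\<lambda>_ r. r + m) n = m * n" for m n :: nat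
    by (induction n) auto
  ultimately show ?thesis
    by simp
qed

lemma effective_diff: "effective f \<Longrightarrow> effective g \<Longrightarrow> effective (\<lambda>x. f x - g x :: nat)"
proof -
  assume "effective f" "effective g"
  then have "effective (\<lambda>x. rec_nat (f x) (\<lambda>_ r. rec_nat 0 (\<lambda>k _. k) r) (g x))"
    by (intro effective_rec_nat effective_snd effective_fst effective_id effective_const)
  moreover have "rec_nat 0 (\<lambda>k _. k) n = n - 1" for n :: nat
    by (cases n) auto
  moreover have "rec_nat m (\<lambda>_ r. r - 1) n = m - n" for m n :: nat
    by (induction n) auto
  ultimately show ?thesis
    by simp
qed

lemma decidable_le: "effective f \<Longrightarrow> effective g \<Longrightarrow> decidable (\<lambda>x. f x \<le> (g x :: nat))"
  using decidable_0[OF effective_diff[of f g]] by simp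

lemma decidable_less: "effective f \<Longrightarrow> effective g \<Longrightarrow> decidable (\<lambda>x. f x < (g x :: nat))"
  using decidable_le[OF effective_Suc, of f g] by (simp add: Suc_le_eq)

lemma decidable_eq: "effective f \<Longrightarrow> effective g \<Longrightarrow> decidable (\<lambda>x. f x = g x)"
  using decidable_conj[OF decidable_le[OF effective_enc effective_enc, of f g]
      decidable_le[OF effective_enc effective_enc, of g f]]
  by (simp add: eq_iff[symmetric] enc_eq_iff)

lemma effective_Cons: "effective f \<Longrightarrow> effective g \<Longrightarrow> effective (\<lambda>x. f x # g x)"
  unfolding effective_def enc_Cons by (intro computable_comp[OF computable_Suc] computable_pair)

lemma effective_case_list:
  assumes "effective l" "effective a" "effective (\<lambda>z. b (fst z) (fst (snd z)) (snd (snd z)))"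
  shows "effective (\<lambda>x. case l x of [] \<Rightarrow> a x | y # ys \<Rightarrow> b x y ys)"
proof -
  have "effective (\<lambda>x. if enc (l x) = 0 then a x
      else b x (dec (fst (prod_decode (enc (l x) - 1)))) (dec (snd (prod_decode (enc (l x) - 1)))))"
    using assms(1,2)
    by (intro effective_if decidable_0 effective_comp3[OF assms(3)] effective_id effective_dec effective_enc
        effective_diff effective_const effective_fst effective_snd effective_prod_decode)
  moreover have "(if enc xs = 0 then a x
      else b x (dec (fst (prod_decode (enc xs - 1)))) (dec (snd (prod_decode (enc xs - 1))))) =
      (case xs of [] \<Rightarrow> a x | y # ys \<Rightarrow> b x y ys)" for x xs
    by (cases xs) auto
  ultimately show ?thesis
    by simp
qed

text \<open>The iterated state consists of the remaining list and the accumulator. The code of a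
  list bounds its length, and surplus rounds leave the state unchanged.\<close>

lemma effective_foldl:
  assumes g: "effective (\<lambda>z. g (fst z) (fst (snd z)) (snd (snd z)))" and a: "effective a" and l: "effective l"
  shows "effective (\<lambda>x. foldl (g x) (a x) (l x))"
proof -
  let ?step = "\<lambda>x s. case fst s of [] \<Rightarrow> s | y # ys \<Rightarrow> (ys, g x (snd s) y)"
  have "effective (\<lambda>x. snd (rec_nat (l x, a x) (\<lambda>_. ?step x) (enc (l x))))"
    by (intro effective_snd effective_rec_nat effective_Pair effective_case_list effective_comp3[OF g]
        effective_fst effective_id effective_enc l a)
  moreover have "rec_nat (xs, b) (\<lambda>_. ?step x) n = (drop n xs, foldl (g x) b (take n xs))" for x xs b n
  proof (induction n)
    case (Suc n)
    show ?case
    proof (cases "drop n xs")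
      case Nil
      then show ?thesis
        using Suc by simp
    next
      case (Cons y ys)
      then have "n < length xs"
        by (rule_tac ccontr) simp
      with Cons have "xs ! n = y" "drop (Suc n) xs = ys"
        using Cons_nth_drop_Suc[of n xs] by simp_all
      then show ?thesis
        using Suc Cons \<open>n < length xs\<close> by (simp add: take_Suc_conv_app_nth)
    qed
  qed simp
  ultimately show ?thesis
    by (simp add: length_le_enc)
qed

lemma effective_rev: "effective l \<Longrightarrow> effective (\<lambda>x. rev (l x))"
proof -
  assume "effective l"
  then have "effective (\<lambda>x. foldl (\<lambda>a y. y # a) [] (l x))"
    by (intro effective_foldl effective_Cons effective_fst effective_snd effective_id effective_const)
  moreover have "foldl (\<lambda>a y. y # a) ys xs = rev xs @ ys" for xs ys :: "'b list"
    by (induction xs arbitrary: ys) auto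
  ultimately show ?thesis
    by simp
qed

lemma effective_foldr:
  assumes g: "effective (\<lambda>z. g (fst z) (fst (snd z)) (snd (snd z)))" and a: "effective a" and l: "effective l"
  shows "effective (\<lambda>x. foldr (g x) (l x) (a x))"
proof -
  have "effective (\<lambda>x. foldl (\<lambda>r y. g x y r) (a x) (rev (l x)))"
    by (intro effective_foldl effective_comp3[OF g] effective_fst effective_snd effective_id effective_rev a l)
  then show ?thesis
    by (simp add: foldr_conv_foldl)
qed

lemma effective_map:
  assumes g: "effective (\<lambda>z. g (fst z) (snd z))" and l: "effective l"
  shows "effective (\<lambda>x. map (g x) (l x))"
proof -
  have "effective (\<lambda>x. foldr (\<lambda>y r. g x y # r) (l x) [])"
    by (intro effective_foldr effective_Cons effective_comp2[OF g] effective_fst effective_snd effective_id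
        effective_const l)
  moreover have "foldr (\<lambda>y r. f y # r) xs [] = map f xs" for f :: "'b \<Rightarrow> 'c" and xs
    by (induction xs) auto
  ultimately show ?thesis
    by simp
qed

lemma effective_filter:
  assumes p: "decidable (\<lambda>z. p (fst z) (snd z))" and l: "effective l"
  shows "effective (\<lambda>x. filter (p x) (l x))"
proof -
  have p': "decidable (\<lambda>z. p (fst z) (fst (snd z)))"
    using p unfolding decidable_def
    by (rule effective_comp2) (intro effective_fst effective_snd effective_id)+
  have "effective (\<lambda>x. foldr (\<lambda>y r. if p x y then y # r else r) (l x) [])"
    by (intro effective_foldr effective_if effective_Cons p' effective_fst effective_snd effective_id
        effective_const l)
  moreover have "foldr (\<lambda>y r. if q y then y # r else r) xs [] = filter q xs" for q :: "'b \<Rightarrow> bool" and xs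
    by (induction xs) auto
  ultimately show ?thesis
    by simp
qed

lemma effective_append: "effective f \<Longrightarrow> effective g \<Longrightarrow> effective (\<lambda>x. f x @ g x)"
proof -
  assume "effective f" "effective g"
  then have "effective (\<lambda>x. foldr (\<lambda>y r. y # r) (f x) (g x))"
    by (intro effective_foldr effective_Cons effective_fst effective_snd effective_id)
  moreover have "foldr (\<lambda>y r. y # r) xs ys = xs @ ys" for xs ys :: "'b list"
    by (induction xs) auto
  ultimately show ?thesis
    by simp
qed

lemma effective_concat: "effective f \<Longrightarrow> effective (\<lambda>x. concat (f x))"
proof -
  assume "effective f"
  then have "effective (\<lambda>x. foldr (\<lambda>y r. y @ r) (f x) [])"
    by (intro effective_foldr effective_append effective_fst effective_snd effective_id effective_const)
  moreover have "foldr (\<lambda>y r. y @ r) xs [] = concat xs" for xs :: "'b list list"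
    by (induction xs) auto
  ultimately show ?thesis
    by simp
qed

lemma effective_length: "effective f \<Longrightarrow> effective (\<lambda>x. length (f x))"
proof -
  assume "effective f"
  then have "effective (\<lambda>x. foldr (\<lambda>_ r. Suc r) (f x) 0)"
    by (intro effective_foldr effective_Suc effective_snd effective_id effective_const)
  moreover have "foldr (\<lambda>_ r. Suc r) xs 0 = length xs" for xs :: "'b list"
    by (induction xs) auto
  ultimately show ?thesis
    by simp
qed

lemma effective_drop: "effective f \<Longrightarrow> effective n \<Longrightarrow> effective (\<lambda>x. drop (n x) (f x))"
proof -
  assume "effective f" "effective n"
  then have "effective (\<lambda>x. rec_nat (f x) (\<lambda>_ r. case r of [] \<Rightarrow> [] | y # ys \<Rightarrow> ys) (n x))"
    by (intro effective_rec_nat effective_case_list effective_snd effective_id effective_const)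
  moreover have "rec_nat xs (\<lambda>_ r. case r of [] \<Rightarrow> [] | y # ys \<Rightarrow> ys) k = drop k xs" for xs :: "'b list" and k
    by (induction k) (auto simp: tl_drop drop_Suc tl_def[symmetric])
  ultimately show ?thesis
    by simp
qed

lemma effective_upt: "effective m \<Longrightarrow> effective n \<Longrightarrow> effective (\<lambda>x. [m x..<n x])"
proof -
  assume m: "effective m" and "effective n"
  then have "effective (\<lambda>x. rec_nat [] (\<lambda>k r. if m x \<le> k then r @ [k] else r) (n x))"
    by (intro effective_rec_nat effective_if decidable_le effective_append effective_Cons
        effective_comp[OF m] effective_fst effective_snd effective_id effective_const)
  moreover have "rec_nat [] (\<lambda>k r. if i \<le> k then r @ [k] else r) j = [i..<j]" for i j :: nat
    by (induction j) auto
  ultimately show ?thesis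
    by simp
qed

lemma decidable_Ball:
  assumes p: "decidable (\<lambda>z. p (fst z) (snd z))" and l: "effective l"
  shows "decidable (\<lambda>x. \<forall>y\<in>set (l x). p x y)"
proof -
  have "effective (\<lambda>x. filter (\<lambda>y. \<not> p x y) (l x))"
    by (intro effective_filter decidable_not p l)
  then have "decidable (\<lambda>x. filter (\<lambda>y. \<not> p x y) (l x) = [])"
    by (intro decidable_eq effective_const)
  then show ?thesis
    by (simp add: filter_empty_conv)
qed

lemma decidable_Bex:
  assumes p: "decidable (\<lambda>z. p (fst z) (snd z))" and l: "effective l"
  shows "decidable (\<lambda>x. \<exists>y\<in>set (l x). p x y)"
  using decidable_not[OF decidable_Ball[OF decidable_not[OF p] l]] by simp

lemma decidable_member: "effective f \<Longrightarrow> effective l \<Longrightarrow> decidable (\<lambda>x. f x \<in> set (l x))"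
proof -
  assume f: "effective f" and l: "effective l"
  have "decidable (\<lambda>x. \<exists>y\<in>set (l x). f x = y)"
    by (intro decidable_Bex decidable_eq effective_comp[OF f] effective_fst effective_snd effective_id l)
  then show ?thesis
    by simp
qed

lemma decidable_case_list:
  assumes "effective l" "decidable a" "decidable (\<lambda>z. b (fst z) (fst (snd z)) (snd (snd z)))"
  shows "decidable (\<lambda>x. case l x of [] \<Rightarrow> a x | y # ys \<Rightarrow> b x y ys)"
proof -
  have "effective (\<lambda>x. case l x of [] \<Rightarrow> of_bool (a x) :: nat | y # ys \<Rightarrow> of_bool (b x y ys))"
    using assms unfolding decidable_def by (intro effective_case_list)
  moreover have "of_bool (case xs of [] \<Rightarrow> c | y # ys \<Rightarrow> d y ys) =
      (case xs of [] \<Rightarrow> of_bool c :: nat | y # ys \<Rightarrow> of_bool (d y ys))" for xs :: "'b list" and c d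
    by (cases xs) auto
  ultimately show ?thesis
    by (simp add: decidable_def)
qed

lemma decidable_comp: "decidable p \<Longrightarrow> effective f \<Longrightarrow> decidable (\<lambda>x. p (f x))"
  unfolding decidable_def by (rule effective_comp)

lemmas effective_intros =
  effective_fst effective_snd effective_id effective_Pair effective_if effective_Suc effective_enc
  effective_prod_decode effective_add effective_mult effective_diff effective_Cons effective_case_list effective_foldl effective_foldr
  effective_map effective_filter effective_append effective_concat effective_length effective_drop
  effective_upt effective_rev effective_of_bool effective_rec_nat
  decidable_not decidable_conj decidable_disj decidable_imp decidable_iff decidable_le decidable_less
  decidable_eq decidable_Ball decidable_Bex decidable_member decidable_case_list decidable_if
  effective_const decidable_True

section \<open>Unbounded search and well-founded recursion\<close>

theorem effective_search:
  fixes p :: "'a::encodable \<Rightarrow> 'b::encodable \<Rightarrow> bool"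
  assumes p: "decidable (\<lambda>z. p (fst z) (snd z))" and ex: "\<And>x. \<exists>y. p x y"
  obtains f where "effective f" "\<And>x. p x (f x)"
proof -
  \<comment> \<open>The truth value is inverted because \<open>computable_Least\<close> looks for a
    zero.\<close>
  let ?q = "\<lambda>n. 1 - (of_bool (p (dec (fst (prod_decode n))) (dec (snd (prod_decode n)))) :: nat)"
  have q: "?q (prod_encode (n, m)) = 0 \<longleftrightarrow> p (dec n) (dec m)" for n m
    by simp
  have "effective (\<lambda>z. 1 - (of_bool (p (fst z) (snd z)) :: nat))"
    by (intro effective_diff effective_const effective_of_bool p)
  then have "computable ?q"
    unfolding effective_def by (simp add: dec_prod enc_nat_def)
  moreover have "\<exists>m. ?q (prod_encode (n, m)) = 0" for n
    unfolding q using ex[of "dec n"] by (metis dec_enc)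
  ultimately have "computable (\<lambda>n. LEAST m. ?q (prod_encode (n, m)) = 0)"
    by (rule computable_Least)
  then have "effective (\<lambda>x. dec (LEAST m. p x (dec m)) :: 'b)"
    unfolding effective_def q by simp
  moreover have "p x (dec (LEAST m. p x (dec m)))" for x
    by (rule LeastI_ex[of "\<lambda>m. p x (dec m)"]) (metis ex dec_enc)
  ultimately show thesis
    by (rule that)
qed

definition lookup :: "('a \<times> 'b::encodable) list \<Rightarrow> 'a \<Rightarrow> 'b" where
  "lookup D c = foldr (\<lambda>e r. if fst e = c then snd e else r) D (dec 0)"

lemma lookup_in: "c \<in> fst ` set D \<Longrightarrow> (c, lookup D c) \<in> set D"
  unfolding lookup_def by (induction D) auto

text \<open>A recursive function is evaluated by searching for a complete table of the calls it makes, in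
  which every entry precedes the entries it depends on.\<close>

theorem effective_wf_rec:
  fixes f :: "'a::encodable \<Rightarrow> 'b::encodable"
  assumes wf: "wf R" and less: "\<And>x c. c \<in> set (calls x) \<Longrightarrow> (c, x) \<in> R"
    and f: "\<And>x. f x = step x (map f (calls x))"
    and calls: "effective calls" and step: "effective (\<lambda>z. step (fst z) (snd z))"
  shows "effective f"
proof -
  define ok where "ok D \<longleftrightarrow> (\<forall>i\<in>set [0..<length D]. case drop i D of [] \<Rightarrow> True | e # D' \<Rightarrow>
      (\<forall>c\<in>set (calls (fst e)). \<exists>e'\<in>set D'. c = fst e') \<and>
      snd e = step (fst e) (map (lookup D') (calls (fst e))))" for D
  define starts where "starts x D \<longleftrightarrow> (case D of [] \<Rightarrow> False | e # D' \<Rightarrow> fst e = x)"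
    for x and D :: "('a \<times> 'b) list"
  have lookup: "effective (\<lambda>z. lookup (fst z) (snd z) :: 'b)"
    unfolding lookup_def by (intro effective_intros)
  have dec_ok: "decidable ok"
    unfolding ok_def[abs_def]
    by (intro effective_intros effective_comp[OF calls] effective_comp2[OF step] effective_comp2[OF lookup])
  have dec: "decidable (\<lambda>z. starts (fst z) (snd z) \<and> ok (snd z))"
    unfolding starts_def by (intro effective_intros decidable_comp[OF dec_ok])
  have ok_Nil: "ok []"
    by (simp add: ok_def)
  have upt: "set [0..<Suc n] = insert 0 (Suc ` set [0..<n])" for n
    by (simp add: atLeast0_lessThan_Suc_eq_insert_0 del: upt_Suc)
  have ok_Cons_step: "ok (e # D) \<longleftrightarrow> ((\<forall>c\<in>set (calls (fst e)). \<exists>e'\<in>set D. c = fst e') \<and>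
      snd e = step (fst e) (map (lookup D) (calls (fst e)))) \<and> ok D" for e D
    unfolding ok_def length_Cons upt by (simp only: ball_simps drop_0 drop_Suc_Cons list.case)
  have ok_correct: "\<forall>e\<in>set D. snd e = f (fst e)" if "ok D" for D
    using that
  proof (induction D)
    case (Cons e D)
    then have D: "\<forall>e\<in>set D. snd e = f (fst e)"
      and e: "\<forall>c\<in>set (calls (fst e)). \<exists>e'\<in>set D. c = fst e'"
        "snd e = step (fst e) (map (lookup D) (calls (fst e)))"
      by (simp_all add: ok_Cons_step)
    have "lookup D c = f c" if "c \<in> set (calls (fst e))" for c
    proof -
      have "c \<in> fst ` set D"
        using e(1) that by auto
      from lookup_in[OF this] show ?thesis
        using D by fastforce
    qed
    then have "map (lookup D) (calls (fst e)) = map f (calls (fst e))"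
      by simp
    then have "snd e = f (fst e)"
      using e(2) f[of "fst e"] by (simp only:)
    then show ?case
      using D by simp
  qed simp
  \<comment> \<open>\<open>lookup\<close> could give another result in a longer table; stated with
    the true values of \<open>f\<close>, correctness visibly survives appending tables.\<close>
  have ok_Cons: "ok (e # D) \<longleftrightarrow> (\<forall>c\<in>set (calls (fst e)). c \<in> fst ` set D) \<and> snd e = f (fst e) \<and> ok D" for e D
  proof (cases "ok D \<and> (\<forall>c\<in>set (calls (fst e)). c \<in> fst ` set D)")
    case True
    then have "lookup D c = f c" if "c \<in> set (calls (fst e))" for c
      using that ok_correct[of D] lookup_in[of c D] by fastforce
    then have "map (lookup D) (calls (fst e)) = map f (calls (fst e))"
      by simp
    then have eq: "step (fst e) (map (lookup D) (calls (fst e))) = f (fst e)"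
      using f[of "fst e"] by (simp only:)
    show ?thesis
      using True unfolding ok_Cons_step eq by (auto simp: image_iff)
  next
    case False
    then show ?thesis
      by (auto simp: ok_Cons_step image_iff)
  qed
  have ok_append: "ok (D @ D')" if "ok D" "ok D'" for D D'
    using that by (induction D) (auto simp: ok_Cons)
  have "\<exists>D. starts x D \<and> ok D" for x
    using wf
  proof (induction x rule: wf_induct_rule)
    case (less x)
    have "\<exists>D. ok D \<and> set cs \<subseteq> fst ` set D" if "set cs \<subseteq> set (calls x)" for cs
      using that
    proof (induction cs)
      case Nil
      then show ?case
        using ok_Nil by auto
    next
      case (Cons c cs)
      then obtain D where D: "ok D" "set cs \<subseteq> fst ` set D"
        by auto
      obtain D' where D': "starts c D'" "ok D'"
        using less assms(2)[of c x] Cons.prems by auto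
      have "c \<in> fst ` set D'"
        using D'(1) by (cases D') (auto simp: starts_def)
      then show ?case
        using ok_append[OF D(1) D'(2)] D(2) by (intro exI[of _ "D @ D'"]) auto
    qed
    then obtain D where "ok D" "set (calls x) \<subseteq> fst ` set D"
      by blast
    then have "ok ((x, f x) # D)"
      by (auto simp: ok_Cons)
    then show ?case
      by (intro exI[of _ "(x, f x) # D"]) (simp add: starts_def)
  qed
  then obtain T where T: "effective T" "\<And>x. starts x (T x) \<and> ok (T x)"
    using effective_search[OF dec] by blast
  have "effective (\<lambda>x. case T x of [] \<Rightarrow> dec 0 | e # D \<Rightarrow> snd e)"
    by (intro effective_intros T(1))
  moreover have "(case T x of [] \<Rightarrow> dec 0 | e # D \<Rightarrow> snd e) = f x" for x
    using T(2)[of x] ok_correct[of "T x"] by (cases "T x") (auto simp: starts_def)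
  ultimately show ?thesis
    by simp
qed

section \<open>Deciding ultimately periodic words\<close>

text \<open>A linked pair as in the theory of omega-semigroups: the type of \<open>v\<close> is
  idempotent and absorbed by that of \<open>u\<close>.\<close>

definition linked :: "core \<Rightarrow> letter list \<Rightarrow> letter list \<Rightarrow> bool" where
  "linked \<phi> u v \<longleftrightarrow> tp \<phi> (u @ v) = tp \<phi> u \<and> tp \<phi> (v @ v) = tp \<phi> v"

text \<open>Truth in the word \<open>u v v v \<dots>\<close> for linked \<open>u\<close> and \<open>v\<close>; the words need not be pumped in the
  case of a quantifier because linked words have the same type as their pumped versions.\<close>

fun lasso_sat :: "core \<Rightarrow> letter list \<Rightarrow> letter list \<Rightarrow> bool" where
  "lasso_sat (Meet X Y) u v \<longleftrightarrow> meets X Y u"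
| "lasso_sat (Before X Y) u v \<longleftrightarrow> before X Y u"
| "lasso_sat (Nand \<phi> \<chi>) u v \<longleftrightarrow> \<not> (lasso_sat \<phi> u v \<and> lasso_sat \<chi> u v)"
| "lasso_sat (Ex X \<phi>) u v \<longleftrightarrow>
     (\<exists>u'\<in>set (variants X u). \<exists>v'\<in>set (variants X v). linked \<phi> u' v' \<and> lasso_sat \<phi> u' v')"

definition lasso :: "'a list \<Rightarrow> 'a list \<Rightarrow> nat \<Rightarrow> 'a" where
  "lasso u v t = (if t < length u then u ! t else v ! ((t - length u) mod length v))"

lemma seg_lasso_stem: "seg (lasso u v) 0 (length u) = u"
  by (rule nth_equalityI) (simp_all add: lasso_def)

lemma seg_lasso_loop:
  "seg (lasso u v) (length u + i * length v) (length u + Suc i * length v) = v"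
proof (rule nth_equalityI)
  fix k assume "k < length (seg (lasso u v) (length u + i * length v) (length u + Suc i * length v))"
  then have "k < length v"
    by simp
  then show "seg (lasso u v) (length u + i * length v) (length u + Suc i * length v) ! k = v ! k"
    by (simp add: lasso_def)
qed simp

lemma csat_lasso_iff:
  fixes p :: "nat \<Rightarrow> nat"
  assumes p: "strict_mono p" "0 < p 0" and ne: "u \<noteq> []" "v \<noteq> []"
    and stem: "tp \<phi> (seg w 0 (p 0)) = tp \<phi> u" and loop: "\<And>i. tp \<phi> (seg w (p i) (p (Suc i))) = tp \<phi> v"
  shows "csat \<phi> w \<longleftrightarrow> csat \<phi> (lasso u v)"
proof (rule csat_saturated)
  let ?f = "\<lambda>i. case i of 0 \<Rightarrow> 0 | Suc j \<Rightarrow> p j"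
  let ?g = "\<lambda>i. case i of 0 \<Rightarrow> 0 | Suc j \<Rightarrow> length u + j * length v"
  show "strict_mono ?f"
    unfolding strict_mono_Suc_iff using p strict_monoD[OF p(1)] by (auto split: nat.split)
  show "strict_mono ?g"
    unfolding strict_mono_Suc_iff using ne by (auto split: nat.split)
  show "tp \<phi> (seg w (?f i) (?f (Suc i))) = tp \<phi> (seg (lasso u v) (?g i) (?g (Suc i)))" for i
    using stem loop seg_lasso_stem[of u v] seg_lasso_loop[of u v] by (cases i) simp_all
qed simp_all

lemma tp_pump_stem: "tp \<phi> (u @ v) = tp \<phi> u \<Longrightarrow> tp \<phi> (seg (lasso u v) 0 (length u + k * length v)) = tp \<phi> u"
proof (induction k)
  case (Suc k)
  have "tp \<phi> (seg (lasso u v) 0 (length u + k * length v) @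
      seg (lasso u v) (length u + k * length v) (length u + Suc k * length v)) = tp \<phi> (u @ v)"
    by (rule tp_append_cong) (use Suc seg_lasso_loop[of u v k] in auto)
  then show ?case
    using Suc.prems by (simp add: seg_append)
qed (simp add: seg_lasso_stem)

lemma tp_pump_loop:
  "tp \<phi> (v @ v) = tp \<phi> v \<Longrightarrow>
    tp \<phi> (seg (lasso u v) (length u + k * length v) (length u + (k + Suc l) * length v)) = tp \<phi> v"
proof (induction l)
  case 0
  then show ?case
    using seg_lasso_loop[of u v k] by simp
next
  case (Suc l)
  have "tp \<phi> (seg (lasso u v) (length u + k * length v) (length u + (k + Suc l) * length v) @
      seg (lasso u v) (length u + (k + Suc l) * length v) (length u + Suc (k + Suc l) * length v)) = tp \<phi> (v @ v)"
    by (rule tp_append_cong) (use Suc seg_lasso_loop[of u v "k + Suc l"] in auto)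
  then show ?case
    using Suc.prems by (simp add: seg_append add_mult_distrib)
qed

lemma lasso_variant:
  assumes "u' \<in> set (variants X u)" "v' \<in> set (variants X v)" "v \<noteq> []"
  shows "lasso u' v' t \<in> set (letter_variants X (lasso u v t))"
proof -
  have l: "list_all2 (\<lambda>a b. b \<in> set (letter_variants X a)) u u'"
    "list_all2 (\<lambda>a b. b \<in> set (letter_variants X a)) v v'"
    using assms by (simp_all add: set_variants)
  then have "length u' = length u" "length v' = length v"
    by (simp_all add: list_all2_lengthD)
  then show ?thesis
    using list_all2_nthD[OF l(1), of t] list_all2_nthD[OF l(2), of "(t - length u) mod length v"] assms(3)
    by (simp add: lasso_def)
qed

lemma length_variants: "u' \<in> set (variants X u) \<Longrightarrow> length u' = length u"
  by (simp add: set_variants list_all2_lengthD)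

text \<open>The colour of a pair of cuts is the type between them together with the label
  \<open>q\<close> of the first one. The stem type is constant only from \<open>g 1\<close> on,
  after one loop has been absorbed.\<close>

lemma ramsey_types:
  fixes w :: "nat \<Rightarrow> letter" and f :: "nat \<Rightarrow> nat"
  assumes "strict_mono f" "finite S" "\<And>i. q i \<in> S"
  obtains g e s where "strict_mono (g :: nat \<Rightarrow> nat)" "\<And>i j. i < j \<Longrightarrow> tp \<phi> (seg w (f (g i)) (f (g j))) = e"
    "\<And>i. q (g i) = s" "\<And>i. 0 < i \<Longrightarrow> tp \<phi> (seg w 0 (f (g i))) = tp \<phi> (seg w 0 (f (g 1)))"
proof -
  obtain g :: "nat \<Rightarrow> nat" and e where g: "strict_mono g"
    "\<And>i j. i < j \<Longrightarrow> (q (g i), tp \<phi> (seg w (f (g i)) (f (g j)))) = e"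
    using ramsey_pairs[of "S \<times> range (tp \<phi>)" "\<lambda>i j. (q i, tp \<phi> (seg w (f i) (f j)))"]
      assms(2,3) finite_range_tp by blast
  have fg: "f (g i) < f (g j)" if "i < j" for i j
    using strict_monoD[OF assms(1) strict_monoD[OF g(1) that]] .
  have e: "tp \<phi> (seg w (f (g i)) (f (g j))) = snd e" if "i < j" for i j
    using g(2)[OF that] by (metis snd_conv)
  have q: "q (g i) = fst e" for i
    using g(2)[of i "Suc i"] by (metis fst_conv lessI)
  have "tp \<phi> (seg w 0 (f (g i))) = tp \<phi> (seg w 0 (f (g 1)))" if "0 < i" for i
  proof -
    have "tp \<phi> (seg w 0 (f (g 0)) @ seg w (f (g 0)) (f (g i))) =
        tp \<phi> (seg w 0 (f (g 0)) @ seg w (f (g 0)) (f (g 1)))"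
      by (rule tp_append_cong) (use e[OF that] e[of 0 1] in auto)
    then show ?thesis
      using fg[OF that] fg[of 0 1] by (simp add: seg_append)
  qed
  then show thesis
    using that[OF g(1) e q] by blast
qed

text \<open>For \<open>Ex\<close>, Ramsey's theorem cuts a witness on the infinite word into linked
  segments. These are variants of pumped words, which have the \<open>Ex\<close>-types of
  \<open>u\<close> and \<open>v\<close>; so variants of \<open>u\<close> and \<open>v\<close>
  themselves realise the same types.\<close>

theorem lasso_sat_iff:
  "u \<noteq> [] \<Longrightarrow> v \<noteq> [] \<Longrightarrow> linked \<phi> u v \<Longrightarrow> lasso_sat \<phi> u v \<longleftrightarrow> csat \<phi> (lasso u v)"
proof (induction \<phi> arbitrary: u v)
  case (Meet X Y)
  let ?n = "\<lambda>k. length u + k * length v"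
  have eq: "meets X Y (seg (lasso u v) 0 (?n k)) \<longleftrightarrow> meets X Y u" for k
    using tp_pump_stem[of "Meet X Y" u v k] Meet.prems(3) by (simp add: linked_def of_bool_eq_iff)
  have ex: "\<exists>k. t < ?n k" for t
    using Meet.prems(2) by (intro exI[of _ "Suc t"]) (cases v, auto)
  have "csat (Meet X Y) (lasso u v) \<longleftrightarrow> (\<exists>k. meets X Y (seg (lasso u v) 0 (?n k)))"
  proof
    assume "csat (Meet X Y) (lasso u v)"
    then obtain t where t: "X \<in> set (lasso u v t)" "Y \<in> set (lasso u v t)"
      by auto
    obtain k where "t < ?n k"
      using ex[of t] ..
    with t show "\<exists>k. meets X Y (seg (lasso u v) 0 (?n k))"
      unfolding meets_seg by (intro exI[of _ k] exI[of _ t]) simp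
  qed (auto simp: meets_seg)
  then show ?case
    using eq by simp
next
  case (Before X Y)
  let ?n = "\<lambda>k. length u + k * length v"
  have eq: "before X Y (seg (lasso u v) 0 (?n k)) \<longleftrightarrow> before X Y u" for k
    using tp_pump_stem[of "Before X Y" u v k] Before.prems(3) by (simp add: linked_def of_bool_eq_iff)
  have ex: "\<exists>k. t < ?n k" for t
    using Before.prems(2) by (intro exI[of _ "Suc t"]) (cases v, auto)
  have "csat (Before X Y) (lasso u v) \<longleftrightarrow> (\<exists>k. before X Y (seg (lasso u v) 0 (?n k)))"
  proof
    assume "csat (Before X Y) (lasso u v)"
    then obtain s t where t: "s < t" "X \<in> set (lasso u v s)" "Y \<in> set (lasso u v t)"
      by auto
    obtain k where "t < ?n k"
      using ex[of t] ..
    with t show "\<exists>k. before X Y (seg (lasso u v) 0 (?n k))"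
      unfolding before_seg by (intro exI[of _ k] exI[of _ s] exI[of _ t]) simp
  qed (auto simp: before_seg)
  then show ?case
    using eq by simp
next
  case (Nand \<phi> \<chi>)
  then show ?case
    by (simp add: linked_def)
next
  case (Ex X \<phi>)
  let ?w = "lasso u v" and ?n = "\<lambda>k. length u + k * length v"
  have pump: "tp (Ex X \<phi>) (seg ?w 0 (?n k)) = tp (Ex X \<phi>) u"
    "tp (Ex X \<phi>) (seg ?w (?n k) (?n (k + Suc l))) = tp (Ex X \<phi>) v" for k l
    using tp_pump_stem tp_pump_loop Ex.prems(3) unfolding linked_def by blast+
  show ?case
  proof
    assume "lasso_sat (Ex X \<phi>) u v"
    then obtain u' v' where uv: "u' \<in> set (variants X u)" "v' \<in> set (variants X v)"
      "linked \<phi> u' v'" "lasso_sat \<phi> u' v'"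
      by auto
    then have "csat \<phi> (lasso u' v')"
      using Ex.IH[of u' v'] Ex.prems(1,2) length_variants[OF uv(1)] length_variants[OF uv(2)] by fastforce
    then show "csat (Ex X \<phi>) (lasso u v)"
      using lasso_variant[OF uv(1,2) Ex.prems(2)] unfolding csat.simps by blast
  next
    assume "csat (Ex X \<phi>) (lasso u v)"
    then obtain w' where w': "\<And>t. w' t \<in> set (letter_variants X (lasso u v t))" "csat \<phi> w'"
      unfolding csat.simps by blast
    have mono: "strict_mono ?n"
      unfolding strict_mono_Suc_iff using Ex.prems(2) by simp
    obtain g :: "nat \<Rightarrow> nat" and e where g: "strict_mono g"
      "\<And>i j. i < j \<Longrightarrow> tp \<phi> (seg w' (?n (g i)) (?n (g j))) = e"
      "\<And>i. 0 < i \<Longrightarrow> tp \<phi> (seg w' 0 (?n (g i))) = tp \<phi> (seg w' 0 (?n (g 1)))"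
      by (rule ramsey_types[OF mono, of "{()}" "\<lambda>_. ()" \<phi> w']) (simp, simp, rule that, assumption+)
    have variant: "seg w' i j \<in> set (variants X (seg ?w i j))" for i j
      using w'(1) by (auto simp: set_variants list_all2_conv_all_nth)
    obtain u' where u': "u' \<in> set (variants X u)" "tp \<phi> (seg w' 0 (?n (g 1))) = tp \<phi> u'"
      using tp_Ex_transfer[OF pump(1) variant] by blast
    have "?n (g 2) = ?n (g 1 + Suc (g 2 - g 1 - 1))"
      using strict_monoD[OF g(1), of 1 2] by simp
    then obtain v' where v': "v' \<in> set (variants X v)" "tp \<phi> (seg w' (?n (g 1)) (?n (g 2))) = tp \<phi> v'"
      using tp_Ex_transfer[OF pump(2) variant] by metis
    have le: "?n (g 1) \<le> ?n (g 2)" "?n (g 2) \<le> ?n (g 3)"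
      using strict_monoD[OF g(1), of 1 2] strict_monoD[OF g(1), of 2 3] by simp_all
    have "tp \<phi> (u' @ v') = tp \<phi> (seg w' 0 (?n (g 1)) @ seg w' (?n (g 1)) (?n (g 2)))"
      by (rule tp_append_cong) (use u' v' in auto)
    then have "tp \<phi> (u' @ v') = tp \<phi> u'"
      using le g(3)[of 2] u'(2) by (simp add: seg_append)
    moreover have "tp \<phi> (v' @ v') = tp \<phi> (seg w' (?n (g 1)) (?n (g 2)) @ seg w' (?n (g 2)) (?n (g 3)))"
      by (rule tp_append_cong) (use v' g(2)[of 1 2] g(2)[of 2 3] in auto)
    then have "tp \<phi> (v' @ v') = tp \<phi> v'"
      using le g(2)[of 1 2] g(2)[of 1 3] v'(2) by (simp add: seg_append)
    ultimately have linked: "linked \<phi> u' v'"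
      by (simp add: linked_def)
    have ne: "u' \<noteq> []" "v' \<noteq> []"
      using length_variants[OF u'(1)] length_variants[OF v'(1)] Ex.prems(1,2) by auto
    have "csat \<phi> w' \<longleftrightarrow> csat \<phi> (lasso u' v')"
    proof (rule csat_lasso_iff[where p = "\<lambda>i. ?n (g (Suc i))"])
      show "strict_mono (\<lambda>i. ?n (g (Suc i)))"
        unfolding strict_mono_Suc_iff using Ex.prems(2) g(1) by (simp add: strict_mono_less)
      show "0 < ?n (g (Suc 0))"
        using Ex.prems(1) by simp
      show "tp \<phi> (seg w' 0 (?n (g (Suc 0)))) = tp \<phi> u'"
        using u'(2) by simp
      show "tp \<phi> (seg w' (?n (g (Suc i))) (?n (g (Suc (Suc i))))) = tp \<phi> v'" for i
        using g(2)[of "Suc i" "Suc (Suc i)"] g(2)[of 1 2] v'(2) by simp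
    qed (rule ne)+
    then have "lasso_sat \<phi> u' v'"
      using Ex.IH[OF ne linked] w'(2) by blast
    then show "lasso_sat (Ex X \<phi>) u v"
      using u'(1) v'(1) linked by auto
  qed
qed

section \<open>Verifying finite state machines\<close>

text \<open>List access with a default value, in terms of operations already known to be
  effective.\<close>

definition nth0 :: "'a::encodable list \<Rightarrow> nat \<Rightarrow> 'a" where
  "nth0 xs i = (case drop i xs of [] \<Rightarrow> dec 0 | y # ys \<Rightarrow> y)"

lemma nth0_nth: "i < length xs \<Longrightarrow> nth0 xs i = xs ! i"
  by (metis Cons_nth_drop_Suc list.simps(5) nth0_def)

definition cell :: "(nat \<times> nat) list \<Rightarrow> nat \<Rightarrow> nat \<Rightarrow> nat \<Rightarrow> nat \<times> nat" where
  "cell es q b p = nth0 es (4 * q + 2 * b + p)"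

text \<open>A table is used both for machines that choose \<open>Y\<close> depending on the current letter of \<open>X\<close>
  (kind 0) and for machines that choose \<open>X\<close> before seeing the current letter of \<open>Y\<close> (other
  kinds); the input bit \<open>b\<close> belongs to the other player.\<close>

definition emit :: "nat \<Rightarrow> (nat \<times> nat) list \<Rightarrow> nat \<Rightarrow> nat \<Rightarrow> nat \<Rightarrow> letter" where
  "emit k es q b p = (if k = 0 then letter3 (b = 1) (snd (cell es q b p) = 1) (p = 1)
     else letter3 (snd (cell es q 0 0) = 1) (b = 1) (p = 1))"

definition pbit :: "nat set \<Rightarrow> nat \<Rightarrow> nat" where
  "pbit P t = of_bool (t \<in> P)"

fun final :: "(nat \<times> nat) list \<Rightarrow> nat set \<Rightarrow> nat \<Rightarrow> nat \<Rightarrow> nat list \<Rightarrow> nat" where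
  "final es P q t [] = q"
| "final es P q t (b # bs) = final es P (fst (cell es q b (pbit P t))) (Suc t) bs"

fun emitted :: "nat \<Rightarrow> (nat \<times> nat) list \<Rightarrow> nat set \<Rightarrow> nat \<Rightarrow> nat \<Rightarrow> nat list \<Rightarrow> letter list" where
  "emitted k es P q t [] = []"
| "emitted k es P q t (b # bs) =
     emit k es q b (pbit P t) # emitted k es P (fst (cell es q b (pbit P t))) (Suc t) bs"

fun bit_lists :: "nat \<Rightarrow> nat list list" where
  "bit_lists 0 = [[]]"
| "bit_lists (Suc m) = map ((#) 0) (bit_lists m) @ map ((#) 1) (bit_lists m)"

definition valid_table :: "nat \<Rightarrow> nat \<Rightarrow> (nat \<times> nat) list \<Rightarrow> bool" where
  "valid_table n q0 es \<longleftrightarrow> q0 < n \<and> length es = 4 * n \<and> (\<forall>e\<in>set es. fst e < n \<and> snd e \<le> 1)"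

text \<open>A run starting at time \<open>N\<close> stands for runs starting at any later multiple
  of \<open>N\<close>, where \<open>P\<close> has the same residual. In a stem of length
  \<open>N + N\<close>, the first half is the actual beginning and the second half stands for
  everything between time \<open>N\<close> and the loop.\<close>

definition verified :: "core \<Rightarrow> nat set \<Rightarrow> nat \<Rightarrow> nat \<Rightarrow> nat \<Rightarrow> (nat \<times> nat) list \<Rightarrow> nat \<Rightarrow> bool" where
  "verified \<phi> P k n q0 es N \<longleftrightarrow>
     (\<forall>q\<in>set [0..<n]. \<forall>bs\<in>set (bit_lists (N + N)). \<exists>cs\<in>set (bit_lists N).
        final es P q N bs = final es P q N cs \<and> tp \<phi> (emitted k es P q N bs) = tp \<phi> (emitted k es P q N cs)) \<and>
     (\<forall>bs\<in>set (bit_lists (N + N)). \<forall>cs\<in>set (bit_lists N).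
        final es P (final es P q0 0 bs) N cs = final es P q0 0 bs \<and>
        linked \<phi> (emitted k es P q0 0 bs) (emitted k es P (final es P q0 0 bs) N cs) \<longrightarrow>
        lasso_sat \<phi> (emitted k es P q0 0 bs) (emitted k es P (final es P q0 0 bs) N cs) = (k = 0))"

lemma verified_block:
  assumes "verified \<phi> P k n q0 es N" "q < n" "bs \<in> set (bit_lists (N + N))"
  shows "\<exists>cs\<in>set (bit_lists N). final es P q N bs = final es P q N cs \<and>
    tp \<phi> (emitted k es P q N bs) = tp \<phi> (emitted k es P q N cs)"
proof -
  have "q \<in> set [0..<n]"
    using assms(2) by simp
  with assms(1,3) show ?thesis
    unfolding verified_def by blast
qed

lemma verified_loop:
  assumes "verified \<phi> P k n q0 es N" "bs \<in> set (bit_lists (N + N))" "cs \<in> set (bit_lists N)"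
    "final es P q0 0 bs = q" "final es P q N cs = q"
    "linked \<phi> (emitted k es P q0 0 bs) (emitted k es P q N cs)"
  shows "lasso_sat \<phi> (emitted k es P q0 0 bs) (emitted k es P q N cs) \<longleftrightarrow> k = 0"
  using assms(1)[unfolded verified_def, THEN conjunct2, rule_format, OF assms(2,3)] assms(4-6) by simp

lemma set_bit_lists: "set (bit_lists m) = {bs. length bs = m \<and> set bs \<subseteq> {0, 1}}"
proof (induction m)
  case (Suc m)
  have "(bs \<in> set (bit_lists (Suc m))) = (length bs = Suc m \<and> set bs \<subseteq> {0, 1})" for bs
    using Suc by (cases bs) auto
  then show ?case
    by blast
qed auto

lemma final_append: "final es P q t (bs @ cs) = final es P (final es P q t bs) (t + length bs) cs"
  by (induction bs arbitrary: q t) simp_all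

lemma emitted_append:
  "emitted k es P q t (bs @ cs) = emitted k es P q t bs @ emitted k es P (final es P q t bs) (t + length bs) cs"
  by (induction bs arbitrary: q t) simp_all

lemma length_emitted [simp]: "length (emitted k es P q t bs) = length bs"
  by (induction bs arbitrary: q t) simp_all

lemma residual_eq_Suc: "residual P t = residual P t' \<Longrightarrow> residual P (Suc t) = residual P (Suc t')"
  by (simp add: shift_residual[symmetric])

lemma pbit_cong: "residual P t = residual P t' \<Longrightarrow> pbit P t = pbit P t'"
  unfolding pbit_def residual_0_iff[of P, symmetric] by simp

lemma final_cong: "residual P t = residual P t' \<Longrightarrow> final es P q t bs = final es P q t' bs"
proof (induction bs arbitrary: q t t')
  case (Cons b bs)
  show ?case
    using Cons.IH[OF residual_eq_Suc[OF Cons.prems]] pbit_cong[OF Cons.prems] by simp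
qed simp

lemma emitted_cong: "residual P t = residual P t' \<Longrightarrow> emitted k es P q t bs = emitted k es P q t' bs"
proof (induction bs arbitrary: q t t')
  case (Cons b bs)
  show ?case
    using Cons.IH[OF residual_eq_Suc[OF Cons.prems]] pbit_cong[OF Cons.prems] by simp
qed simp

lemma residual_mult:
  assumes "\<And>t. N \<le> t \<Longrightarrow> residual P (t + N) = residual P t" "N \<le> t"
  shows "residual P (t + c * N) = residual P t"
proof (induction c)
  case (Suc c)
  then show ?case
    using assms(1)[of "t + c * N"] assms(2) by (simp add: algebra_simps)
qed simp

lemma final_less:
  assumes "valid_table n q0 es" "q < n" "set bs \<subseteq> {0, 1}"
  shows "final es P q t bs < n"
  using assms(2,3)
proof (induction bs arbitrary: q t)
  case (Cons b bs)
  let ?i = "4 * q + 2 * b + pbit P t"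
  have "?i < length es"
    using Cons.prems assms(1) by (auto simp: valid_table_def pbit_def)
  then have "cell es q b (pbit P t) \<in> set es"
    by (simp add: cell_def nth0_nth)
  then have "fst (cell es q b (pbit P t)) < n"
    using assms(1) by (auto simp: valid_table_def)
  then show ?case
    using Cons by simp
qed simp

section \<open>Runs on infinite inputs: soundness and completeness of the test\<close>

definition machine_state :: "(nat \<times> nat) list \<Rightarrow> nat set \<Rightarrow> nat \<Rightarrow> (nat \<Rightarrow> nat) \<Rightarrow> nat \<Rightarrow> nat" where
  "machine_state es P q0 b t = final es P q0 0 (seg b 0 t)"

definition machine_word :: "nat \<Rightarrow> (nat \<times> nat) list \<Rightarrow> nat set \<Rightarrow> nat \<Rightarrow> (nat \<Rightarrow> nat) \<Rightarrow> nat \<Rightarrow> letter" where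
  "machine_word k es P q0 b t = emit k es (machine_state es P q0 b t) (b t) (pbit P t)"

lemma final_seg: "i \<le> j \<Longrightarrow> final es P (machine_state es P q0 b i) i (seg b i j) = machine_state es P q0 b j"
  using final_append[of es P q0 0 "seg b 0 i" "seg b i j"] by (simp add: machine_state_def seg_append)

lemma emitted_seg:
  "i \<le> j \<Longrightarrow> emitted k es P (machine_state es P q0 b i) i (seg b i j) = seg (machine_word k es P q0 b) i j"
proof (induction j rule: dec_induct)
  case (step j)
  then show ?case
    by (simp add: seg_Suc emitted_append final_seg machine_word_def)
qed simp

lemma machine_state_0 [simp]: "machine_state es P q0 b 0 = q0"
  by (simp add: machine_state_def)

lemma machine_state_Suc:
  "machine_state es P q0 b (Suc t) = fst (cell es (machine_state es P q0 b t) (b t) (pbit P t))"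
  by (simp add: machine_state_def seg_Suc final_append)

text \<open>All blocks but the last are replaced by a single one, which leaves two blocks to be
  reduced by the test.\<close>

lemma blocks_reduce:
  assumes valid: "valid_table n q0 es" and per: "\<And>t. N \<le> t \<Longrightarrow> residual P (t + N) = residual P t"
    and verified: "verified \<phi> P k n q0 es N"
    and bs: "length bs = Suc c * N" "set bs \<subseteq> {0, 1}" and q: "q < n"
  shows "\<exists>cs\<in>set (bit_lists N). final es P q N bs = final es P q N cs \<and>
      tp \<phi> (emitted k es P q N bs) = tp \<phi> (emitted k es P q N cs)"
  using bs
proof (induction c arbitrary: bs)
  case 0
  then show ?case
    by (intro bexI[of _ bs]) (auto simp: set_bit_lists)
next
  case (Suc c)
  define bs1 bs2 where "bs1 = take (Suc c * N) bs" and "bs2 = drop (Suc c * N) bs"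
  have split: "bs = bs1 @ bs2" "length bs1 = Suc c * N" "length bs2 = N"
    using Suc.prems(1) by (simp_all add: bs1_def bs2_def)
  have sub: "set bs1 \<subseteq> {0, 1}" "set bs2 \<subseteq> {0, 1}"
    using Suc.prems(2) split(1) by auto
  obtain cs where cs: "cs \<in> set (bit_lists N)" "final es P q N bs1 = final es P q N cs"
    "tp \<phi> (emitted k es P q N bs1) = tp \<phi> (emitted k es P q N cs)"
    using Suc.IH[OF split(2) sub(1)] by blast
  have len: "length cs = N" "set cs \<subseteq> {0, 1}"
    using cs(1) by (simp_all add: set_bit_lists)
  \<comment> \<open>The replacement moves the last block to an earlier time; equal residuals ensure
    that it runs as before.\<close>
  have res: "residual P (N + length bs1) = residual P (N + length cs)"
    using residual_mult[OF per, of N "Suc c"] residual_mult[OF per, of N 1] split(2) len(1) by simp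
  have "final es P q N bs = final es P q N (cs @ bs2)"
    unfolding split(1) final_append cs(2) by (rule final_cong[OF res])
  moreover have "tp \<phi> (emitted k es P q N bs) = tp \<phi> (emitted k es P q N (cs @ bs2))"
    unfolding split(1) emitted_append cs(2) emitted_cong[OF res] by (rule tp_append_cong[OF cs(3)]) simp
  moreover have "cs @ bs2 \<in> set (bit_lists (N + N))"
    using len split(3) sub(2) by (simp add: set_bit_lists)
  then have "\<exists>ds\<in>set (bit_lists N). final es P q N (cs @ bs2) = final es P q N ds \<and>
      tp \<phi> (emitted k es P q N (cs @ bs2)) = tp \<phi> (emitted k es P q N ds)"
    by (rule verified_block[OF verified q])
  ultimately show ?case
    by simp
qed

text \<open>Ramsey's theorem cuts the run at multiples of \<open>N\<close>, always in the same
  state. Stem and loop are then shortened to the tested lengths, keeping states and types.\<close>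

theorem verified_sound:
  assumes valid: "valid_table n q0 es" and per: "\<And>t. N \<le> t \<Longrightarrow> residual P (t + N) = residual P t"
    and verified: "verified \<phi> P k n q0 es N" and N: "0 < N" and b: "\<And>t. b t \<in> {0, 1}"
  shows "csat \<phi> (machine_word k es P q0 b) \<longleftrightarrow> k = 0"
proof -
  let ?w = "machine_word k es P q0 b" and ?s = "machine_state es P q0 b"
  have bits: "set (seg b i j) \<subseteq> {0, 1}" for i j
  proof
    fix x assume "x \<in> set (seg b i j)"
    then obtain t where "x = b t"
      by (auto simp: seg_def)
    then show "x \<in> {0, 1}"
      using b[of t] by simp
  qed
  have q0: "q0 < n"
    using valid by (simp add: valid_table_def)
  have s: "?s t < n" for t
    unfolding machine_state_def by (rule final_less[OF valid q0 bits])
  have mono: "strict_mono (\<lambda>i. i * N)"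
    unfolding strict_mono_Suc_iff using N by simp
  have fin: "finite {..<n}" and mem: "?s (i * N) \<in> {..<n}" for i
    using s by auto
  obtain g :: "nat \<Rightarrow> nat" and e q where g: "strict_mono g"
    "\<And>i j. i < j \<Longrightarrow> tp \<phi> (seg ?w (g i * N) (g j * N)) = e" "\<And>i. ?s (g i * N) = q"
    "\<And>i. 0 < i \<Longrightarrow> tp \<phi> (seg ?w 0 (g i * N)) = tp \<phi> (seg ?w 0 (g 1 * N))"
    by (rule ramsey_types[OF mono fin mem, of \<phi> ?w]) (rule that, assumption+)
  \<comment> \<open>The stem ends at \<open>g 2 * N\<close>: at least one full block must remain
    after the first \<open>N\<close> letters, and strict monotonicity guarantees
    \<open>2 \<le> g 2\<close>.\<close>
  have g2: "2 \<le> g 2" "g 2 < g 3"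
    using strict_monoD[OF g(1), of 0 1] strict_monoD[OF g(1), of 1 2] strict_monoD[OF g(1), of 2 3] by auto
  have eq: "Suc (g 2 - 2) = g 2 - 1" "Suc (g 3 - g 2 - 1) = g 3 - g 2"
    using g2 by simp_all
  have "length (seg b N (g 2 * N)) = Suc (g 2 - 2) * N"
    unfolding eq by (simp add: diff_mult_distrib)
  then obtain cs where cs: "cs \<in> set (bit_lists N)"
    "final es P (?s N) N (seg b N (g 2 * N)) = final es P (?s N) N cs"
    "tp \<phi> (emitted k es P (?s N) N (seg b N (g 2 * N))) = tp \<phi> (emitted k es P (?s N) N cs)"
    using blocks_reduce[OF valid per verified _ bits s] by blast
  have len_cs: "length cs = N" "set cs \<subseteq> {0, 1}"
    using cs(1) by (simp_all add: set_bit_lists)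
  define bs where "bs = seg b 0 N @ cs"
  have le: "N \<le> g 2 * N" "g 2 * N \<le> g 3 * N"
    using g2 by simp_all
  have bs: "bs \<in> set (bit_lists (N + N))"
    using len_cs bits[of 0 N] by (simp add: bs_def set_bit_lists)
  have final_bs: "final es P q0 0 bs = q"
    using cs(2) final_seg[OF le(1), of es P q0 b] final_seg[of 0 N es P q0 b] g(3)[of 2]
    by (simp add: bs_def final_append)
  define u where "u = emitted k es P q0 0 bs"
  have "tp \<phi> (seg ?w 0 N @ emitted k es P (?s N) N cs) = tp \<phi> (seg ?w 0 N @ seg ?w N (g 2 * N))"
    by (rule tp_append_cong) (use cs(3) emitted_seg[OF le(1), of k es P q0 b] in simp_all)
  moreover have "u = seg ?w 0 N @ emitted k es P (?s N) N cs"
    using emitted_seg[of 0 N k es P q0 b] final_seg[of 0 N es P q0 b] by (simp add: u_def bs_def emitted_append)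
  ultimately have u: "tp \<phi> u = tp \<phi> (seg ?w 0 (g 2 * N))"
    using le by (simp add: seg_append)
  have "length (seg b (g 2 * N) (g 3 * N)) = Suc (g 3 - g 2 - 1) * N"
    unfolding eq by (simp add: diff_mult_distrib)
  moreover have "q < n"
    using s g(3) by metis
  ultimately obtain ds where ds: "ds \<in> set (bit_lists N)"
    "final es P q N (seg b (g 2 * N) (g 3 * N)) = final es P q N ds"
    "tp \<phi> (emitted k es P q N (seg b (g 2 * N) (g 3 * N))) = tp \<phi> (emitted k es P q N ds)"
    using blocks_reduce[OF valid per verified _ bits] by blast
  have res: "residual P (g 2 * N) = residual P N"
  proof -
    have "g 2 * N = N + (g 2 - 1) * N"
      using g2 by (simp add: algebra_simps)
    then show ?thesis
      using residual_mult[OF per, of N "g 2 - 1"] by simp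
  qed
  define v where "v = emitted k es P q N ds"
  have final_ds: "final es P q N ds = q"
    using ds(2) final_seg[OF le(2), of es P q0 b] g(3)[of 2] g(3)[of 3] final_cong[OF res] by simp
  have v: "tp \<phi> v = e"
    using ds(3) emitted_seg[OF le(2), of k es P q0 b] g(3)[of 2] emitted_cong[OF res] g(2)[of 2 3]
    by (simp add: v_def)
  have ne: "u \<noteq> []" "v \<noteq> []"
  proof -
    have "length u = N + N" "length v = N"
      using bs ds(1) by (simp_all add: u_def v_def set_bit_lists)
    then show "u \<noteq> []" "v \<noteq> []"
      using N by auto
  qed
  have "tp \<phi> (u @ v) = tp \<phi> (seg ?w 0 (g 2 * N) @ seg ?w (g 2 * N) (g 3 * N))"
    by (rule tp_append_cong) (use u v g(2)[of 2 3] in simp_all)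
  then have "tp \<phi> (u @ v) = tp \<phi> u"
    using le u g(4)[of 2] g(4)[of 3] by (simp add: seg_append)
  moreover have "tp \<phi> (v @ v) = tp \<phi> (seg ?w (g 0 * N) (g 1 * N) @ seg ?w (g 1 * N) (g 2 * N))"
    by (rule tp_append_cong) (use v g(2)[of 0 1] g(2)[of 1 2] in simp_all)
  then have "tp \<phi> (v @ v) = tp \<phi> v"
    using v g(2)[of 0 2] strict_monoD[OF g(1), of 0 1] strict_monoD[OF g(1), of 1 2]
    by (simp add: seg_append)
  ultimately have linked: "linked \<phi> u v"
    by (simp add: linked_def)
  have "csat \<phi> ?w \<longleftrightarrow> csat \<phi> (lasso u v)"
  proof (rule csat_lasso_iff[where p = "\<lambda>i. g (i + 2) * N"])
    show "strict_mono (\<lambda>i. g (i + 2) * N)"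
      unfolding strict_mono_Suc_iff using g(1) N by (simp add: strict_mono_less)
    show "0 < g (0 + 2) * N"
      using g2 N by (simp add: numeral_2_eq_2)
    show "tp \<phi> (seg ?w 0 (g (0 + 2) * N)) = tp \<phi> u"
      using u by (simp add: numeral_2_eq_2)
    show "tp \<phi> (seg ?w (g (i + 2) * N) (g (Suc i + 2) * N)) = tp \<phi> v" for i
      using g(2)[of "i + 2" "Suc i + 2"] v by simp
  qed (rule ne)+
  also have "\<dots> \<longleftrightarrow> lasso_sat \<phi> u v"
    using lasso_sat_iff[OF ne linked] by simp
  also have "\<dots> \<longleftrightarrow> k = 0"
    using verified_loop[OF verified bs ds(1) final_bs final_ds] linked by (simp add: u_def v_def)
  finally show ?thesis .
qed

text \<open>\<open>B i\<close> is the behaviour of all runs over \<open>i * K\<close> letters.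
  Ramsey's theorem for the differences yields \<open>B a = B c = B (a + c)\<close>: a run over
  \<open>2 * a\<close> periods is changed into one over \<open>a + c\<close>, and that one into one
  over \<open>a\<close>.\<close>

theorem verified_complete:
  assumes valid: "valid_table n q0 es" and per: "\<And>t. K \<le> t \<Longrightarrow> residual P (t + K) = residual P t"
    and K: "0 < K" and all: "\<And>b. (\<And>t. b t \<in> {0, 1}) \<Longrightarrow> csat \<phi> (machine_word k es P q0 b) \<longleftrightarrow> k = 0"
  shows "\<exists>j. verified \<phi> P k n q0 es (Suc j * K)"
proof -
  define B where "B i = {(q, s, q'). q < n \<and> (\<exists>bs\<in>set (bit_lists (i * K)).
      q' = final es P q K bs \<and> s = tp \<phi> (emitted k es P q K bs))}" for i
  have res: "residual P (K + i * K) = residual P K" for i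
    using residual_mult[OF per, of K i] by simp
  have mem: "B i \<in> Pow ({..<n} \<times> range (tp \<phi>) \<times> {..<n})" for i
    using final_less[OF valid] by (auto simp: B_def set_bit_lists)
  have fin: "finite (Pow ({..<n} \<times> range (tp \<phi>) \<times> {..<n}))"
    using finite_range_tp by simp
  obtain g :: "nat \<Rightarrow> nat" and e where g: "strict_mono g" "\<And>i j. i < j \<Longrightarrow> B (g j - g i) = e"
    by (rule ramsey_pairs[where c = "\<lambda>i j. B (j - i)", OF fin mem]) (rule that, assumption+)
  define a c where "a = g 1 - g 0" and "c = g 2 - g 1"
  have lt: "g 0 < g 1" "g 1 < g 2"
    using strict_monoD[OF g(1), of 0 1] strict_monoD[OF g(1), of 1 2] by auto
  have B: "B c = B a" "B (a + c) = B a" and a: "a = Suc (a - 1)"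
    using g(2)[of 0 1] g(2)[of 1 2] g(2)[of 0 2] lt by (simp_all add: a_def c_def)
  define N where "N = a * K"
  have N: "0 < N" "residual P N = residual P K"
    using a K res[of "a - 1"] by (simp add: N_def, metis N_def a mult_Suc)
  have res2: "residual P (K + N) = residual P K" "residual P (N + N) = residual P K"
    using res[of a] res[of "a + a - 1"] a by (simp add: N_def, metis N_def add.assoc add_mult_distrib add_Suc mult_Suc diff_Suc_1)
  have "\<exists>cs\<in>set (bit_lists N). final es P q N bs = final es P q N cs \<and>
      tp \<phi> (emitted k es P q N bs) = tp \<phi> (emitted k es P q N cs)"
    if q: "q < n" and bs: "bs \<in> set (bit_lists (N + N))" for q bs
  proof -
    define bs1 bs2 where "bs1 = take N bs" and "bs2 = drop N bs"
    have split: "bs = bs1 @ bs2" "bs1 \<in> set (bit_lists N)" "bs2 \<in> set (bit_lists N)"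
      using bs set_take_subset[of N bs] set_drop_subset[of N bs]
      by (auto simp: bs1_def bs2_def set_bit_lists)
    define q1 where "q1 = final es P q K bs1"
    have "q1 < n"
      unfolding q1_def by (rule final_less[OF valid q]) (use split(2) in \<open>simp add: set_bit_lists\<close>)
    then have "(q1, tp \<phi> (emitted k es P q1 K bs2), final es P q1 K bs2) \<in> B a"
      using split(3) by (auto simp: B_def N_def)
    then have "(q1, tp \<phi> (emitted k es P q1 K bs2), final es P q1 K bs2) \<in> B c"
      using B by simp
    then obtain bs3 where bs3: "bs3 \<in> set (bit_lists (c * K))" "final es P q1 K bs2 = final es P q1 K bs3"
      "tp \<phi> (emitted k es P q1 K bs2) = tp \<phi> (emitted k es P q1 K bs3)"
      by (auto simp: B_def)
    have len: "length bs1 = N" "length bs3 = c * K" "set bs1 \<subseteq> {0, 1}" "set bs3 \<subseteq> {0, 1}"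
      using split(2) bs3(1) by (simp_all add: set_bit_lists)
    have "bs1 @ bs3 \<in> set (bit_lists ((a + c) * K))"
      using len by (simp add: set_bit_lists N_def add_mult_distrib)
    then have "(q, tp \<phi> (emitted k es P q K (bs1 @ bs3)), final es P q K (bs1 @ bs3)) \<in> B (a + c)"
      using q by (auto simp: B_def)
    then obtain cs where cs: "cs \<in> set (bit_lists N)" "final es P q K (bs1 @ bs3) = final es P q K cs"
      "tp \<phi> (emitted k es P q K (bs1 @ bs3)) = tp \<phi> (emitted k es P q K cs)"
      unfolding B(2) by (auto simp: B_def N_def)
    have "final es P q K bs = final es P q K (bs1 @ bs3)"
      using bs3(2) final_cong[OF res2(1)] unfolding split(1) final_append len(1) q1_def by simp
    moreover have "tp \<phi> (emitted k es P q K bs) = tp \<phi> (emitted k es P q K (bs1 @ bs3))"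
      unfolding split(1) emitted_append len(1) emitted_cong[OF res2(1)] q1_def[symmetric]
      by (rule tp_append_cong) (use bs3(3) in simp_all)
    ultimately show ?thesis
      using cs final_cong[OF N(2)] emitted_cong[OF N(2)] by (intro bexI[of _ cs]) simp_all
  qed
  moreover have "lasso_sat \<phi> (emitted k es P q0 0 bs) (emitted k es P (final es P q0 0 bs) N cs) = (k = 0)"
    if bs: "bs \<in> set (bit_lists (N + N))" and cs: "cs \<in> set (bit_lists N)"
      and loop: "final es P (final es P q0 0 bs) N cs = final es P q0 0 bs"
      and linked: "linked \<phi> (emitted k es P q0 0 bs) (emitted k es P (final es P q0 0 bs) N cs)" for bs cs
  proof -
    define q where "q = final es P q0 0 bs"
    \<comment> \<open>Every tested pair comes from a genuine infinite input, \<open>bs\<close>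
      followed by \<open>cs\<close> for ever, to which the assumption on the machine
      applies.\<close>
    let ?b = "lasso bs cs" and ?u = "emitted k es P q0 0 bs" and ?v = "emitted k es P q N cs"
    have len: "length bs = N + N" "length cs = N" "set bs \<subseteq> {0, 1}" "set cs \<subseteq> {0, 1}"
      using bs cs by (simp_all add: set_bit_lists)
    have "?b t \<in> {0, 1}" for t
    proof -
      have "?b t \<in> set bs \<union> set cs"
        using N(1) len(1,2) by (auto simp: lasso_def intro!: nth_mem)
      then show ?thesis
        using len(3,4) by blast
    qed
    then have "csat \<phi> (machine_word k es P q0 ?b) \<longleftrightarrow> k = 0"
      by (rule all)
    have ne: "?u \<noteq> []" "?v \<noteq> []"
      using len(1,2) N(1) by (metis length_emitted length_0_conv add_is_0 less_not_refl)+
    let ?p = "\<lambda>i. N + N + i * N"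
    have res3: "residual P (?p i) = residual P N" for i
    proof -
      have "?p i = K + (a + a - 1 + i * a) * K"
        using a by (cases a) (simp_all add: N_def algebra_simps)
      then show ?thesis
        using res[of "a + a - 1 + i * a"] N(2) by simp
    qed
    have stem: "seg ?b 0 (?p 0) = bs" and block: "seg ?b (?p i) (?p (Suc i)) = cs" for i
      using seg_lasso_stem[of bs cs] seg_lasso_loop[of bs cs i] len(1,2) by simp_all
    have state: "machine_state es P q0 ?b (?p i) = q" for i
    proof (induction i)
      case 0
      then show ?case
        using stem by (simp add: machine_state_def q_def)
    next
      case (Suc i)
      then show ?case
        using final_seg[of "?p i" "?p (Suc i)" es P q0 ?b] final_cong[OF res3[of i]] block[of i] loop
        by (simp add: q_def)
    qed
    have "csat \<phi> (machine_word k es P q0 ?b) \<longleftrightarrow> csat \<phi> (lasso ?u ?v)"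
    proof (rule csat_lasso_iff[where p = ?p])
      show "strict_mono ?p"
        unfolding strict_mono_Suc_iff using N(1) by simp
      show "0 < ?p 0"
        using N(1) by simp
      show "tp \<phi> (seg (machine_word k es P q0 ?b) 0 (?p 0)) = tp \<phi> ?u"
        using emitted_seg[of 0 "?p 0" k es P q0 ?b] stem by simp
      show "tp \<phi> (seg (machine_word k es P q0 ?b) (?p i) (?p (Suc i))) = tp \<phi> ?v" for i
        using emitted_seg[of "?p i" "?p (Suc i)" k es P q0 ?b] state[of i] emitted_cong[OF res3[of i]] block[of i]
        by simp
    qed (rule ne)+
    then show ?thesis
      using lasso_sat_iff[OF ne] linked \<open>csat \<phi> (machine_word k es P q0 ?b) \<longleftrightarrow> k = 0\<close>
      unfolding q_def by simp
  qed
  ultimately have "verified \<phi> P k n q0 es N"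
    unfolding verified_def by simp
  then show ?thesis
    using a unfolding N_def by metis
qed

section \<open>The verification is computable\<close>

lemma less_prod_encode: "0 < a \<Longrightarrow> b < prod_encode (a, b)"
proof -
  have "k \<le> triangle k" for k
    by (induction k) auto
  from this[of "a + b"] show "0 < a \<Longrightarrow> b < prod_encode (a, b)"
    by (simp add: prod_encode_def)
qed

instantiation core :: encodable
begin

text \<open>The variable of \<open>Ex\<close> is made part of the tag, so that every tag from 3 on
  is used and the coding is onto.\<close>

primrec enc_core :: "core \<Rightarrow> nat" where
  "enc_core (Meet x y) = prod_encode (0, prod_encode (x, y))"
| "enc_core (Before x y) = prod_encode (1, prod_encode (x, y))"
| "enc_core (Nand \<phi> \<chi>) = prod_encode (2, prod_encode (enc_core \<phi>, enc_core \<chi>))"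
| "enc_core (Ex x \<phi>) = prod_encode (3 + x, enc_core \<phi>)"

instance
proof
  have "\<phi> = \<chi>" if "enc \<phi> = enc \<chi>" for \<phi> \<chi> :: core
    using that
  proof (induction \<phi> arbitrary: \<chi>)
    case (Meet x y)
    then show ?case by (cases \<chi>) auto
  next
    case (Before x y)
    then show ?case by (cases \<chi>) auto
  next
    case (Nand \<phi>1 \<phi>2)
    then show ?case by (cases \<chi>) auto
  next
    case (Ex x \<phi>)
    then show ?case by (cases \<chi>) auto
  qed
  then have "inj (enc :: core \<Rightarrow> nat)"
    by (rule injI)
  moreover have "\<exists>\<phi> :: core. enc \<phi> = n" for n
  proof (induction n rule: less_induct)
    case (less n)
    obtain t r where n: "n = prod_encode (t, r)"
      by (metis prod_decode_inverse surj_pair)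
    obtain x y where r: "r = prod_encode (x, y)"
      by (metis prod_decode_inverse surj_pair)
    have le: "x \<le> r" "y \<le> r"
      unfolding r by (rule le_prod_encode_1, rule le_prod_encode_2)
    consider "t = 0" | "t = 1" | "t = 2" | "t = 3 + (t - 3)" "0 < t"
      by linarith
    then show ?case
    proof cases
      case 1
      then show ?thesis
        using n r by (intro exI[of _ "Meet x y"]) simp
    next
      case 2
      then show ?thesis
        using n r by (intro exI[of _ "Before x y"]) simp
    next
      case 3
      then have "x < n" "y < n"
        using less_prod_encode[of t r] n le by auto
      then obtain \<phi> \<chi> :: core where "enc \<phi> = x" "enc \<chi> = y"
        using less.IH by metis
      then show ?thesis
        using 3 n r by (intro exI[of _ "Nand \<phi> \<chi>"]) simp
    next
      case 4
      then have "r < n"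
        using less_prod_encode[of t r] n by simp
      then obtain \<phi> :: core where "enc \<phi> = r"
        using less.IH by metis
      then show ?thesis
        using 4 n by (intro exI[of _ "Ex (t - 3) \<phi>"]) simp
    qed
  qed
  then have "surj (enc :: core \<Rightarrow> nat)"
    by (metis surj_def)
  ultimately show "bij (enc :: core \<Rightarrow> nat)"
    by (rule bijI)
qed

end

lemma effective_prod_encode: "effective f \<Longrightarrow> effective (\<lambda>x. prod_encode (f x))"
proof (rule effective_comp[of prod_encode])
  have "prod_encode = (enc :: nat \<times> nat \<Rightarrow> nat)"
    by (auto simp: enc_prod_def enc_nat_def)
  then show "effective prod_encode"
    using effective_enc[OF effective_id] by metis
qed

lemma effective_Meet: "effective f \<Longrightarrow> effective g \<Longrightarrow> effective (\<lambda>x. Meet (f x) (g x))"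
proof -
  have eq: "Meet x y = dec (prod_encode (0, prod_encode (x, y)))" for x y
    by (metis dec_enc enc_core.simps(1))
  show "effective f \<Longrightarrow> effective g \<Longrightarrow> effective (\<lambda>x. Meet (f x) (g x))"
    unfolding eq by (intro effective_dec effective_prod_encode effective_intros)
qed

lemma effective_Before: "effective f \<Longrightarrow> effective g \<Longrightarrow> effective (\<lambda>x. Before (f x) (g x))"
proof -
  have eq: "Before x y = dec (prod_encode (1, prod_encode (x, y)))" for x y
    by (metis dec_enc enc_core.simps(2))
  show "effective f \<Longrightarrow> effective g \<Longrightarrow> effective (\<lambda>x. Before (f x) (g x))"
    unfolding eq by (intro effective_dec effective_prod_encode effective_intros)
qed

lemma effective_Nand: "effective f \<Longrightarrow> effective g \<Longrightarrow> effective (\<lambda>x. Nand (f x) (g x))"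
proof -
  have eq: "Nand x y = dec (prod_encode (2, prod_encode (enc x, enc y)))" for x y
    by (metis dec_enc enc_core.simps(3))
  show "effective f \<Longrightarrow> effective g \<Longrightarrow> effective (\<lambda>x. Nand (f x) (g x))"
    unfolding eq by (intro effective_dec effective_prod_encode effective_intros)
qed

lemma effective_Ex: "effective f \<Longrightarrow> effective g \<Longrightarrow> effective (\<lambda>x. Ex (f x) (g x))"
proof -
  have eq: "Ex x y = dec (prod_encode (3 + x, enc y))" for x y
    by (metis dec_enc enc_core.simps(4))
  show "effective f \<Longrightarrow> effective g \<Longrightarrow> effective (\<lambda>x. Ex (f x) (g x))"
    unfolding eq by (intro effective_dec effective_prod_encode effective_intros)
qed

lemma effective_case_core:
  assumes c: "effective c"
    and m: "effective (\<lambda>z. m (fst z) (fst (snd z)) (snd (snd z)))"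
    and b: "effective (\<lambda>z. b (fst z) (fst (snd z)) (snd (snd z)))"
    and d: "effective (\<lambda>z. d (fst z) (fst (snd z)) (snd (snd z)))"
    and e: "effective (\<lambda>z. e (fst z) (fst (snd z)) (snd (snd z)))"
  shows "effective (\<lambda>x. case c x of Meet X Y \<Rightarrow> m x X Y | Before X Y \<Rightarrow> b x X Y
    | Nand \<phi> \<chi> \<Rightarrow> d x \<phi> \<chi> | Ex X \<phi> \<Rightarrow> e x X \<phi>)"
proof -
  let ?t = "\<lambda>n. fst (prod_decode n)" and ?r = "\<lambda>n. snd (prod_decode n)"
  have eq: "(case \<psi> of Meet X Y \<Rightarrow> m' X Y | Before X Y \<Rightarrow> b' X Y | Nand \<phi> \<chi> \<Rightarrow> d' \<phi> \<chi> | Ex X \<phi> \<Rightarrow> e' X \<phi>) =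
     (if ?t (enc \<psi>) = 0 then m' (?t (?r (enc \<psi>))) (?r (?r (enc \<psi>)))
      else if ?t (enc \<psi>) = 1 then b' (?t (?r (enc \<psi>))) (?r (?r (enc \<psi>)))
      else if ?t (enc \<psi>) = 2 then d' (dec (?t (?r (enc \<psi>)))) (dec (?r (?r (enc \<psi>))))
      else e' (?t (enc \<psi>) - 3) (dec (?r (enc \<psi>))))" for \<psi> m' b' d' e'
    by (cases \<psi>) auto
  show ?thesis
    unfolding eq
    by (intro effective_comp3[OF m] effective_comp3[OF b] effective_comp3[OF d] effective_comp3[OF e]
        effective_dec effective_intros c)
qed

lemma effective_comp4:
  assumes "effective (\<lambda>z. f (fst z) (fst (snd z)) (fst (snd (snd z))) (snd (snd (snd z))))"
    "effective a" "effective b" "effective c" "effective d"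
  shows "effective (\<lambda>x. f (a x) (b x) (c x) (d x))"
  using effective_comp[OF assms(1), of "\<lambda>x. (a x, b x, c x, d x)"] assms(2-5)
  by (simp add: effective_Pair)

lemma effective_comp5:
  assumes "effective (\<lambda>z. f (fst z) (fst (snd z)) (fst (snd (snd z))) (fst (snd (snd (snd z))))
      (snd (snd (snd (snd z)))))"
    "effective a" "effective b" "effective c" "effective d" "effective e"
  shows "effective (\<lambda>x. f (a x) (b x) (c x) (d x) (e x))"
  using effective_comp[OF assms(1), of "\<lambda>x. (a x, b x, c x, d x, e x)"] assms(2-6)
  by (simp add: effective_Pair)

lemma decidable_comp2:
  assumes "decidable (\<lambda>z. p (fst z) (snd z))" "effective a" "effective b"
  shows "decidable (\<lambda>x. p (a x) (b x))"
  using effective_comp2[of "\<lambda>a b. of_bool (p a b) :: nat"] assms unfolding decidable_def by blast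

lemma decidable_comp3:
  assumes "decidable (\<lambda>z. p (fst z) (fst (snd z)) (snd (snd z)))" "effective a" "effective b" "effective c"
  shows "decidable (\<lambda>x. p (a x) (b x) (c x))"
  using effective_comp3[of "\<lambda>a b c. of_bool (p a b c) :: nat"] assms unfolding decidable_def by blast

lemma effective_nth0: "effective l \<Longrightarrow> effective i \<Longrightarrow> effective (\<lambda>x. nth0 (l x) (i x))"
  unfolding nth0_def by (intro effective_intros)

lemma effective_variants: "effective X \<Longrightarrow> effective u \<Longrightarrow> effective (\<lambda>x. variants (X x) (u x))"
proof (rule effective_comp2[of variants])
  have "variants X u = foldr (\<lambda>a vs. map ((#) (filter (\<lambda>y. X \<noteq> y) a)) vs @
      map ((#) (X # filter (\<lambda>y. X \<noteq> y) a)) vs) u [[]]" for X u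
    by (induction u) (simp_all add: removeAll_filter_not_eq)
  then show "effective (\<lambda>z. variants (fst z) (snd z))"
    by simp (intro effective_intros)
qed

lemma decidable_meets:
  "effective X \<Longrightarrow> effective Y \<Longrightarrow> effective u \<Longrightarrow> decidable (\<lambda>x. meets (X x) (Y x) (u x))"
  by (rule decidable_comp3[of meets]) (unfold meets_def, intro effective_intros)

lemma decidable_occurs: "effective X \<Longrightarrow> effective u \<Longrightarrow> decidable (\<lambda>x. occurs (X x) (u x))"
  by (rule decidable_comp2[of occurs]) (unfold occurs_def, intro effective_intros)

lemma decidable_before:
  "effective X \<Longrightarrow> effective Y \<Longrightarrow> effective u \<Longrightarrow> decidable (\<lambda>x. before (X x) (Y x) (u x))"
proof (rule decidable_comp3[of before])
  have "before X Y u \<longleftrightarrow> (\<exists>j\<in>set [0..<length u]. Y \<in> set (nth0 u j) \<and> (\<exists>i\<in>set [0..<j]. X \<in> set (nth0 u i)))"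
    for X Y and u :: "letter list"
    unfolding before_def by (intro bex_cong conj_cong refl) (auto simp: nth0_nth)
  then show "decidable (\<lambda>z. before (fst z) (fst (snd z)) (snd (snd z)))"
    by (simp only:) (intro effective_intros effective_nth0)
qed

text \<open>The set is filtered out of an initial segment of the natural numbers; the sum of the
  list bounds its members.\<close>

lemma effective_sorted_list:
  "effective l \<Longrightarrow> effective (\<lambda>x. sorted_list_of_set (set (l x)) :: nat list)"
proof (rule effective_comp[of "\<lambda>ys. sorted_list_of_set (set ys)"])
  have bound: "y \<le> foldr (\<lambda>a b. a + b) ys 0" if "y \<in> set ys" for y and ys :: "nat list"
    using that by (induction ys) auto
  have "sorted_list_of_set (set ys) = filter (\<lambda>y. y \<in> set ys) [0..<Suc (foldr (\<lambda>a b. a + b) ys 0)]"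
    for ys :: "nat list"
    by (rule sorted_distinct_set_unique)
       (auto simp: sorted_wrt_filter less_Suc_eq_le dest: bound simp del: upt_Suc)
  then show "effective (\<lambda>ys :: nat list. sorted_list_of_set (set ys))"
    by (simp only:) (intro effective_intros)
qed

text \<open>Recursion on the formula, in which the word is part of the argument: \<open>Ex\<close>
  calls its body on each of finitely many variants.\<close>

lemma effective_tp: "effective c \<Longrightarrow> effective u \<Longrightarrow> effective (\<lambda>x. tp (c x) (u x))"
proof (rule effective_comp2[of tp])
  let ?calls = "\<lambda>z. case fst z of Meet X Y \<Rightarrow> [] | Before X Y \<Rightarrow> []
    | Nand \<phi> \<chi> \<Rightarrow> [(\<phi>, snd z), (\<chi>, snd z)] | Ex X \<phi> \<Rightarrow> map (\<lambda>v. (\<phi>, v)) (variants X (snd z))"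
  let ?step = "\<lambda>z ys. case fst z of Meet X Y \<Rightarrow> of_bool (meets X Y (snd z))
    | Before X Y \<Rightarrow> prod_encode (of_bool (occurs X (snd z)),
        prod_encode (of_bool (occurs Y (snd z)), of_bool (before X Y (snd z))))
    | Nand \<phi> \<chi> \<Rightarrow> prod_encode (nth0 ys 0, nth0 ys 1)
    | Ex X \<phi> \<Rightarrow> enc (sorted_list_of_set (set ys))"
  show "effective (\<lambda>z. tp (fst z) (snd z))"
  proof (rule effective_wf_rec[where calls = ?calls and step = ?step])
    show "wf (measure (size \<circ> fst) :: ((core \<times> letter list) \<times> (core \<times> letter list)) set)"
      by (rule wf_measure)
    show "(y, z) \<in> measure (size \<circ> fst)" if "y \<in> set (?calls z)" for y z :: "core \<times> letter list"
      using that by (cases "fst z") auto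
    show "tp (fst z) (snd z) = ?step z (map (\<lambda>z. tp (fst z) (snd z)) (?calls z))" for z :: "core \<times> letter list"
      by (cases "fst z") (simp_all add: nth0_nth enc_list_def enc_nat_def[abs_def] comp_def)
    show "effective ?calls"
      by (intro effective_case_core effective_variants effective_intros)
    show "effective (\<lambda>z. ?step (fst z) (snd z))"
      by (intro effective_case_core effective_prod_encode effective_sorted_list effective_nth0
          decidable_meets decidable_occurs decidable_before effective_intros)
  qed
qed

lemma decidable_linked:
  "effective c \<Longrightarrow> effective u \<Longrightarrow> effective v \<Longrightarrow> decidable (\<lambda>x. linked (c x) (u x) (v x))"
  by (rule decidable_comp3[of linked]) (unfold linked_def, intro effective_intros effective_tp)

text \<open>The condition \<open>linked\<close> is built into the list of recursive calls; for
  \<open>Ex\<close> it then remains to ask whether some answer is 1.\<close>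

lemma decidable_lasso_sat:
  "effective c \<Longrightarrow> effective u \<Longrightarrow> effective v \<Longrightarrow> decidable (\<lambda>x. lasso_sat (c x) (u x) (v x))"
proof (rule decidable_comp3[of lasso_sat])
  let ?calls = "\<lambda>z. case fst z of Meet X Y \<Rightarrow> [] | Before X Y \<Rightarrow> []
    | Nand \<phi> \<chi> \<Rightarrow> [(\<phi>, snd z), (\<chi>, snd z)]
    | Ex X \<phi> \<Rightarrow> map (\<lambda>q. (\<phi>, q)) (filter (\<lambda>q. linked \<phi> (fst q) (snd q))
        (concat (map (\<lambda>u'. map (\<lambda>v'. (u', v')) (variants X (snd (snd z)))) (variants X (fst (snd z))))))"
  let ?step = "\<lambda>z ys. case fst z of Meet X Y \<Rightarrow> of_bool (meets X Y (fst (snd z))) :: nat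
    | Before X Y \<Rightarrow> of_bool (before X Y (fst (snd z)))
    | Nand \<phi> \<chi> \<Rightarrow> of_bool (\<not> (nth0 ys 0 = 1 \<and> nth0 ys 1 = 1))
    | Ex X \<phi> \<Rightarrow> of_bool (1 \<in> set ys)"
  let ?f = "\<lambda>z. of_bool (lasso_sat (fst z) (fst (snd z)) (snd (snd z))) :: nat"
  have bool_image: "Suc 0 \<in> (\<lambda>x. of_bool (p x)) ` A \<longleftrightarrow> (\<exists>x\<in>A. p x)"
    for p and A :: "(letter list \<times> letter list) set"
    by (auto simp: image_iff)
  have "effective ?f"
  proof (rule effective_wf_rec[where calls = ?calls and step = ?step])
    show "wf (measure (size \<circ> fst) :: ((core \<times> letter list \<times> letter list) \<times> (core \<times> letter list \<times> letter list)) set)"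
      by (rule wf_measure)
    show "(y, z) \<in> measure (size \<circ> fst)" if "y \<in> set (?calls z)" for y z :: "core \<times> letter list \<times> letter list"
      using that by (cases "fst z") auto
    show "?f z = ?step z (map ?f (?calls z))" for z :: "core \<times> letter list \<times> letter list"
      by (cases "fst z") (auto simp: nth0_nth bool_image)
    show "effective ?calls"
      by (intro effective_case_core effective_variants decidable_linked effective_intros)
    show "effective (\<lambda>z. ?step (fst z) (snd z))"
      by (intro effective_case_core effective_nth0 decidable_meets decidable_before effective_intros)
  qed
  then show "decidable (\<lambda>z. lasso_sat (fst z) (fst (snd z)) (snd (snd z)))"
    by (simp add: decidable_def)
qed

lemma effective_cell:
  "effective es \<Longrightarrow> effective q \<Longrightarrow> effective b \<Longrightarrow> effective p \<Longrightarrow> effective (\<lambda>x. cell (es x) (q x) (b x) (p x))"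
  unfolding cell_def by (intro effective_nth0 effective_intros)

lemma effective_emit:
  "effective k \<Longrightarrow> effective es \<Longrightarrow> effective q \<Longrightarrow> effective b \<Longrightarrow> effective p \<Longrightarrow>
    effective (\<lambda>x. emit (k x) (es x) (q x) (b x) (p x))"
  unfolding emit_def letter3_def by (intro effective_cell effective_intros)

lemma effective_bit_lists: "effective m \<Longrightarrow> effective (\<lambda>x. bit_lists (m x))"
proof -
  have eq: "bit_lists i = rec_nat [[]] (\<lambda>_ r. map ((#) 0) r @ map ((#) 1) r) i" for i
    by (induction i) auto
  show "effective m \<Longrightarrow> effective (\<lambda>x. bit_lists (m x))"
    unfolding eq by (intro effective_intros)
qed

text \<open>The values up to \<open>d + p\<close> form a constant list; for larger \<open>t\<close>
  the argument \<open>t - p\<close> still exceeds \<open>d\<close>, so periodicity applies.\<close>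

lemma effective_pbit:
  assumes "ultimately_periodic P"
  shows "effective (pbit P)"
proof -
  obtain p d where p: "p > 0" "\<And>n. n > d \<Longrightarrow> n \<in> P \<longleftrightarrow> n + p \<in> P"
    using assms unfolding ultimately_periodic_def by blast
  let ?calls = "\<lambda>t. if t \<le> d + p then [] else [t - p]"
  let ?step = "\<lambda>t ys. if t \<le> d + p then nth0 (map (pbit P) [0..<Suc (d + p)]) t else nth0 ys 0"
  show ?thesis
  proof (rule effective_wf_rec[where calls = ?calls and step = ?step])
    show "wf {(s, t). s < (t :: nat)}"
      by (rule wf_less)
    show "(s, t) \<in> {(s, t). s < t}" if "s \<in> set (?calls t)" for s t
      using that p(1) by (auto split: if_splits)
    show "pbit P t = ?step t (map (pbit P) (?calls t))" for t
    proof (cases "t \<le> d + p")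
      case True
      then show ?thesis
        by (simp add: nth0_nth del: upt_Suc)
    next
      case False
      then show ?thesis
        using p(2)[of "t - p"] by (simp add: nth0_nth pbit_def)
    qed
    show "effective ?calls" "effective (\<lambda>z. ?step (fst z) (snd z))"
      by (intro effective_nth0 effective_intros)+
  qed
qed

context
  fixes P :: "nat set"
  assumes P: "effective (pbit P)"
begin

lemma effective_final:
  "effective es \<Longrightarrow> effective q \<Longrightarrow> effective t \<Longrightarrow> effective bs \<Longrightarrow>
    effective (\<lambda>x. final (es x) P (q x) (t x) (bs x))"
proof (rule effective_comp4[of "\<lambda>es q t bs. final es P q t bs"])
  have "final es P q t bs =
      fst (foldl (\<lambda>s b. (fst (cell es (fst s) b (pbit P (snd s))), Suc (snd s))) (q, t) bs)" for es q t bs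
    by (induction bs arbitrary: q t) simp_all
  then show "effective (\<lambda>z. final (fst z) P (fst (snd z)) (fst (snd (snd z))) (snd (snd (snd z))))"
    by (simp only:) (intro effective_cell effective_comp[OF P] effective_intros)
qed

lemma effective_emitted:
  "effective k \<Longrightarrow> effective es \<Longrightarrow> effective q \<Longrightarrow> effective t \<Longrightarrow> effective bs \<Longrightarrow>
    effective (\<lambda>x. emitted (k x) (es x) P (q x) (t x) (bs x))"
proof (rule effective_comp5[of "\<lambda>k es q t bs. emitted k es P q t bs"])
  have "v @ emitted k es P q t bs =
      snd (snd (foldl (\<lambda>s b. (fst (cell es (fst s) b (pbit P (fst (snd s)))), Suc (fst (snd s)),
        snd (snd s) @ [emit k es (fst s) b (pbit P (fst (snd s)))])) (q, t, v) bs))" for k es q t bs v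
  proof (induction bs arbitrary: q t v)
    case (Cons b bs)
    show ?case
      using Cons.IH[of "v @ [emit k es q b (pbit P t)]" "fst (cell es q b (pbit P t))" "Suc t"] by simp
  qed simp
  from this[of "[]"] have "emitted k es P q t bs =
      snd (snd (foldl (\<lambda>s b. (fst (cell es (fst s) b (pbit P (fst (snd s)))), Suc (fst (snd s)),
        snd (snd s) @ [emit k es (fst s) b (pbit P (fst (snd s)))])) (q, t, []) bs))" for k es q t bs
    by simp
  then show "effective (\<lambda>z. emitted (fst z) (fst (snd z)) P (fst (snd (snd z))) (fst (snd (snd (snd z))))
      (snd (snd (snd (snd z)))))"
    by (simp only:) (intro effective_cell effective_emit effective_comp[OF P] effective_intros)
qed

lemma decidable_verified:
  "decidable (\<lambda>z. verified (fst z) P (fst (snd z)) (fst (snd (snd z))) (fst (snd (snd (snd z))))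
     (fst (snd (snd (snd (snd z))))) (snd (snd (snd (snd (snd z))))))"
  unfolding verified_def
  by (intro effective_final effective_emitted effective_tp decidable_linked decidable_lasso_sat
      effective_bit_lists effective_intros)

end

lemma decidable_valid_table:
  "decidable (\<lambda>z. valid_table (fst z) (fst (snd z)) (snd (snd z)))"
  unfolding valid_table_def by (intro effective_intros)

text \<open>Decoding and translation in one recursion on numbers: \<open>mlo_code\<close> is not
  onto, so \<open>mlo\<close> does not become \<open>encodable\<close> through it. Every tag above 5
  is read as \<open>ExS\<close>.\<close>

function decode_core :: "nat \<Rightarrow> core" where
  "decode_core n = (let t = fst (prod_decode n); r = snd (prod_decode n);
       x = fst (prod_decode r); y = snd (prod_decode r) in
     if t = 0 then Before (2 * x) (2 * y)
     else if t = 1 then Meet (2 * x) (2 * y)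
     else if t = 2 then Meet (2 * x) (Suc (2 * y))
     else if t = 3 then cNot (decode_core r)
     else if t = 4 then cAnd (decode_core x) (decode_core y)
     else if t = 5 then
       Ex (2 * x) (cAnd (cAnd (Meet (2 * x) (2 * x)) (cNot (Before (2 * x) (2 * x)))) (decode_core y))
     else Ex (Suc (2 * x)) (decode_core y))"
  by auto

lemma decode_core_less:
  assumes "0 < fst (prod_decode n)"
  shows "snd (prod_decode n) < n" "fst (prod_decode (snd (prod_decode n))) < n"
    "snd (prod_decode (snd (prod_decode n))) < n"
proof -
  show r: "snd (prod_decode n) < n"
    using less_prod_encode[OF assms, of "snd (prod_decode n)"] by simp
  show "fst (prod_decode (snd (prod_decode n))) < n" "snd (prod_decode (snd (prod_decode n))) < n"
    using r le_prod_encode_1[of "fst (prod_decode (snd (prod_decode n)))" "snd (prod_decode (snd (prod_decode n)))"]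
      le_prod_encode_2[of "snd (prod_decode (snd (prod_decode n)))" "fst (prod_decode (snd (prod_decode n)))"]
    by simp_all
qed

termination decode_core
  by (relation "measure id") (auto intro: decode_core_less)

declare decode_core.simps [simp del]

lemma decode_core_mlo_code: "decode_core (mlo_code \<psi>) = to_core \<psi>"
  by (induction \<psi>) (subst decode_core.simps, simp)+

lemma effective_decode_core: "effective decode_core"
proof -
  let ?t = "\<lambda>n. fst (prod_decode n)" and ?r = "\<lambda>n. snd (prod_decode n)"
  let ?calls = "\<lambda>n. if ?t n = 0 then [] else [?r n, ?t (?r n), ?r (?r n)]"
  let ?step = "\<lambda>n ys. let x = ?t (?r n); y = ?r (?r n) in
     if ?t n = 0 then Before (2 * x) (2 * y)
     else if ?t n = 1 then Meet (2 * x) (2 * y)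
     else if ?t n = 2 then Meet (2 * x) (Suc (2 * y))
     else if ?t n = 3 then cNot (nth0 ys 0)
     else if ?t n = 4 then cAnd (nth0 ys 1) (nth0 ys 2)
     else if ?t n = 5 then
       Ex (2 * x) (cAnd (cAnd (Meet (2 * x) (2 * x)) (cNot (Before (2 * x) (2 * x)))) (nth0 ys 2))
     else Ex (Suc (2 * x)) (nth0 ys 2)"
  show ?thesis
  proof (rule effective_wf_rec[where calls = ?calls and step = ?step])
    show "wf {(s, t). s < (t :: nat)}"
      by (rule wf_less)
    show "(m, n) \<in> {(s, t). s < t}" if "m \<in> set (?calls n)" for m n
      using that decode_core_less[of n] by (auto split: if_splits)
    show "decode_core n = ?step n (map decode_core (?calls n))" for n
      by (subst decode_core.simps) (simp add: Let_def nth0_nth)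
    show "effective ?calls"
      by (intro effective_intros)
    show "effective (\<lambda>z. ?step (fst z) (snd z))"
      unfolding Let_def
      by (intro effective_Meet effective_Before effective_Nand effective_Ex effective_nth0 effective_intros)
  qed
qed

section \<open>Finite state operators as tables\<close>

lemma mealy_finite_state: "mealy {..<n :: nat} q0 \<delta> out F \<Longrightarrow> finite_state_C F"
  unfolding finite_state_C_def by (intro conjI) (erule mealy_causal, blast)

lemma moore_finite_state: "moore {..<n :: nat} q0 \<delta> out F \<Longrightarrow> finite_state_SC F"
  unfolding finite_state_SC_def by (intro conjI) (erule moore_strongly_causal, blast)

abbreviation bits :: "nat set \<Rightarrow> nat \<Rightarrow> nat" where
  "bits X t \<equiv> of_bool (t \<in> X)"

lemma machine_word_mealy:
  assumes F: "mealy {..<n} q0 \<delta> out F"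
    and cell: "\<And>q x p. q < n \<Longrightarrow> cell es q (of_bool x) (of_bool p) = (\<delta> q (x, p), of_bool (out q (x, p)))"
  shows "machine_word 0 es P q0 (bits X) = word3 X (apply2 F X P) P"
proof
  fix t
  let ?a = "\<lambda>s. (s \<in> X, s \<in> P)"
  have lt: "state_after \<delta> q0 ?a t < n" for t
    using state_after_in[of "{..<n}" q0 \<delta> ?a t] F by (simp add: mealy_def)
  have state: "machine_state es P q0 (bits X) t = state_after \<delta> q0 ?a t" for t
    by (induction t) (simp_all add: machine_state_Suc pbit_def cell[OF lt])
  show "machine_word 0 es P q0 (bits X) t = word3 X (apply2 F X P) P t"
    using F by (simp add: machine_word_def emit_def state pbit_def cell[OF lt] word3_def apply2_def mealy_def)
qed

lemma machine_word_moore: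
  assumes G: "moore {..<n} q0 \<delta> out G"
    and cell: "\<And>q y p. q < n \<Longrightarrow> fst (cell es q (of_bool y) (of_bool p)) = \<delta> q (y, p)"
      "\<And>q. q < n \<Longrightarrow> snd (cell es q 0 0) = 1 \<longleftrightarrow> out q"
    and k: "k \<noteq> 0"
  shows "machine_word k es P q0 (bits Y) = word3 (apply2 G Y P) Y P"
proof
  fix t
  let ?a = "\<lambda>s. (s \<in> Y, s \<in> P)"
  have lt: "state_after \<delta> q0 ?a t < n" for t
    using state_after_in[of "{..<n}" q0 \<delta> ?a t] G by (simp add: moore_def)
  have state: "machine_state es P q0 (bits Y) t = state_after \<delta> q0 ?a t" for t
    by (induction t) (simp_all add: machine_state_Suc pbit_def cell(1)[OF lt])
  show "machine_word k es P q0 (bits Y) t = word3 (apply2 G Y P) Y P t"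
    using G k cell(2)[OF lt[of t]]
    by (simp add: machine_word_def emit_def state pbit_def word3_def apply2_def moore_def)
qed

lemma table_exists:
  assumes "q0 < n" "\<And>q x p. q < n \<Longrightarrow> \<delta> q (x, p) < n"
  obtains es where "valid_table n q0 es"
    "\<And>q x p. q < n \<Longrightarrow> cell es q (of_bool x) (of_bool p) = (\<delta> q (x, p), of_bool (out q (x, p)))"
proof -
  \<comment> \<open>Inverts the index \<open>4 * q + 2 * x + p\<close>: the quotient by 4 is the
    state, the two lowest bits are the letter.\<close>
  define f where "f i = (\<delta> (i div 4) (odd (i div 2), odd i), of_bool (out (i div 4) (odd (i div 2), odd i)) :: nat)"
    for i
  define es where "es = map f [0..<4 * n]"
  have digits: "(4 * q + 2 * i + j) div 4 = q" "odd ((4 * q + 2 * i + j) div 2) \<longleftrightarrow> i = 1"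
    "odd (4 * q + 2 * i + j) \<longleftrightarrow> j = 1" if "i \<le> 1" "j \<le> 1" for q i j :: nat
    using that by presburger+
  have "f (4 * q + 2 * of_bool x + of_bool p) = (\<delta> q (x, p), of_bool (out q (x, p)))" for q x p
    unfolding f_def by (subst digits, simp, simp)+ simp
  moreover have "4 * q + 2 * of_bool x + of_bool p < 4 * n" if "q < n" for q x p
    using that by (cases x; cases p) auto
  ultimately have "cell es q (of_bool x) (of_bool p) = (\<delta> q (x, p), of_bool (out q (x, p)))"
    if "q < n" for q x p
    using that by (simp add: cell_def es_def nth0_nth)
  moreover have "valid_table n q0 es"
    using assms by (auto simp: valid_table_def es_def f_def)
  ultimately show thesis
    using that by blast
qed

lemma residual_period:
  assumes "ultimately_periodic P"
  obtains K where "0 < K" "\<And>t. K \<le> t \<Longrightarrow> residual P (t + K) = residual P t"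
proof -
  obtain p d where p: "p > 0" "\<And>n. n > d \<Longrightarrow> n \<in> P \<longleftrightarrow> n + p \<in> P"
    using assms unfolding ultimately_periodic_def by blast
  have one: "residual P (t + p) = residual P t" if "d < t" for t
    using p(2)[of "_ + t"] that by (auto simp: residual_def algebra_simps)
  have many: "residual P (t + c * p) = residual P t" if "d < t" for t c
  proof (induction c)
    case (Suc c)
    then show ?case
      using one[of "t + c * p"] that by (simp add: algebra_simps)
  qed simp
  \<comment> \<open>A multiple of the period that exceeds \<open>d\<close> serves both as the period
    and as the threshold \<open>K\<close>.\<close>
  have "d < Suc d * p"
    using p(1) by (cases p) auto
  then show thesis
    using that[of "Suc d * p"] p(1) many[of _ "Suc d"] by simp
qed

lemma machine_word_bits:
  assumes "\<And>t. b t \<in> {0, 1 :: nat}"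
  shows "b = bits {t. b t = 1}"
proof
  show "b t = bits {t. b t = 1} t" for t
    using assms[of t] by auto
qed

text \<open>Termination of the search: the dichotomy supplies a machine of one of the players, and
  completeness a length at which the test succeeds.\<close>

lemma verified_table_exists:
  assumes P: "ultimately_periodic P" and K: "0 < K" "\<And>t. K \<le> t \<Longrightarrow> residual P (t + K) = residual P t"
  shows "\<exists>k n q0 es j. valid_table n q0 es \<and> verified \<phi> P k n q0 es (Suc j * K)"
  using synthesis_dichotomy[OF P, of \<phi>]
proof (elim disjE exE conjE)
  fix n :: nat and q0 \<delta> out F
  assume F: "mealy {..<n} q0 \<delta> out F" "\<forall>X. csat \<phi> (word3 X (apply2 F X P) P)"
  obtain es where es: "valid_table n q0 es"
    "\<And>q x p. q < n \<Longrightarrow> cell es q (of_bool x) (of_bool p) = (\<delta> q (x, p), of_bool (out q (x, p)))"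
    by (rule table_exists[of q0 n \<delta> out]) (use F(1) in \<open>auto simp: mealy_def transition_system_def\<close>)
  have "csat \<phi> (machine_word 0 es P q0 b) \<longleftrightarrow> (0 :: nat) = 0" if "\<And>t. b t \<in> {0, 1}" for b
    using F(2) machine_word_mealy[OF F(1) es(2)] machine_word_bits[of b, OF that] by metis
  then show ?thesis
    using verified_complete[OF es(1) K(2,1), of \<phi> 0] es(1) by blast
next
  fix n :: nat and q0 \<delta> out G
  assume G: "moore {..<n} q0 \<delta> out G" "\<forall>Y. \<not> csat \<phi> (word3 (apply2 G Y P) Y P)"
  obtain es where es: "valid_table n q0 es"
    "\<And>q x p. q < n \<Longrightarrow> cell es q (of_bool x) (of_bool p) = (\<delta> q (x, p), of_bool (out q))"
    by (rule table_exists[of q0 n \<delta> "\<lambda>q _. out q"]) (use G(1) in \<open>auto simp: moore_def transition_system_def\<close>)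
  have "machine_word 1 es P q0 (bits Y) = word3 (apply2 G Y P) Y P" for Y
    by (rule machine_word_moore[OF G(1)]) (use es(2) es(2)[of _ False False] in simp_all)
  then have "csat \<phi> (machine_word 1 es P q0 b) \<longleftrightarrow> (1 :: nat) = 0" if "\<And>t. b t \<in> {0, 1}" for b
    using G(2) machine_word_bits[of b, OF that] by (metis zero_neq_one)
  then show ?thesis
    using verified_complete[OF es(1) K(2,1), of \<phi> 1] es(1) by blast
qed

lemma verified_mealy:
  assumes valid: "valid_table n q0 es" and per: "\<And>t. N \<le> t \<Longrightarrow> residual P (t + N) = residual P t"
    and verified: "verified \<phi> P 0 n q0 es N" and N: "0 < N"
  defines "T \<equiv> (q0, map (\<lambda>(q, y). (q, y = 1)) es)"
  shows "\<exists>F. presents T F \<and> finite_state_C F \<and> (\<forall>X. csat \<phi> (word3 X (apply2 F X P) P))"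
proof -
  let ?es = "map (\<lambda>(q, y). (q, y = 1)) es"
  define \<delta> where "\<delta> q a = fst (entry ?es q a)" for q a
  define out where "out q a = snd (entry ?es q a)" for q a
  define F where "F a i = out (state_after \<delta> q0 a i) (a i)" for a i
  have ix: "4 * q + 2 * of_bool x + of_bool p < length es" if "q < n" for q x p
    using that valid by (cases x; cases p) (auto simp: valid_table_def)
  have cell: "cell es q (of_bool x) (of_bool p) = (\<delta> q (x, p), of_bool (out q (x, p)))" if "q < n" for q x p
  proof -
    let ?e = "es ! (4 * q + 2 * of_bool x + of_bool p)"
    have "?e \<in> set es"
      using ix[OF that] by (rule nth_mem)
    then have "snd ?e \<le> 1"
      using valid by (auto simp: valid_table_def)
    then show ?thesis
      using ix[OF that, of x p]
      by (cases ?e) (auto simp: cell_def nth0_nth \<delta>_def out_def entry_def)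
  qed
  have "\<delta> q a < n" if "q < n" for q a
  proof -
    obtain x p where a: "a = (x, p)" by (cases a)
    have "cell es q (of_bool x) (of_bool p) \<in> set es"
      using ix[OF that, of x p] by (simp add: cell_def nth0_nth)
    then have "fst (cell es q (of_bool x) (of_bool p)) < n"
      using valid by (auto simp: valid_table_def)
    then show ?thesis
      using cell[OF that, of x p] a by simp
  qed
  then have F: "mealy {..<n} q0 \<delta> out F"
    using valid by (simp add: mealy_def transition_system_def F_def valid_table_def)
  moreover have "presents T F"
    unfolding presents_def T_def using valid F
    by (auto simp: valid_table_def \<delta>_def[abs_def] out_def[abs_def])
  moreover have "csat \<phi> (word3 X (apply2 F X P) P)" for X
    using verified_sound[OF valid per verified N, of "bits X"] machine_word_mealy[OF F cell] by simp
  ultimately show ?thesis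
    using mealy_finite_state by blast
qed

lemma verified_moore:
  assumes valid: "valid_table n q0 es" and per: "\<And>t. N \<le> t \<Longrightarrow> residual P (t + N) = residual P t"
    and verified: "verified \<phi> P k n q0 es N" and N: "0 < N" and k: "k \<noteq> 0"
  shows "\<exists>G. finite_state_SC G \<and> (\<forall>Y. \<not> csat \<phi> (word3 (apply2 G Y P) Y P))"
proof -
  define \<delta> where "\<delta> q a = fst (cell es q (of_bool (fst a)) (of_bool (snd a)))" for q and a :: "bool \<times> bool"
  define out where "out q \<longleftrightarrow> snd (cell es q 0 0) = 1" for q
  define G where "G a i = out (state_after \<delta> q0 a i)" for a i
  have ix: "4 * q + 2 * of_bool x + of_bool p < length es" if "q < n" for q x p
    using that valid by (cases x; cases p) (auto simp: valid_table_def)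
  have "\<delta> q a < n" if "q < n" for q a
  proof -
    have "cell es q (of_bool (fst a)) (of_bool (snd a)) \<in> set es"
      using ix[OF that, of "fst a" "snd a"] by (simp add: cell_def nth0_nth)
    then show ?thesis
      using valid by (auto simp: valid_table_def \<delta>_def)
  qed
  then have G: "moore {..<n} q0 \<delta> out G"
    using valid by (simp add: moore_def transition_system_def G_def valid_table_def)
  have "machine_word k es P q0 (bits Y) = word3 (apply2 G Y P) Y P" for Y
    by (rule machine_word_moore[OF G _ _ k]) (simp_all add: \<delta>_def out_def)
  then have "\<not> csat \<phi> (word3 (apply2 G Y P) Y P)" for Y
    using verified_sound[OF valid per verified N, of "bits Y"] k by simp
  then show ?thesis
    using moore_finite_state[OF G] by blast
qed

section \<open>The two alternatives exclude each other\<close>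

text \<open>Each application of \<open>H\<close> settles one more letter, whatever the initial
  string; the letter at \<open>t\<close> is final after \<open>Suc t\<close> rounds.\<close>

lemma strongly_causal_fixed_point:
  fixes H :: "(nat \<Rightarrow> 'a) \<Rightarrow> nat \<Rightarrow> 'a"
  assumes H: "\<And>a a' t. (\<And>i. i < t \<Longrightarrow> a i = a' i) \<Longrightarrow> H a t = H a' t"
  shows "\<exists>y. H y = y"
proof -
  fix b :: "nat \<Rightarrow> 'a"
  define y where "y t = (H ^^ Suc t) b t" for t
  have stable: "\<forall>i<n. (H ^^ Suc n) b i = (H ^^ n) b i" for n
  proof (induction n)
    case (Suc n)
    show ?case
    proof (intro allI impI)
      fix i assume "i < Suc n"
      have "H ((H ^^ Suc n) b) i = H ((H ^^ n) b) i"
        by (rule H) (use Suc \<open>i < Suc n\<close> in auto)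
      then show "(H ^^ Suc (Suc n)) b i = (H ^^ Suc n) b i"
        by simp
    qed
  qed simp
  have agree: "(H ^^ n) b i = y i" if "i < n" for i n
    using Suc_leI[OF that]
  proof (induction n rule: dec_induct)
    case base
    then show ?case
      by (simp add: y_def)
  next
    case (step n)
    then show ?case
      using stable[of n] by simp
  qed
  have "H y t = y t" for t
  proof -
    have "H y t = H ((H ^^ t) b) t"
      by (rule H) (use agree in auto)
    then show ?thesis
      by (simp add: y_def)
  qed
  then show ?thesis
    by blast
qed

text \<open>\<open>F\<close> applied to the output of \<open>G\<close> is strongly causal in
  \<open>Y\<close>; a fixed point is a play that follows both operators, and \<open>W\<close> would
  have to hold and to fail for it.\<close>

lemma not_both_win:
  assumes F: "finite_state_C F" "\<forall>X. W X (apply2 F X P)" and G: "finite_state_SC G" "\<forall>Y. \<not> W (apply2 G Y P) Y"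
  shows False
proof -
  define H where "H a t = F (\<lambda>s. (s \<in> apply2 G {s. a s} P, s \<in> P)) t" for a t
  have causal: "H a t = H a' t" if "\<And>i. i < t \<Longrightarrow> a i = a' i" for a a' t
  proof -
    have "G (\<lambda>s. (s \<in> {s. a s}, s \<in> P)) i = G (\<lambda>s. (s \<in> {s. a' s}, s \<in> P)) i" if "i \<le> t" for i
      using G(1)[unfolded finite_state_SC_def strongly_causal_def, THEN conjunct1, rule_format,
          of t "\<lambda>s. (s \<in> {s. a s}, s \<in> P)" "\<lambda>s. (s \<in> {s. a' s}, s \<in> P)" i]
        that \<open>\<And>i. i < t \<Longrightarrow> a i = a' i\<close> by simp
    then show ?thesis
      unfolding H_def
      using F(1)[unfolded finite_state_C_def causal_def, THEN conjunct1, rule_format,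
          of t "\<lambda>s. (s \<in> apply2 G {s. a s} P, s \<in> P)" "\<lambda>s. (s \<in> apply2 G {s. a' s} P, s \<in> P)" t]
      by (simp add: apply2_def)
  qed
  have "\<exists>y. H y = y"
    by (rule strongly_causal_fixed_point) (rule causal)
  then obtain y where y: "H y = y" ..
  have "apply2 F (apply2 G {s. y s} P) P = {s. H y s}"
    by (simp add: apply2_def[of F] H_def)
  then have "apply2 F (apply2 G {s. y s} P) P = {s. y s}"
    using y by simp
  then show False
    using F(2) G(2) by metis
qed

section \<open>The algorithm\<close>

text \<open>The search yields tables with numerical output bits; as these are at most 1, the code is
  that of the table with truth values.\<close>

lemma enc_table:
  assumes "valid_table n q0 es"
  shows "enc (q0, es) = machine_code (q0, map (\<lambda>(q, y). (q, y = 1)) es)"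
proof -
  have eq: "map enc es = map ((\<lambda>(q, b). prod_encode (q, of_bool b)) \<circ> (\<lambda>(q, y). (q, y = 1))) es"
  proof (rule map_cong[OF refl])
    fix e assume "e \<in> set es"
    then have "snd e = 0 \<or> snd e = 1"
      using assms by (fastforce simp: valid_table_def)
    then show "enc e = ((\<lambda>(q, b). prod_encode (q, of_bool b)) \<circ> (\<lambda>(q, y). (q, y = 1))) e"
      by (cases e) (auto simp: enc_prod_def enc_nat_def)
  qed
  show ?thesis
    unfolding machine_code_def case_prod_conv map_map enc_prod_def[of "(q0, es)"] enc_list_def
    by (simp only: fst_conv snd_conv enc_nat_def[of q0] eq)
qed

theorem Problem4_computable_if_ultimately_periodic:
  assumes P: "ultimately_periodic P"
  shows "Problem4_computable P"
proof -
  obtain K where K: "0 < K" "\<And>t. K \<le> t \<Longrightarrow> residual P (t + K) = residual P t"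
    using residual_period[OF P] by blast
  have per: "residual P (t + Suc j * K) = residual P t" if "Suc j * K \<le> t" for t j
    by (rule residual_mult[OF K(2)]) (use that in auto)
  \<comment> \<open>A candidate consists of the kind, the number of states, the initial state, the
    table and a number \<open>j\<close> that fixes the test length \<open>Suc j * K\<close>.\<close>
  define good where "good n y \<longleftrightarrow> valid_table (fst (snd y)) (fst (snd (snd y))) (fst (snd (snd (snd y)))) \<and>
      verified (decode_core n) P (fst y) (fst (snd y)) (fst (snd (snd y))) (fst (snd (snd (snd y))))
        (Suc (snd (snd (snd (snd y)))) * K)"
    for n and y :: "nat \<times> nat \<times> nat \<times> (nat \<times> nat) list \<times> nat"
  have dec: "decidable (\<lambda>z. good (fst z) (snd z))"
    unfolding good_def
    by (intro decidable_conj decidable_comp[OF decidable_valid_table, of "\<lambda>z. (_ z, _ z, _ z)", simplified]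
        decidable_comp[OF decidable_verified[OF effective_pbit[OF P]],
          of "\<lambda>z. (_ z, _ z, _ z, _ z, _ z, _ z)", simplified]
        effective_comp[OF effective_decode_core] effective_intros)
  \<comment> \<open>The dichotomy holds for every core formula, hence for whatever
    \<open>decode_core\<close> makes of a number that codes no formula; so the search is
    total.\<close>
  have ex: "\<exists>y. good n y" for n
    using verified_table_exists[OF P K, of "decode_core n"] unfolding good_def by fastforce
  obtain f where f: "effective f" "\<And>n. good n (f n)"
    using effective_search[OF dec ex] by blast
  define h where "h n = (if fst (f n) = 0
      then Suc (enc (fst (snd (snd (f n))), fst (snd (snd (snd (f n)))))) else 0)" for n
  have "effective h"
    unfolding h_def[abs_def] by (intro effective_comp[OF f(1)] effective_intros)
  then have "computable h"
    by (simp add: effective_def enc_nat_def)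
  moreover have "if \<exists>F. C_solution \<psi> P F
      then \<exists>T F. h (mlo_code \<psi>) = Suc (machine_code T) \<and> presents T F \<and> C_solution \<psi> P F
      else h (mlo_code \<psi>) = 0" if \<psi>: "formula_XYP \<psi>" for \<psi>
  proof -
    obtain k n q0 es j where y: "f (mlo_code \<psi>) = (k, n, q0, es, j)"
      by (metis surj_pair)
    then have valid: "valid_table n q0 es" and ver: "verified (to_core \<psi>) P k n q0 es (Suc j * K)"
      using f(2)[of "mlo_code \<psi>"] by (simp_all add: good_def decode_core_mlo_code)
    have pos: "0 < Suc j * K"
      using K(1) by simp
    show ?thesis
    proof (cases "k = 0")
      case True
      let ?T = "(q0, map (\<lambda>(q, y). (q, y = 1)) es)"
      obtain F where F: "presents ?T F" "finite_state_C F"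
        "\<forall>X. csat (to_core \<psi>) (word3 X (apply2 F X P) P)"
        using verified_mealy[OF valid per ver[unfolded True] pos] by blast
      have "C_solution \<psi> P F"
        using F holds_iff_csat[OF \<psi>] by (simp add: C_solution_def)
      moreover have "h (mlo_code \<psi>) = Suc (machine_code ?T)"
        using y True enc_table[OF valid] by (simp add: h_def)
      ultimately show ?thesis
        using F(1) by auto
    next
      case False
      obtain G where G: "finite_state_SC G" "\<forall>Y. \<not> csat (to_core \<psi>) (word3 (apply2 G Y P) Y P)"
        using verified_moore[OF valid per ver pos False] by blast
      have "\<not> C_solution \<psi> P F" for F
        using not_both_win[of F "\<lambda>X Y. csat (to_core \<psi>) (word3 X Y P)" P G] G holds_iff_csat[OF \<psi>]
        by (auto simp: C_solution_def)
      then show ?thesis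
        using y False by (simp add: h_def)
    qed
  qed
  ultimately show ?thesis
    unfolding Problem4_computable_def by blast
qed

theorem theorem1p3:
  fixes P :: "nat set"
  shows "(ultimately_periodic P \<longleftrightarrow>
           (\<forall>\<psi>. formula_XYP \<psi> \<longrightarrow>
              (\<exists>F. finite_state_C F \<and> (\<forall>X. holds \<psi> X (apply2 F X P) P)) \<or>
              (\<exists>G. finite_state_SC G \<and> (\<forall>Y. \<not> holds \<psi> (apply2 G Y P) Y P))))
         \<and> (ultimately_periodic P \<longrightarrow> Problem4_computable P)"
proof (intro conjI iffI impI allI)
  fix \<psi> assume P: "ultimately_periodic P" and \<psi>: "formula_XYP \<psi>"
  show "(\<exists>F. finite_state_C F \<and> (\<forall>X. holds \<psi> X (apply2 F X P) P)) \<or>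
      (\<exists>G. finite_state_SC G \<and> (\<forall>Y. \<not> holds \<psi> (apply2 G Y P) Y P))"
    using synthesis_dichotomy[OF P, of "to_core \<psi>"] mealy_finite_state moore_finite_state
    unfolding holds_iff_csat[OF \<psi>] by blast
next
  assume "\<forall>\<psi>. formula_XYP \<psi> \<longrightarrow>
      (\<exists>F. finite_state_C F \<and> (\<forall>X. holds \<psi> X (apply2 F X P) P)) \<or>
      (\<exists>G. finite_state_SC G \<and> (\<forall>Y. \<not> holds \<psi> (apply2 G Y P) Y P))"
  \<comment> \<open>The first alternative is tried on \<open>X = {}\<close>. Against the second,
    \<open>Y\<close> is the correct prediction, which satisfies the formula whatever
    \<open>G\<close> plays.\<close>
  then consider F where "finite_state_C F" "holds predict_next {} (apply2 F {} P) P"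
    | G where "\<not> holds predict_next (apply2 G {t. Suc t \<in> P} P) {t. Suc t \<in> P} P"
    using formula_predict_next by blast
  then show "ultimately_periodic P"
  proof cases
    case 1
    then show ?thesis
      by (rule ultimately_periodic_if_predicted)
  next
    case 2
    then show ?thesis
      by (simp add: holds_predict_next)
  qed
qed (rule Problem4_computable_if_ultimately_periodic)

end
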